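(* Let $k$ be an algebraically closed field of characteristic $0$, let $\psi:C\to E$ be a covering of odd degree $n$ from a genus $2$ curve $C$ to an elliptic curve $E$ over $k$, and let $\phi:\mathbb P^1\to\mathbb P^1$ be the covering induced by $\psi$. Then $\psi$ induces a partition of the set of $6$ Weierstrass points of $C$ into two sets $W^{(1)}$ and $W^{(2)}$, each of cardinality $3$, such that $|\phi(W^{(1)})|=1$ and $|\phi(W^{(2)})|=3$ (Weierstrass points being identified with their images in $\mathbb P^1$). Moreover the ramification structure of $\phi$ is as follows. Case I (the generic case: $\psi$ has two ramification points of index $2$ lying in different fibers): $$\left((2)^{\frac{n-1}2},(2)^{\frac{n-1}2},(2)^{\frac{n-1}2},(2)^{\frac{n-3}2},(2)^1\right);$$ or one of the following degenerate cases. Case II ($\psi$ has two ramification points of index $2$ lying in the same fiber): one of i) $\left((2)^{\frac{n-1}2},(2)^{\frac{n-1}2},(2)^{\frac{n-1}2},(4)^1(2)^{\frac{n-7}2}\right)$, ii) $\left((2)^{\frac{n-1}2},(2)^{\frac{n-1}2},(2)^{\frac{n-1}2},(2)^{\frac{n-1}2}\right)$, iii) $\left((2)^{\frac{n-1}2},(2)^{\frac{n-1}2},(4)^1(2)^{\frac{n-5}2},(2)^{\frac{n-3}2}\right)$. Case III ($\psi$ has one ramification point, of index $3$): one of i) $\left((2)^{\frac{n-1}2},(2)^{\frac{n-1}2},(2)^{\frac{n-1}2},(3)^1(2)^{\frac{n-5}2}\right)$, ii) $\left((2)^{\frac{n-1}2},(2)^{\frac{n-1}2},(3)^1(2)^{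\frac{n-3}2},(2)^{\frac{n-3}2}\right)$.
   Context: Let $w$ be the hyperelliptic involution of $C$; the origin of $E$ is chosen so that $\psi\circ w=-\psi$. Let $\pi_C:C\to\mathbb P^1=C/\langle w\rangle$ and $\pi_E:E\to\mathbb P^1=E/\langle -1\rangle$ be the natural degree 2 projections; the induced covering $\phi$ is the degree $n$ map with $\phi\circ\pi_C=\pi_E\circ\psi$. By Riemann–Hurwitz, $\psi$ is ramified either at exactly two points, each of index 2, or at exactly one point, of index 3. Notation for ramification structures: entries separated by commas describe the fibers over the different branch points of $\phi$ (the order of entries is immaterial; entries correspond to the four points of $\pi_E(E[2])$, together with one further point in the five-entry case); $(m)^r$ means that the fiber contains $r$ points of ramification index $m$; unramified points in a fiber are not written. An entry $(2)^0$ with nothing else denotes an unramified fiber; a case in which a negative exponent appears does not occur for that $n$. *)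

theory Defs
  imports "HOL-Computational_Algebra.Computational_Algebra" "HOL-Library.Poly_Mapping"
begin

section \<open>Curves as function fields\<close>

text \<open>
  A smooth projective curve over \<open>k\<close> is represented by its function field \<open>K\<close> (a type of class
  \<^class>\<open>field\<close>) together with the structure map \<open>i :: k \<Rightarrow> K\<close>; a nonconstant morphism
  \<open>X \<rightarrow> Y\<close> is represented by its comorphism, a homomorphism \<open>K(Y) \<Rightarrow> K(X)\<close> of \<open>k\<close>-algebras.
  As homomorphisms of fields are injective, nonconstancy is automatic, and composition is reversed.
\<close>

definition field_hom :: "('a::field \<Rightarrow> 'b::field) \<Rightarrow> bool" where
  "field_hom h \<longleftrightarrow>
     h 1 = 1 \<and> (\<forall>x y. h (x + y) = h x + h y) \<and> (\<forall>x y. h (x * y) = h x * h y)"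

text \<open>\<open>covering i j h\<close>: \<open>h\<close> is the comorphism of a covering from the curve \<open>i\<close> to the curve \<open>j\<close>.\<close>

definition covering :: "('k \<Rightarrow> 'a::field) \<Rightarrow> ('k \<Rightarrow> 'b::field) \<Rightarrow> ('b \<Rightarrow> 'a) \<Rightarrow> bool" where
  "covering i j h \<longleftrightarrow> field_hom h \<and> (\<forall>c. h (j c) = i c)"

definition automorphism :: "('k \<Rightarrow> 'a::field) \<Rightarrow> ('a \<Rightarrow> 'a) \<Rightarrow> bool" where
  "automorphism i h \<longleftrightarrow> covering i i h \<and> bij h"

text \<open>The projective line, with function field \<open>k(X)\<close>.\<close>

definition P1 :: "'k::field \<Rightarrow> 'k poly fract" where
  "P1 c = to_fract [:c:]"

text \<open>\<open>K\<close> is a finite extension of a rational function field \<open>k(x)\<close> inside \<open>K\<close>.\<close>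

definition function_field :: "('k::field \<Rightarrow> 'a::field) \<Rightarrow> bool" where
  "function_field i \<longleftrightarrow> field_hom i \<and>
     (\<exists>h B. covering i P1 h \<and> finite B \<and> module.span (\<lambda>a z. h a * z) B = UNIV)"

text \<open>The degree of the field extension; this is \<open>0\<close> for an infinite extension.\<close>

definition map_degree :: "('b::field \<Rightarrow> 'a::field) \<Rightarrow> nat" where
  "map_degree h = vector_space.dim (\<lambda>a z. h a * z) (UNIV :: 'a set)"


section \<open>Points and ramification\<close>

text \<open>
  The points are the normalized discrete valuations of \<open>K\<close> that are trivial on \<open>k\<close>.
  The value at \<open>0\<close>, which should be infinite, is set to \<open>0\<close>, to make the valuation unique.
\<close>

definition points :: "('k::zero \<Rightarrow> 'a::field) \<Rightarrow> ('a \<Rightarrow> int) set" where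
  "points i = {v. v 0 = 0
     \<and> (\<forall>x y. x \<noteq> 0 \<longrightarrow> y \<noteq> 0 \<longrightarrow> v (x * y) = v x + v y)
     \<and> (\<forall>x y. x \<noteq> 0 \<longrightarrow> y \<noteq> 0 \<longrightarrow> x + y \<noteq> 0 \<longrightarrow> min (v x) (v y) \<le> v (x + y))
     \<and> (\<forall>c. c \<noteq> 0 \<longrightarrow> v (i c) = 0)
     \<and> (\<exists>t. v t = 1)}"

text \<open>
  The restriction of \<open>v\<close> along \<open>h\<close> has value group \<open>e\<int>\<close>, where \<open>e\<close> is the ramification index;
  dividing by \<open>e\<close> normalizes it and gives the image point.
\<close>

definition ram_index :: "('b::field \<Rightarrow> 'a::field) \<Rightarrow> ('a \<Rightarrow> int) \<Rightarrow> nat" where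
  "ram_index h v = (LEAST e. 0 < e \<and> (\<exists>z. v (h z) = int e))"

definition image_point :: "('b::field \<Rightarrow> 'a::field) \<Rightarrow> ('a \<Rightarrow> int) \<Rightarrow> ('b \<Rightarrow> int)" where
  "image_point h v = (\<lambda>z. v (h z) div int (ram_index h v))"

definition ram_points :: "('k::zero \<Rightarrow> 'a::field) \<Rightarrow> ('b::field \<Rightarrow> 'a) \<Rightarrow> ('a \<Rightarrow> int) set" where
  "ram_points i h = {P \<in> points i. 1 < ram_index h P}"

text \<open>The multiset of the ramification indices greater than \<open>1\<close> in the (finite) fiber over \<open>t\<close>.\<close>

definition fiber_type ::
    "('k::zero \<Rightarrow> 'a::field) \<Rightarrow> ('b::field \<Rightarrow> 'a) \<Rightarrow> ('b \<Rightarrow> int) \<Rightarrow> nat multiset" where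
  "fiber_type i h t =
     image_mset (ram_index h) (mset_set {P \<in> ram_points i h. image_point h P = t})"

text \<open>
  The entries \<open>Ms\<close> describe the fibers over the points of \<open>S\<close> (in some order), the entries \<open>Ns\<close>
  the fibers over further points; every other fiber is unramified.
\<close>

definition ram_structure ::
    "('k::zero \<Rightarrow> 'a::field) \<Rightarrow> ('k \<Rightarrow> 'b::field) \<Rightarrow> ('b \<Rightarrow> 'a) \<Rightarrow> ('b \<Rightarrow> int) set
      \<Rightarrow> nat multiset list \<Rightarrow> nat multiset list \<Rightarrow> bool" where
  "ram_structure i j h S Ms Ns \<longleftrightarrow>
     (\<exists>ts us. distinct (ts @ us) \<and> set ts = S \<and> set us \<subseteq> points j
        \<and> map (fiber_type i h) ts = Ms \<and> map (fiber_type i h) us = Ns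
        \<and> (\<forall>t \<in> points j - set (ts @ us). fiber_type i h t = {#}))"

text \<open>The entry \<open>(m)\<^sup>r\<close>.\<close>

abbreviation entry :: "nat \<Rightarrow> nat \<Rightarrow> nat multiset" where
  "entry m r \<equiv> replicate_mset r m"


section \<open>Divisors and genus\<close>

definition divisors :: "('k::zero \<Rightarrow> 'a::field) \<Rightarrow> (('a \<Rightarrow> int) \<Rightarrow>\<^sub>0 int) set" where
  "divisors i = {D. Poly_Mapping.keys D \<subseteq> points i}"

definition deg :: "(('a \<Rightarrow> int) \<Rightarrow>\<^sub>0 int) \<Rightarrow> int" where
  "deg D = (\<Sum>P \<in> Poly_Mapping.keys D. Poly_Mapping.lookup D P)"

definition lin_equiv ::
    "('k::zero \<Rightarrow> 'a::field) \<Rightarrow> (('a \<Rightarrow> int) \<Rightarrow>\<^sub>0 int) \<Rightarrow> (('a \<Rightarrow> int) \<Rightarrow>\<^sub>0 int) \<Rightarrow> bool" where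
  "lin_equiv i D D' \<longleftrightarrow> (\<exists>z. z \<noteq> 0 \<and> (\<forall>P \<in> points i. Poly_Mapping.lookup D P - Poly_Mapping.lookup D' P = P z))"

definition RR_space :: "('k::zero \<Rightarrow> 'a::field) \<Rightarrow> (('a \<Rightarrow> int) \<Rightarrow>\<^sub>0 int) \<Rightarrow> 'a set" where
  "RR_space i D = {z. z = 0 \<or> (\<forall>P \<in> points i. - Poly_Mapping.lookup D P \<le> P z)}"

text \<open>Over a function field, \<open>RR_space i D\<close> is always finite-dimensional over \<open>k\<close>.\<close>

definition ell :: "('k::field \<Rightarrow> 'a::field) \<Rightarrow> (('a \<Rightarrow> int) \<Rightarrow>\<^sub>0 int) \<Rightarrow> nat" where
  "ell i D = vector_space.dim (\<lambda>c z. i c * z) (RR_space i D)"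

text \<open>The genus is the maximum of \<open>deg D - \<ell>(D) + 1\<close> over all divisors \<open>D\<close>.\<close>

definition has_genus :: "('k::field \<Rightarrow> 'a::field) \<Rightarrow> nat \<Rightarrow> bool" where
  "has_genus i g \<longleftrightarrow>
     (\<forall>D \<in> divisors i. deg D - int (ell i D) + 1 \<le> int g)
     \<and> (\<exists>D \<in> divisors i. deg D - int (ell i D) + 1 = int g)"

definition curve_of_genus :: "nat \<Rightarrow> ('k::field \<Rightarrow> 'a::field) \<Rightarrow> bool" where
  "curve_of_genus g i \<longleftrightarrow> function_field i \<and> has_genus i g"

text \<open>
  A point \<open>P\<close> of a curve of genus \<open>g\<close> is a Weierstrass point if there is a nonconstant function
  that is regular outside \<open>P\<close> and has a pole of order at most \<open>g\<close> at \<open>P\<close>.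
\<close>

definition weierstrass_points :: "nat \<Rightarrow> ('k::field \<Rightarrow> 'a::field) \<Rightarrow> ('a \<Rightarrow> int) set" where
  "weierstrass_points g i = {P \<in> points i. 2 \<le> ell i (Poly_Mapping.single P (int g))}"

text \<open>
  \<open>w\<close> is an involution, and \<open>p\<close> is the quotient map by \<open>\<langle>w\<rangle>\<close> onto the projective line: it identifies
  \<open>k(X)\<close> with the fixed field of \<open>w\<close>.
\<close>

definition P1_quotient :: "('k::field \<Rightarrow> 'a::field) \<Rightarrow> ('a \<Rightarrow> 'a) \<Rightarrow> ('k poly fract \<Rightarrow> 'a) \<Rightarrow> bool" where
  "P1_quotient i w p \<longleftrightarrow>
     automorphism i w \<and> w \<circ> w = id \<and> w \<noteq> id \<and> covering i P1 p \<and> range p = {z. w z = z}"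


section \<open>The group law of an elliptic curve with origin \<open>Z\<close>\<close>

text \<open>\<open>P + Q\<close> is the unique point \<open>R\<close> such that the divisors \<open>[P] + [Q]\<close> and \<open>[R] + [Z]\<close> are equivalent.\<close>

definition ec_add ::
    "('k::field \<Rightarrow> 'a::field) \<Rightarrow> ('a \<Rightarrow> int) \<Rightarrow> ('a \<Rightarrow> int) \<Rightarrow> ('a \<Rightarrow> int) \<Rightarrow> ('a \<Rightarrow> int)" where
  "ec_add i Z P Q = (THE R. R \<in> points i \<and>
     lin_equiv i (Poly_Mapping.single P 1 + Poly_Mapping.single Q 1)
                 (Poly_Mapping.single R 1 + Poly_Mapping.single Z 1))"

definition ec_neg :: "('k::field \<Rightarrow> 'a::field) \<Rightarrow> ('a \<Rightarrow> int) \<Rightarrow> ('a \<Rightarrow> int) \<Rightarrow> ('a \<Rightarrow> int)" where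
  "ec_neg i Z P = (THE R. R \<in> points i \<and> ec_add i Z P R = Z)"

definition two_torsion :: "('k::field \<Rightarrow> 'a::field) \<Rightarrow> ('a \<Rightarrow> int) \<Rightarrow> ('a \<Rightarrow> int) set" where
  "two_torsion i Z = {P \<in> points i. ec_add i Z P P = Z}"

text \<open>\<open>m\<close> is the comorphism of multiplication by \<open>-1\<close>.\<close>

definition is_negation :: "('k::field \<Rightarrow> 'a::field) \<Rightarrow> ('a \<Rightarrow> int) \<Rightarrow> ('a \<Rightarrow> 'a) \<Rightarrow> bool" where
  "is_negation i Z m \<longleftrightarrow> automorphism i m \<and> (\<forall>P \<in> points i. image_point m P = ec_neg i Z P)"

end

theory Submission
  imports Defs
begin

text \<open>
  Write \<open>K(C) = k(X)(y)\<close> with \<open>y\<^sup>2 = F\<close>, where \<open>F\<close> is a squarefree polynomial, and likewise for \<open>E\<close>. A double cover of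
  the line has genus \<open>g\<close> exactly if it has \<open>2g + 2\<close> branch points; the points over them are the
  Weierstrass points of \<open>C\<close> (six) and the points of \<open>E[2]\<close> (four). Since \<open>\<psi>(y\<^sub>E)\<close> is anti-invariant under
  \<open>w\<close>, \<open>\<phi>(F\<^sub>E)\<close> equals \<open>F\<^sub>C\<close> up to a square: a point \<open>a\<close> of the line is a branch point of \<open>\<pi>\<^sub>C\<close> if and only if \<open>\<phi>(a)\<close> is
  a branch point of \<open>\<pi>\<^sub>E\<close> and the ramification index of \<open>\<phi>\<close> at \<open>a\<close> is odd.

  The rest is counting on the line. As \<open>n\<close> is odd, each of the four special fibers of \<open>\<phi>\<close> contains an
  odd number of the six branch points, so these numbers are \<open>1, 1, 1, 3\<close>. The Riemann-Hurwitz
  formula for \<open>\<phi>\<close> leaves room for exactly one point whose ramification index differs from the least one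
  allowed by parity; whether this point lies outside the special fibers, or in one of them and off the
  branch points, or is a branch point decides between the Cases I, II and III. The ramification of
  \<open>\<psi>\<close> is then read off from \<open>\<phi> \<circ> \<pi>\<^sub>C = \<pi>\<^sub>E \<circ> \<psi>\<close>.
\<close>

section \<open>Valuations\<close>

text \<open>Points are abstract valuations, so at every place of a double cover it has to be shown
  that a point exists and that there are no others. Existence comes from substituting a Laurent
  series for \<open>X\<close> and extracting a square root of \<open>F\<close> in k((t)). Uniqueness
  rests on the fact that a normalized valuation is known once it is known up to a positive factor,
  so the ramification index need not be known beforehand. The genus is a maximum over all divisors,
  but deg D - ell(D) grows with D, and every divisor is dominated by a multiple of one pulled back
  from the line, whose Riemann-Roch space can be written down. Riemann-Hurwitz is established on the
  line alone, by counting the zeros of a Wronskian. The number n is given as a vector space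
  dimension, whereas the counting needs it as the number of points in a fiber of
  \<open>\<phi>\<close>. The link is the basis 1, X, ..., X^(n-1), which serves both for k(X) over
  the image of \<open>\<phi>\<close> and for K(C) over the image of \<open>\<psi>\<close>.\<close>

lemma field_hom_simps:
  fixes h :: "'a::field \<Rightarrow> 'b::field"
  assumes "field_hom h"
  shows "h 0 = 0" "h 1 = 1" "h (x + y) = h x + h y" "h (x - y) = h x - h y" "h (- x) = - h x"
    "h (x * y) = h x * h y" "h (x ^ n) = h x ^ n" "h (inverse x) = inverse (h x)"
    "h (x / y) = h x / h y" "h x = 0 \<longleftrightarrow> x = 0" "h x = h y \<longleftrightarrow> x = y"
    "h (sum f A) = (\<Sum>a\<in>A. h (f a))" "h (numeral m) = numeral m" "h (x powi k) = h x powi k"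
proof -
  have h1: "h 1 = 1" and hadd: "h (x + y) = h x + h y" and hmult: "h (x * y) = h x * h y" for x y
    using assms unfolding field_hom_def by auto
  have h0: "h 0 = 0"
    using hadd[of 0 0] by (metis add_cancel_right_right add.right_neutral)
  have hm: "h (- x) = - h x" for x
    using hadd[of x "- x"] h0 by (simp add: eq_neg_iff_add_eq_0 add.commute)
  have hd: "h (x - y) = h x - h y" for x y
    using hadd[of x "- y"] hm by simp
  have hinv: "h (inverse x) = inverse (h x)" for x
  proof (cases "x = 0")
    case False
    then have "h x * h (inverse x) = 1"
      using hmult[of x "inverse x"] h1 by simp
    then show ?thesis by (metis inverse_unique)
  qed (simp add: h0)
  have hz: "h x = 0 \<longleftrightarrow> x = 0" for x
    using hmult[of x "inverse x"] h1 h0 by (metis mult_zero_left right_inverse zero_neq_one)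
  have hp: "h (x ^ n) = h x ^ n" for n x
    by (induction n) (simp_all add: h1 hmult)
  have hnat: "h (of_nat n) = of_nat n" for n
    by (induction n) (simp_all add: h0 h1 hadd)
  show "h 0 = 0" "h 1 = 1" "h (x + y) = h x + h y" "h (x - y) = h x - h y" "h (- x) = - h x"
    "h (x * y) = h x * h y" "h (x ^ n) = h x ^ n" "h (inverse x) = inverse (h x)"
    "h x = 0 \<longleftrightarrow> x = 0"
    by (fact h0 h1 hadd hd hm hmult hp hinv hz)+
  show "h (x / y) = h x / h y"
    by (simp add: divide_inverse hmult hinv)
  show "h x = h y \<longleftrightarrow> x = y"
    using hz[of "x - y"] hd by auto
  show "h (sum f A) = (\<Sum>a\<in>A. h (f a))"
    by (induction A rule: infinite_finite_induct) (simp_all add: h0 hadd)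
  show "h (numeral m) = numeral m"
    using hnat[of "numeral m"] by simp
  show "h (x powi k) = h x powi k"
    by (simp add: power_int_def hp hinv)
qed

lemma field_hom_comp: "field_hom g \<Longrightarrow> field_hom h \<Longrightarrow> field_hom (\<lambda>x. g (h x))"
  unfolding field_hom_def by auto

text \<open>Triviality on constants and the value 1 are left to \<open>points\<close>: the axioms
  here survive restriction along any homomorphism (\<open>val_comp\<close>), where the value group
  may shrink.\<close>

locale valuation =
  fixes v :: "'a::field \<Rightarrow> int"
  assumes val_0: "v 0 = 0"
    and val_mult: "x \<noteq> 0 \<Longrightarrow> y \<noteq> 0 \<Longrightarrow> v (x * y) = v x + v y"
    and val_add: "x \<noteq> 0 \<Longrightarrow> y \<noteq> 0 \<Longrightarrow> x + y \<noteq> 0 \<Longrightarrow> min (v x) (v y) \<le> v (x + y)"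
begin

lemma val_1: "v 1 = 0"
  using val_mult[of 1 1] by simp

lemma val_minus: "v (- x) = v x"
proof (cases "x = 0")
  case False
  have "v (-1) = 0"
    using val_mult[of "-1" "-1"] val_1 by simp
  then show ?thesis
    using val_mult[of "-1" x] False by simp
qed simp

lemma val_inverse: "v (inverse x) = - v x"
proof (cases "x = 0")
  case False
  then show ?thesis
    using val_mult[of x "inverse x"] val_1 by simp
qed (simp add: val_0)

lemma val_divide: "x \<noteq> 0 \<Longrightarrow> y \<noteq> 0 \<Longrightarrow> v (x / y) = v x - v y"
  using val_mult[of x "inverse y"] by (simp add: val_inverse divide_inverse)

lemma val_power: "v (x ^ n) = int n * v x"
proof (cases "x = 0")
  case True
  then show ?thesis by (cases n) (simp_all add: val_0 val_1)
next
  case False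
  then show ?thesis
    by (induction n) (simp_all add: val_1 val_mult algebra_simps)
qed

lemma val_power_int: "v (x powi k) = k * v x"
  by (simp add: power_int_def val_power val_inverse)

text \<open>Restores the convention that 0 has infinite value, which the normalization
  \<open>v 0 = 0\<close> gives up; sums and products then need no case distinction.\<close>

definition at_least :: "int \<Rightarrow> 'a \<Rightarrow> bool" where
  "at_least n x \<longleftrightarrow> x = 0 \<or> n \<le> v x"

lemma at_least_0 [simp]: "at_least n 0"
  by (simp add: at_least_def)

lemma at_least_minus: "at_least n (- x) \<longleftrightarrow> at_least n x"
  by (auto simp: at_least_def val_minus)

lemma at_least_add: "at_least n x \<Longrightarrow> at_least n y \<Longrightarrow> at_least n (x + y)"
  using val_add[of x y] by (cases "x = 0"; cases "y = 0"; cases "x + y = 0") (auto simp: at_least_def)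

lemma at_least_diff: "at_least n x \<Longrightarrow> at_least n y \<Longrightarrow> at_least n (x - y)"
  using at_least_add[of n x "- y"] by (simp add: at_least_minus)

lemma at_least_mult: "at_least n x \<Longrightarrow> at_least m y \<Longrightarrow> at_least (n + m) (x * y)"
  using val_mult[of x y] by (cases "x = 0"; cases "y = 0") (auto simp: at_least_def)

lemma at_least_mult0: "at_least 0 x \<Longrightarrow> at_least n y \<Longrightarrow> at_least n (x * y)"
  using at_least_mult[of 0 x n y] by simp

lemma at_least_sum: "(\<And>a. a \<in> A \<Longrightarrow> at_least n (f a)) \<Longrightarrow> at_least n (\<Sum>a\<in>A. f a)"
  by (induction A rule: infinite_finite_induct) (auto intro: at_least_add)

text \<open>Were \<open>x + y\<close> of larger value than \<open>x\<close>, so would be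
  \<open>x = (x + y) - y\<close>. Phrased with \<open>at_least\<close> so that \<open>y = 0\<close>
  is covered whatever the sign of \<open>v x\<close>.\<close>

lemma val_add_eq:
  assumes "x \<noteq> 0" "at_least (v x + 1) y"
  shows "x + y \<noteq> 0 \<and> v (x + y) = v x"
proof -
  have "\<not> at_least (v x + 1) (x + y)"
    using at_least_diff[of "v x + 1" "x + y" y] assms by (auto simp: at_least_def)
  moreover have "at_least (v x) (x + y)"
    using assms by (intro at_least_add) (auto simp: at_least_def)
  ultimately show ?thesis
    by (auto simp: at_least_def)
qed

lemma val_add_less: "x \<noteq> 0 \<Longrightarrow> v x < v y \<Longrightarrow> x + y \<noteq> 0 \<and> v (x + y) = v x"
  using val_add_eq[of x y] by (simp add: at_least_def)

lemma val_add_neq: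
  assumes "x \<noteq> 0" "y \<noteq> 0" "v x \<noteq> v y"
  shows "x + y \<noteq> 0 \<and> v (x + y) = min (v x) (v y)"
  using val_add_less[of x y] val_add_less[of y x] assms by (cases "v x < v y") (auto simp: add.commute)

lemma val_comp:
  fixes h :: "'c::field \<Rightarrow> 'a"
  assumes "field_hom h"
  shows "valuation (\<lambda>x. v (h x))"
proof
  note h = field_hom_simps[OF assms]
  fix x y :: 'c assume "x \<noteq> 0" "y \<noteq> 0" "x + y \<noteq> 0"
  then show "min (v (h x)) (v (h y)) \<le> v (h (x + y))"
    using val_add[of "h x" "h y"] by (simp add: h flip: h(3))
qed (simp_all add: field_hom_simps[OF assms] val_0 val_mult)

end

section \<open>Points and their images\<close>

lemma points_iff:
  "v \<in> points i \<longleftrightarrow> valuation v \<and> (\<forall>c. c \<noteq> 0 \<longrightarrow> v (i c) = 0) \<and> (\<exists>t. v t = 1)"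
  unfolding points_def valuation_def by auto

lemma pointsD:
  assumes "v \<in> points i"
  shows "valuation v" "c \<noteq> 0 \<Longrightarrow> v (i c) = 0" "\<exists>t. t \<noteq> 0 \<and> v t = 1"
  using assms unfolding points_iff by (auto simp: valuation_def) (metis zero_neq_one)

text \<open>Since \<open>u\<close> attains 1, the least positive value of \<open>v\<close> on the
  image of \<open>h\<close> is exactly \<open>e\<close>. Indices and images are computed by
  exhibiting such a factorization.\<close>

lemma restrict_point:
  assumes "\<And>z. v (h z) = int e * u z" "u \<in> points j" "0 < e"
  shows "ram_index h v = e" "image_point h v = u"
proof -
  obtain t where t: "u t = 1"
    using pointsD(3)[OF assms(2)] by auto
  show "ram_index h v = e"
    unfolding ram_index_def
  proof (rule Least_equality)
    show "0 < e \<and> (\<exists>z. v (h z) = int e)"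
      using assms(1)[of t] t assms(3) by auto
  next
    fix d assume "0 < d \<and> (\<exists>z. v (h z) = int d)"
    then obtain z where "0 < d" "int e * u z = int d"
      using assms(1) by auto
    then have "int e dvd int d" by (metis dvd_triv_left)
    then show "e \<le> d" using \<open>0 < d\<close> by (simp add: dvd_imp_le)
  qed
  then show "image_point h v = u"
    unfolding image_point_def using assms by auto
qed

text \<open>The values of \<open>v\<close> on the image of \<open>h\<close> form a subgroup of the
  integers; the last assumption makes it nonzero, so it is generated by its least positive element.
  The zero subgroup would leave the \<open>LEAST\<close> in \<open>ram_index\<close> without a
  witness.\<close>

lemma restrict_point_ex:
  fixes i :: "'k::zero \<Rightarrow> 'a::field" and j :: "'k \<Rightarrow> 'b::field" and h :: "'b \<Rightarrow> 'a"
  assumes "v \<in> points i" "covering i j h" "v (h z) \<noteq> 0"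
  shows "image_point h v \<in> points j" "0 < ram_index h v"
    "\<And>z. v (h z) = int (ram_index h v) * image_point h v z"
proof -
  interpret valuation v by (rule pointsD(1)[OF assms(1)])
  have h: "field_hom h" and hc: "h (j c) = i c" for c
    using assms(2) unfolding covering_def by auto
  interpret vh: valuation "\<lambda>x. v (h x)" by (rule val_comp[OF h])
  let ?e = "ram_index h v"
  let ?Q = "\<lambda>e. 0 < e \<and> (\<exists>z. v (h z) = int e)"
  have "\<exists>e. ?Q e"
  proof (cases "0 < v (h z)")
    case True
    then show ?thesis by (intro exI[of _ "nat (v (h z))"]) auto
  next
    case False
    then show ?thesis
      using assms(3) vh.val_inverse[of z] by (intro exI[of _ "nat (v (h (inverse z)))"]) auto
  qed
  then have e: "?Q ?e" and emin: "\<And>d. ?Q d \<Longrightarrow> ?e \<le> d"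
    unfolding ram_index_def by (rule LeastI_ex) (rule Least_le)
  show pos: "0 < ?e" using e by simp
  obtain t where t: "v (h t) = int ?e" using e by auto
  then have t0: "t \<noteq> 0" using pos vh.val_0 by auto
  have dvd: "int ?e dvd v (h x)" for x
  proof (rule ccontr)
    assume nd: "\<not> int ?e dvd v (h x)"
    then have x0: "x \<noteq> 0" using vh.val_0 by auto
    \<comment> \<open>Scaling \<open>x\<close> by a power of \<open>t\<close> replaces its value by
      the remainder modulo the index, which would be a smaller positive value.\<close>
    define q where "q = v (h x) div int ?e"
    have "v (h (x * t powi (- q))) = v (h x) mod int ?e"
      using x0 t0 by (subst vh.val_mult) (auto simp: vh.val_power_int t q_def minus_div_mult_eq_mod)
    moreover have "0 < v (h x) mod int ?e" "v (h x) mod int ?e < int ?e"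
      using nd pos pos_mod_sign[of "int ?e" "v (h x)"] pos_mod_bound[of "int ?e" "v (h x)"]
      by (auto simp: dvd_eq_mod_eq_0 intro: le_neq_trans)
    ultimately have "?Q (nat (v (h x) mod int ?e))" by auto
    then have "?e \<le> nat (v (h x) mod int ?e)" by (rule emin)
    then show False
      using \<open>v (h x) mod int ?e < int ?e\<close> \<open>0 < v (h x) mod int ?e\<close> by linarith
  qed
  show eq: "v (h z) = int (ram_index h v) * image_point h v z" for z
    unfolding image_point_def using dvd[of z] by simp
  have pos': "0 < int ?e" using pos by simp
  have val: "valuation (image_point h v)"
  proof
    show "image_point h v 0 = 0" using eq[of 0] pos by (simp add: vh.val_0)
    fix x y :: 'b assume xy: "x \<noteq> 0" "y \<noteq> 0"
    have "int ?e * image_point h v (x * y) = int ?e * (image_point h v x + image_point h v y)"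
      using vh.val_mult[OF xy] by (simp add: eq algebra_simps)
    then show "image_point h v (x * y) = image_point h v x + image_point h v y"
      using pos by simp
    assume "x + y \<noteq> 0"
    from vh.val_add[OF xy this]
    have "int ?e * image_point h v x \<le> int ?e * image_point h v (x + y) \<or>
          int ?e * image_point h v y \<le> int ?e * image_point h v (x + y)"
      by (simp add: eq min_le_iff_disj)
    then show "min (image_point h v x) (image_point h v y) \<le> image_point h v (x + y)"
      using pos by (auto simp: min_le_iff_disj)
  qed
  show "image_point h v \<in> points j"
    unfolding points_iff
  proof (intro conjI allI impI)
    fix c assume "c \<noteq> (0::'k)"
    then show "image_point h v (j c) = 0"
      using pointsD(2)[OF assms(1), of c] eq[of "j c"] pos by (simp add: hc)
  next
    show "\<exists>t. image_point h v t = 1"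
      using t eq[of t] pos by (intro exI[of _ t]) simp
  qed (rule val)
qed

text \<open>Both valuations attain 1, so \<open>d\<close> and \<open>e\<close> divide each other.
  Points thus have to be compared only up to a positive rational factor.\<close>

lemma proportional_points_eq:
  assumes "u \<in> points i" "v \<in> points i" "\<And>z. int e * v z = int d * u z" "0 < d" "0 < e"
  shows "v = u"
proof -
  obtain s t where "u s = 1" "v t = 1"
    using assms(1,2) by (metis pointsD(3))
  then have "int e * v s = int d" "int e = int d * u t"
    using assms(3)[of s] assms(3)[of t] by auto
  then have "e dvd d" "d dvd e"
    by (metis dvd_triv_left int_dvd_int_iff)+
  then have "e = d" by (simp add: dvd_antisym)
  then show ?thesis using assms by auto
qed

section \<open>Points from embeddings into Laurent series\<close>

lemma laurent_point:
  fixes \<sigma> :: "'a::field \<Rightarrow> 'k::field fls"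
  assumes "field_hom \<sigma>" "\<And>c. \<sigma> (i c) = fls_const c" "fls_subdegree (\<sigma> t) = 1"
  shows "(\<lambda>z. fls_subdegree (\<sigma> z)) \<in> points i"
proof -
  note s = field_hom_simps[OF assms(1)]
  have "valuation (\<lambda>z. fls_subdegree (\<sigma> z))"
  proof
    fix x y :: 'a assume "x \<noteq> 0" "y \<noteq> 0" "x + y \<noteq> 0"
    then show "min (fls_subdegree (\<sigma> x)) (fls_subdegree (\<sigma> y)) \<le> fls_subdegree (\<sigma> (x + y))"
      using fls_plus_subdegree[of "\<sigma> x" "\<sigma> y"] by (simp add: s flip: s(3))
  qed (simp_all add: s)
  then show ?thesis
    unfolding points_iff using assms(2,3) by auto
qed

text \<open>The residue field of such a point is k: the constant is the coefficient of t^0.\<close>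

lemma laurent_residue:
  fixes \<sigma> :: "'a::field \<Rightarrow> 'k::field fls"
  assumes "field_hom \<sigma>" "\<And>c. \<sigma> (i c) = fls_const c" "0 \<le> fls_subdegree (\<sigma> z)"
  shows "\<exists>c. z = i c \<or> 1 \<le> fls_subdegree (\<sigma> (z - i c))"
proof (intro exI)
  let ?c = "fls_nth (\<sigma> z) 0"
  show "z = i ?c \<or> 1 \<le> fls_subdegree (\<sigma> (z - i ?c))"
  proof (cases "z = i ?c")
    case False
    have "1 \<le> fls_subdegree (\<sigma> (z - i ?c))"
    proof (rule fls_subdegree_geI)
      show "\<sigma> (z - i ?c) \<noteq> 0"
        using False by (simp add: field_hom_simps[OF assms(1)])
      fix k :: int assume "k < 1"
      then consider "k < 0" | "k = 0" by linarith
      then show "fls_nth (\<sigma> (z - i ?c)) k = 0"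
        by cases (use assms in \<open>simp_all add: field_hom_simps[OF assms(1)]\<close>)
    qed
    then show ?thesis by simp
  qed simp
qed


section \<open>The points of the projective line\<close>

text \<open>\<open>None\<close> is the point at infinity.\<close>

fun ord :: "'k::field option \<Rightarrow> 'k poly \<Rightarrow> int" where
  "ord None p = - int (degree p)"
| "ord (Some a) p = int (order a p)"

lemma ord_mult: "p \<noteq> 0 \<Longrightarrow> q \<noteq> 0 \<Longrightarrow> ord a (p * q) = ord a p + ord a q"
  by (cases a) (simp_all add: degree_mult_eq order_mult)

lemma ord_linear: "ord a [:-b, 1:] = (case a of None \<Rightarrow> -1 | Some c \<Rightarrow> if b = c then 1 else 0)"
  using order_power_n_n[of b 1] by (auto split: option.split simp: order_0I)

lemma order_const [simp]: "c \<noteq> 0 \<Longrightarrow> order a [:c:] = 0"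
  by (rule order_0I) simp

lemma ord_const [simp]: "c \<noteq> 0 \<Longrightarrow> ord a [:c:] = 0"
  by (cases a) auto

text \<open>Constants and linear factors generate the nonzero polynomials multiplicatively, so
  statements about orders and valuations need checking only there.\<close>

lemma poly_linear_induct [consumes 1, case_names const linear]:
  fixes p :: "'k::alg_closed_field poly"
  assumes "p \<noteq> 0" "\<And>c. c \<noteq> 0 \<Longrightarrow> P [:c:]"
    "\<And>a p. p \<noteq> 0 \<Longrightarrow> P p \<Longrightarrow> P ([:-a, 1:] * p)"
  shows "P p"
proof -
  obtain A where A: "p = smult (lead_coeff p) (\<Prod>x\<in>#A. [:-x, 1:])"
    using alg_closed_imp_factorization[OF assms(1)] by auto
  have "c \<noteq> 0 \<Longrightarrow> P (smult c (\<Prod>x\<in>#A. [:-x, 1:]))" for c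
  proof (induction A)
    case empty
    then show ?case using assms(2)[of c] by (simp add: one_pCons)
  next
    case (add a A)
    have "P ([:-a, 1:] * smult c (\<Prod>x\<in>#A. [:-x, 1:]))"
      using add by (intro assms(3)) auto
    then show ?case by (simp add: mult_smult_right mult_ac)
  qed
  then show ?thesis using A assms(1) by (metis leading_coeff_0_iff)
qed

lemma sum_order_eq_degree:
  fixes p :: "'k::alg_closed_field poly"
  assumes "p \<noteq> 0" "finite A" "{a. poly p a = 0} \<subseteq> A"
  shows "(\<Sum>a\<in>A. order a p) = degree p"
proof -
  have "finite A \<Longrightarrow> {a. poly p a = 0} \<subseteq> A \<Longrightarrow> (\<Sum>a\<in>A. order a p) = degree p" for A
    using assms(1)
  proof (induction p arbitrary: A rule: poly_linear_induct)
    case (linear b p)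
    have "order a [:- b, 1:] = (if a = b then 1 else 0)" for a
      using ord_linear[of "Some a" b] by (auto split: if_splits)
    moreover have "b \<in> A" "{a. poly p a = 0} \<subseteq> A" using linear.prems by auto
    ultimately show ?case
      using linear.IH[of A] linear.prems(1) linear.hyps
      by (simp add: order_mult sum.distrib degree_mult_eq del: mult_pCons_left)
  qed auto
  then show ?thesis using assms by blast
qed

text \<open>The zeros of \<open>p\<close> number \<open>degree p\<close>, which the value at
  infinity cancels. \<open>A\<close> may be any finite set that covers the support.\<close>

lemma sum_ord_eq_0:
  fixes p :: "'k::alg_closed_field poly"
  assumes "p \<noteq> 0" "finite A" "insert None (Some ` {a. poly p a = 0}) \<subseteq> A"
  shows "(\<Sum>a\<in>A. ord a p) = 0"
proof -
  let ?B = "{a. Some a \<in> A}"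
  have AB: "A = insert None (Some ` ?B)"
  proof (intro set_eqI iffI)
    fix x assume "x \<in> A"
    then show "x \<in> insert None (Some ` ?B)" by (cases x) auto
  qed (use assms(3) in auto)
  have fin: "finite ?B"
    using finite_vimageI[OF assms(2), of Some] by (simp add: vimage_def)
  have "{a. poly p a = 0} \<subseteq> ?B" using assms(3) by auto
  from sum_order_eq_degree[OF assms(1) fin this]
  have "(\<Sum>a\<in>?B. int (order a p)) = int (degree p)"
    by (metis of_nat_sum)
  moreover have "(\<Sum>a\<in>insert None (Some ` ?B). ord a p) = ord None p + (\<Sum>a\<in>?B. ord (Some a) p)"
    using fin by (subst sum.insert) (auto simp: sum.reindex)
  ultimately show ?thesis by (subst AB) simp
qed

text \<open>The factor \<open>e\<close> may be 0; this case serves to exclude valuations that vanish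
  on all linear polynomials.\<close>

lemma val_poly_linear:
  fixes v :: "'k::alg_closed_field poly fract \<Rightarrow> int"
  assumes "valuation v" "\<And>c. c \<noteq> 0 \<Longrightarrow> v (P1 c) = 0"
    and "\<And>b. v (to_fract [:-b, 1:]) = e * ord a [:-b, 1:]" and "p \<noteq> 0"
  shows "v (to_fract p) = e * ord a p"
  using assms(4)
proof (induction p rule: poly_linear_induct)
  case (const c)
  then show ?case using assms(2) by (simp add: P1_def)
next
  case (linear b p)
  interpret valuation v by fact
  have "v (to_fract [:-b, 1:] * to_fract p) = e * ord a [:-b, 1:] + e * ord a p"
    using linear assms(3) by (subst val_mult) simp_all
  then show ?case
    using linear.hyps by (subst ord_mult) (simp_all add: distrib_left flip: to_fract_mult del: mult_pCons_left)
qed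

section \<open>Laurent expansions of rational functions\<close>

lemma fract_cases_to_fract:
  obtains p q where "z = to_fract p / to_fract q" "q \<noteq> 0"
  by (cases z) (auto simp: Fract_conv_to_fract)

text \<open>Universal property of the fraction field: injectivity of \<open>g\<close> makes
  \<open>g p / g q\<close> meaningful and independent of the representation.\<close>

lemma field_hom_fract_extend:
  fixes g :: "'a::idom \<Rightarrow> 'b::field"
  assumes "g 1 = 1" "\<And>x y. g (x + y) = g x + g y" "\<And>x y. g (x * y) = g x * g y"
    "\<And>x. g x = 0 \<Longrightarrow> x = 0"
  shows "\<exists>h. field_hom h \<and> (\<forall>x. h (to_fract x) = g x)"
proof -
  define h where "h z = (SOME y. \<exists>p q. q \<noteq> 0 \<and> z = Fract p q \<and> y = g p / g q)" for z
  have g0: "g 0 = 0" using assms(2)[of 0 0] by (metis add_cancel_right_right add.right_neutral)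
  have h: "h (Fract p q) = g p / g q" if "q \<noteq> 0" for p q
  proof -
    have "\<exists>p' q'. q' \<noteq> 0 \<and> Fract p q = Fract p' q' \<and> h (Fract p q) = g p' / g q'"
      unfolding h_def by (rule someI) (use that in blast)
    then obtain p' q' where q': "q' \<noteq> 0" "Fract p q = Fract p' q'" "h (Fract p q) = g p' / g q'"
      by blast
    then have "p * q' = p' * q" using that by (simp add: eq_fract)
    then have "g p * g q' = g p' * g q" by (metis assms(3))
    moreover have "g q \<noteq> 0" "g q' \<noteq> 0" using assms(4) that q' by auto
    ultimately show ?thesis unfolding q'(3) by (simp add: frac_eq_eq)
  qed
  have "field_hom h"
    unfolding field_hom_def
  proof (intro conjI allI)
    show "h 1 = 1" using h[of 1 1] assms(1) by (simp add: One_fract_def)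
    fix x y :: "'a fract"
    obtain p q p' q' where x: "x = Fract p q" "q \<noteq> 0" and y: "y = Fract p' q'" "q' \<noteq> 0"
      by (metis Fract_cases)
    have "g q \<noteq> 0" "g q' \<noteq> 0" using assms(4) x y by auto
    then show "h (x + y) = h x + h y" "h (x * y) = h x * h y"
      using x y by (simp_all add: h assms(2,3) field_simps)
  qed
  moreover have "h (to_fract x) = g x" for x
    using h[of 1 x] by (simp add: to_fract_def assms(1))
  ultimately show ?thesis by blast
qed

text \<open>The series to be substituted for \<open>X\<close> near \<open>a\<close>. With
  \<open>e = 1\<close> it gives the expansion on the line itself, with \<open>e = 2\<close> the one
  on a double cover at a branch point, where orders double.\<close>

definition local_coord :: "nat \<Rightarrow> 'k::field option \<Rightarrow> 'k fls" where
  "local_coord e a = (case a of None \<Rightarrow> inverse (fls_X ^ e) | Some c \<Rightarrow> fls_const c + fls_X ^ e)"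

lemma local_coord_linear:
  assumes "0 < e"
  shows "local_coord e a - fls_const b \<noteq> 0"
    and "fls_subdegree (local_coord e a - fls_const b) = int e * ord a [:-b, 1:]"
proof -
  have "local_coord e a - fls_const b \<noteq> 0 \<and>
    fls_subdegree (local_coord e a - fls_const b) = int e * ord a [:-b, 1:]"
  proof (cases a)
    case None
    have "fls_subdegree (inverse (fls_X ^ e) - fls_const b :: 'a fls) = - int e"
      using assms by (subst fls_subdegree_diff_eq1) auto
    moreover from this have "inverse (fls_X ^ e) - fls_const b \<noteq> (0 :: 'a fls)"
      using assms by (metis fls_zero_subdegree neg_equal_0_iff_equal of_nat_0_eq_iff less_not_refl)
    ultimately show ?thesis using None by (simp add: local_coord_def)
  next
    case (Some c)
    have eq: "local_coord e a - fls_const b = fls_const (c - b) + fls_X ^ e"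
      using Some by (simp add: local_coord_def flip: fls_minus_const)
    show ?thesis
    proof (cases "b = c")
      case True
      then show ?thesis unfolding eq using Some by (simp add: ord_linear del: ord.simps)
    next
      case False
      have "fls_nth (fls_const (c - b) + fls_X ^ e) 0 \<noteq> 0"
        using False assms by simp
      then have "fls_const (c - b) + fls_X ^ e \<noteq> 0" by (metis fls_zero_nth)
      moreover have "fls_subdegree (fls_const (c - b) + fls_X ^ e) = 0"
        using False assms by (subst fls_subdegree_add_eq1) auto
      ultimately show ?thesis unfolding eq using False Some by (simp add: ord_linear del: ord.simps)
    qed
  qed
  then show "local_coord e a - fls_const b \<noteq> 0"
    "fls_subdegree (local_coord e a - fls_const b) = int e * ord a [:-b, 1:]" by auto
qed

lemma poly_map_poly_fls_const:
  "poly (map_poly fls_const (p + q)) T = poly (map_poly fls_const p) T + poly (map_poly fls_const q) T"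
  "poly (map_poly fls_const (p * q)) T = poly (map_poly fls_const p) T * poly (map_poly fls_const q) T"
  for p q :: "'k::field poly"
proof -
  have add: "map_poly fls_const (p + q) = map_poly fls_const p + map_poly fls_const q" for p q :: "'k poly"
    by (rule poly_eqI) (simp add: coeff_map_poly fls_plus_const)
  show "poly (map_poly fls_const (p + q)) T = poly (map_poly fls_const p) T + poly (map_poly fls_const q) T"
    by (simp add: add)
  show "poly (map_poly fls_const (p * q)) T = poly (map_poly fls_const p) T * poly (map_poly fls_const q) T"
    by (induction p) (simp_all add: add map_poly_pCons map_poly_smult algebra_simps)
qed

text \<open>Evaluation at \<open>local_coord e a\<close> sends no linear polynomial to 0, hence no
  nonzero polynomial, and so extends from polynomials to k(X).\<close>

lemma ex_laurent_hom:
  fixes a :: "'k::alg_closed_field option"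
  assumes "0 < e"
  shows "\<exists>\<rho>. field_hom \<rho> \<and> (\<forall>c. \<rho> (P1 c) = fls_const c) \<and>
    (\<forall>p. p \<noteq> 0 \<longrightarrow> fls_subdegree (\<rho> (to_fract p)) = int e * ord a p)"
proof -
  define g :: "'k poly \<Rightarrow> 'k fls" where "g p = poly (map_poly fls_const p) (local_coord e a)" for p
  have g1: "g 1 = 1" by (simp add: g_def)
  have gadd: "g (p + q) = g p + g q" and gmult: "g (p * q) = g p * g q" for p q
    unfolding g_def by (rule poly_map_poly_fls_const)+
  have glin: "g [:-b, 1:] = local_coord e a - fls_const b" and gconst: "g [:b:] = fls_const b" for b
    by (simp_all add: g_def map_poly_pCons)
  have g: "g p \<noteq> 0 \<and> fls_subdegree (g p) = int e * ord a p" if "p \<noteq> 0" for p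
    using that
  proof (induction p rule: poly_linear_induct)
    case (linear b p)
    then have "g ([:-b, 1:] * p) \<noteq> 0"
      unfolding gmult using local_coord_linear(1)[OF assms] by (simp add: glin)
    moreover have "fls_subdegree (g ([:-b, 1:] * p)) = int e * ord a ([:-b, 1:] * p)"
      using linear local_coord_linear[OF assms, of a b]
      by (subst ord_mult; simp add: gmult glin distrib_left del: mult_pCons_left ord.simps)
    ultimately show ?case by blast
  qed (simp add: gconst)
  obtain \<rho> where \<rho>: "field_hom \<rho>" "\<forall>p. \<rho> (to_fract p) = g p"
    using field_hom_fract_extend[of g] g1 gadd gmult g by blast
  then show ?thesis using g by (intro exI[of _ \<rho>]) (auto simp: P1_def gconst)
qed

definition laurent_hom :: "'k::alg_closed_field option \<Rightarrow> 'k poly fract \<Rightarrow> 'k fls" where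
  "laurent_hom a = (SOME \<rho>. field_hom \<rho> \<and> (\<forall>c. \<rho> (P1 c) = fls_const c) \<and>
    (\<forall>p. p \<noteq> 0 \<longrightarrow> fls_subdegree (\<rho> (to_fract p)) = ord a p))"

text \<open>Taken as the order of a Laurent expansion, not as \<open>ord\<close> of numerator minus
  denominator: the valuation axioms and the residues are then inherited from k((t)).\<close>

definition pt :: "'k::alg_closed_field option \<Rightarrow> 'k poly fract \<Rightarrow> int" where
  "pt a z = fls_subdegree (laurent_hom a z)"

lemma laurent_hom:
  "field_hom (laurent_hom a)" "laurent_hom a (P1 c) = fls_const c"
  and pt_poly: "p \<noteq> 0 \<Longrightarrow> pt a (to_fract p) = ord a p"
  using someI_ex[OF ex_laurent_hom[of 1 a, simplified]]
  unfolding laurent_hom_def[symmetric] pt_def by auto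

lemma ex_uniformizer: "\<exists>t. pt a t = 1"
proof (cases a)
  case None
  have "pt a (to_fract [:0, 1:]) = -1" using None by (subst pt_poly) auto
  then have "pt a (inverse (to_fract [:0, 1:])) = 1"
    by (simp add: pt_def field_hom_simps[OF laurent_hom(1)])
  then show ?thesis by blast
next
  case (Some b)
  have "pt a (to_fract [:-b, 1:]) = 1"
    using Some ord_linear[of a b] by (subst pt_poly) auto
  then show ?thesis by blast
qed

lemma pt_point: "pt a \<in> points P1"
proof -
  obtain t where "fls_subdegree (laurent_hom a t) = 1"
    using ex_uniformizer[of a] by (auto simp: pt_def)
  from laurent_point[OF laurent_hom(1) laurent_hom(2) this]
  show ?thesis by (simp add: pt_def[abs_def])
qed

lemma valuation_pt: "valuation (pt a)"
  by (rule pointsD(1)[OF pt_point])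

lemma pt_const [simp]: "pt a (P1 c) = 0"
  using pointsD(2)[OF pt_point, of c a] valuation.val_0[OF valuation_pt]
  by (cases "c = 0") (auto simp: P1_def)

lemma pt_residue: "0 \<le> pt a z \<Longrightarrow> \<exists>c. valuation.at_least (pt a) 1 (z - P1 c)"
  using laurent_residue[OF laurent_hom(1) laurent_hom(2), where z=z]
  by (auto simp: pt_def valuation.at_least_def[OF valuation_pt])

lemma pt_quotient: "p \<noteq> 0 \<Longrightarrow> q \<noteq> 0 \<Longrightarrow> pt a (to_fract p / to_fract q) = ord a p - ord a q"
  by (simp add: valuation.val_divide[OF valuation_pt] pt_poly)

lemma pt_multiple:
  assumes "valuation v" "\<And>p. p \<noteq> 0 \<Longrightarrow> v (to_fract p) = e * ord a p"
  shows "v z = e * pt a z"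
proof -
  obtain p q where z: "z = to_fract p / to_fract q" "q \<noteq> 0" by (rule fract_cases_to_fract)
  show ?thesis
  proof (cases "p = 0")
    case True
    then show ?thesis
      using valuation.val_0[OF assms(1)] valuation.val_0[OF valuation_pt, of a] z by simp
  next
    case False
    then show ?thesis
      using z by (simp add: pt_quotient valuation.val_divide[OF assms(1)] assms(2) right_diff_distrib)
  qed
qed

lemma pt_inj: "pt a = pt b \<longleftrightarrow> a = b"
proof
  assume "pt a = pt b"
  then have "ord a [:-c, 1:] = ord b [:-c, 1:]" for c
    using pt_poly[of "[:-c, 1:]"] by (metis one_neq_zero pCons_eq_0_iff)
  then have *: "(case a of None \<Rightarrow> -1 | Some d \<Rightarrow> if c = d then 1 else 0) =
      (case b of None \<Rightarrow> -1 | Some d \<Rightarrow> if c = d then 1 else (0::int))" for c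
    by (simp only: ord_linear)
  show "a = b"
    using *[of "the a"] *[of "the b"] by (cases a; cases b) (auto split: if_splits)
qed auto

text \<open>If \<open>X\<close> has a pole, all \<open>X - b\<close> have the same negative value,
  as at infinity. Otherwise some \<open>X - c\<close> is a nonunit, and every other
  \<open>X - b\<close> differs from it by a nonzero constant and is a unit.\<close>

lemma points_P1: "points P1 = range (pt :: 'k::alg_closed_field option \<Rightarrow> _)"
proof (intro equalityI subsetI)
  fix v :: "'k poly fract \<Rightarrow> int" assume v: "v \<in> points P1"
  interpret valuation v by (rule pointsD(1)[OF v])
  let ?x = "to_fract [:0, 1::'k:]"
  have const: "v (P1 c) = 0" if "c \<noteq> 0" for c using pointsD(2)[OF v that] .
  have lin: "to_fract [:-b, 1:] = ?x - P1 b" for b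
    by (simp add: P1_def flip: to_fract_diff)
  have P1z: "P1 c = 0 \<longleftrightarrow> c = 0" for c :: 'k by (simp add: P1_def)
  have "\<exists>a e. 0 < e \<and> (\<forall>b. v (to_fract [:-b, 1:]) = e * ord a [:-b, 1:])"
  proof (cases "v ?x < 0")
    case True
    have "v (to_fract [:-b, 1:]) = v ?x" for b
    proof (cases "b = 0")
      case False
      have "v (?x + - P1 b) = v ?x"
        using True const[OF False] by (intro conjunct2[OF val_add_less]) (auto simp: val_minus)
      then show ?thesis by (simp add: lin)
    qed simp
    then show ?thesis using True
      by (intro exI[of _ None] exI[of _ "- v ?x"]) (auto)
  next
    case False
    have ge: "at_least 0 (to_fract [:-b, 1:])" for b
      unfolding lin using False const[of b] P1z[of b] by (intro at_least_diff) (auto simp: at_least_def)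
    have "\<exists>b. 0 < v (to_fract [:-b, 1:])"
    proof (rule ccontr)
      assume "\<not> ?thesis"
      then have "v (to_fract [:-b, 1:]) = 0" for b
        using ge[of b] by (auto simp: at_least_def order.antisym not_less)
      \<comment> \<open>The trivial valuation is 0 times the one at any point; infinity is an
        arbitrary choice.\<close>
      then have "v (to_fract [:-b, 1:]) = 0 * ord None [:-b, 1:]" for b by simp
      then have "v (to_fract p) = 0 * ord None p" if "p \<noteq> 0" for p
        using val_poly_linear[OF valuation_axioms const, of 0 None p] that by blast
      then have "v z = 0" for z
        using pt_multiple[OF valuation_axioms, of 0 None] by simp
      then show False using pointsD(3)[OF v] by auto
    qed
    then obtain c where c: "0 < v (to_fract [:-c, 1:])" by blast
    have "v (to_fract [:-b, 1:]) = 0" if "b \<noteq> c" for b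
    proof -
      have *: "to_fract [:-b, 1:] = P1 (c - b) + to_fract [:-c, 1:]"
        by (simp add: P1_def flip: to_fract_add)
      show ?thesis unfolding *
        using c const[of "c - b"] that val_add_less[of "P1 (c - b)" "to_fract [:-c, 1:]"] by (simp add: P1z)
    qed
    then show ?thesis using c
      by (intro exI[of _ "Some c"] exI[of _ "v (to_fract [:-c, 1:])"]) (auto simp: ord_linear simp del: ord.simps)
  qed
  then obtain a e where e: "0 < e" "\<And>b. v (to_fract [:-b, 1:]) = e * ord a [:-b, 1:]" by blast
  have eq: "v z = e * pt a z" for z
    by (rule pt_multiple[OF valuation_axioms val_poly_linear[OF valuation_axioms const e(2)]])
  obtain t where "v t = 1" using pointsD(3)[OF v] by auto
  then have "e * pt a t = 1" using eq by simp
  then have "e = 1" using e(1) by (simp add: zmult_eq_1_iff)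
  then show "v \<in> range pt" using eq by auto
qed (auto simp: pt_point)

text \<open>Numerator and denominator each have total order 0 once infinity is counted, so a
  principal divisor on the line has degree 0.\<close>

lemma pt_finite_support:
  assumes "z \<noteq> 0"
  shows "finite {a. pt a z \<noteq> 0}"
    and "finite A \<Longrightarrow> {a. pt a z \<noteq> 0} \<subseteq> A \<Longrightarrow> (\<Sum>a\<in>A. pt a z) = 0"
proof -
  obtain p q where z: "z = to_fract p / to_fract q" "q \<noteq> 0" by (rule fract_cases_to_fract)
  then have p: "p \<noteq> 0" using assms by auto
  let ?F = "insert None (Some ` ({a. poly p a = 0} \<union> {a. poly q a = 0}))"
  have pt: "pt a z = ord a p - ord a q" for a using z p by (simp add: pt_quotient)
  have fin: "finite ?F" using p z(2) by (simp add: poly_roots_finite)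
  have sub: "{a. pt a z \<noteq> 0} \<subseteq> ?F"
  proof
    fix a assume "a \<in> {a. pt a z \<noteq> 0}"
    then show "a \<in> ?F"
    proof (cases a)
      case (Some b)
      then have "poly p b = 0 \<or> poly q b = 0"
        using \<open>a \<in> {a. pt a z \<noteq> 0}\<close> order_0I[of p b] order_0I[of q b]
        by (cases "poly p b = 0"; cases "poly q b = 0") (auto simp: pt)
      then show ?thesis using Some by blast
    qed simp
  qed
  show "finite {a. pt a z \<noteq> 0}" by (rule finite_subset[OF sub fin])
  assume A: "finite A" "{a. pt a z \<noteq> 0} \<subseteq> A"
  have "(\<Sum>a\<in>A. pt a z) = (\<Sum>a\<in>A \<union> ?F. pt a z)"
    using A fin by (intro sum.mono_neutral_left) auto
  also have "\<dots> = 0"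
    unfolding pt sum_subtractf using A fin p z(2)
    by (subst (1 2) sum_ord_eq_0) auto
  finally show "(\<Sum>a\<in>A. pt a z) = 0" .
qed

text \<open>The orders of the denominator never exceed those of the numerator; removing linear
  factors one by one, this becomes divisibility.\<close>

lemma poly_if_no_finite_poles:
  fixes z :: "'k::alg_closed_field poly fract"
  assumes "\<And>a. 0 \<le> pt (Some a) z"
  shows "\<exists>p. z = to_fract p"
proof -
  obtain p q where z: "z = to_fract p / to_fract q" "q \<noteq> 0" by (rule fract_cases_to_fract)
  have "q \<noteq> 0 \<Longrightarrow> (\<And>a. p \<noteq> 0 \<Longrightarrow> order a q \<le> order a p) \<Longrightarrow> q dvd p" for p
  proof (induction q arbitrary: p rule: poly_linear_induct)
    case (const c)
    then show ?case by (intro dvdI[of _ _ "smult (inverse c) p"]) simp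
  next
    case (linear b q)
    show ?case
    proof (cases "p = 0")
      case False
      have "order b ([:-b, 1:] * q) = Suc (order b q)"
        using linear.hyps order_power_n_n[of b 1] by (subst order_mult) (auto simp del: mult_pCons_left)
      then have "order b p \<noteq> 0" using linear.prems[OF False, of b] by linarith
      then have "[:-b, 1:] dvd p" using order_root poly_eq_0_iff_dvd by metis
      then obtain p' where p': "p = [:-b, 1:] * p'" by (rule dvdE)
      have "p' \<noteq> 0" using p' False by auto
      have "q dvd p'"
      proof (rule linear.IH)
        fix a
        have "order a ([:-b, 1:] * q) \<le> order a ([:-b, 1:] * p')" using linear.prems False p' by blast
        then show "order a q \<le> order a p'"
          using linear.hyps \<open>p' \<noteq> 0\<close> by (subst (asm) (1 2) order_mult) (auto simp del: mult_pCons_left)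
      qed
      then show ?thesis using p' by (metis dvd_refl mult_dvd_mono)
    qed simp
  qed
  moreover have "order a q \<le> order a p" if "p \<noteq> 0" for a
    using assms[of a] z that by (simp add: pt_quotient)
  ultimately have "q dvd p" using z(2) by blast
  then obtain r where "p = q * r" by (rule dvdE)
  then show ?thesis using z by (intro exI[of _ r]) simp
qed

section \<open>Double covers of the projective line\<close>

text \<open>Multiplying by \<open>X - a\<close> toggles the root \<open>a\<close> of the squarefree
  part: a second occurrence moves into the square.\<close>

lemma ex_squarefree_part:
  fixes p :: "'k::alg_closed_field poly"
  assumes "p \<noteq> 0"
  shows "\<exists>s q. s \<noteq> 0 \<and> rsquarefree q \<and> p = s * s * q"
  using assms
proof (induction p rule: poly_linear_induct)
  case (const c)
  then show ?case
    by (intro exI[of _ 1] exI[of _ "[:c:]"]) (auto simp: rsquarefree_def)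
next
  case (linear a p)
  then obtain s q where sq: "s \<noteq> 0" "rsquarefree q" "p = s * s * q" by blast
  have q0: "q \<noteq> 0" using sq(2) by (auto simp: rsquarefree_def)
  have lin: "order b [:-a, 1:] = (if b = a then 1 else 0)" for b
    using ord_linear[of "Some b" a] by (auto split: if_splits)
  show ?case
  proof (cases "poly q a = 0")
    case True
    then obtain r where r: "q = [:-a, 1:] * r" using poly_eq_0_iff_dvd by (metis dvdE)
    then have r0: "r \<noteq> 0" using q0 by (metis mult_zero_right)
    have "rsquarefree r"
      unfolding rsquarefree_def
    proof (intro conjI allI)
      fix b
      have "order b q = order b [:-a, 1:] + order b r"
        unfolding r using r0 by (intro order_mult) (auto simp del: mult_pCons_left)
      moreover have "order b q = 0 \<or> order b q = 1"
        using sq(2) unfolding rsquarefree_def by blast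
      ultimately show "order b r = 0 \<or> order b r = 1" by linarith
    qed (rule r0)
    moreover have "[:-a, 1:] * p = ([:-a, 1:] * s) * ([:-a, 1:] * s) * r"
      unfolding sq(3) r by (simp only: mult_ac)
    moreover have "[:-a, 1:] * s \<noteq> 0" using sq(1) by (simp del: mult_pCons_left)
    ultimately show ?thesis by blast
  next
    case False
    have "rsquarefree ([:-a, 1:] * q)"
      unfolding rsquarefree_def
    proof (intro conjI allI)
      show "[:-a, 1:] * q \<noteq> 0" using q0 by (simp del: mult_pCons_left)
      fix b
      have "order b ([:-a, 1:] * q) = order b [:-a, 1:] + order b q"
        using q0 by (intro order_mult) (simp del: mult_pCons_left)
      then show "order b ([:-a, 1:] * q) = 0 \<or> order b ([:-a, 1:] * q) = 1"
        using sq(2) order_0I[OF False] unfolding rsquarefree_def lin by (cases "b = a") auto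
    qed
    moreover have "[:-a, 1:] * p = s * s * ([:-a, 1:] * q)"
      unfolding sq(3) by (simp only: mult_ac)
    ultimately show ?thesis using sq(1) by blast
  qed
qed

lemma alg_closed_sqrt: "\<exists>s :: 'k::alg_closed_field. s * s = c"
  using nth_root_exists[of 2 c] by (auto simp: power2_eq_square)

text \<open>Shifting by the even order leaves a power series with nonzero constant term, which has a
  square root because k is algebraically closed of characteristic 0.\<close>

lemma fls_sqrt:
  fixes f :: "'k::{alg_closed_field, field_char_0} fls"
  assumes "even (fls_subdegree f)"
  shows "\<exists>g. g * g = f"
proof (cases "f = 0")
  case False
  define u where "u = fls_base_factor_to_fps f"
  obtain k where k: "fls_subdegree f = 2 * k" using assms by blast
  have f: "f = fls_shift (- (2 * k)) (fps_to_fls u)"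
    unfolding u_def using fls_conv_base_factor_to_fps_shift_subdegree[of f] k by simp
  have u0: "fps_nth u 0 \<noteq> 0"
    unfolding u_def using False by simp
  obtain s where s: "s * s = fps_nth u 0" using alg_closed_sqrt by blast
  \<comment> \<open>The function argument of \<open>fps_radical\<close> supplies the root of the
    constant coefficient; \<open>Suc 1\<close> is the exponent 2.\<close>
  have "fps_radical (\<lambda>_ _. s) (Suc 1) u ^ Suc 1 = u"
    using power_radical[OF u0, of "\<lambda>_ _. s" 1] s by (simp add: power2_eq_square)
  then obtain r where r: "r * r = u" by (auto simp: power2_eq_square numeral_2_eq_2)
  have "fls_shift (-k) (fps_to_fls r) * fls_shift (-k) (fps_to_fls r) = f"
    unfolding f r[symmetric] by (simp add: fls_shifted_times_simps fls_times_fps_to_fls)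
  then show ?thesis by blast
qed (auto intro: exI[of _ 0])

lemma field_hom_P1: "field_hom P1"
  unfolding field_hom_def P1_def by (simp flip: to_fract_add to_fract_mult one_pCons)

text \<open>A quotient map of degree 2 in the normal form \<open>y^2 = F\<close>, obtained in
  \<open>ex_double_cover\<close>. As \<open>F\<close> is squarefree, its roots are the finite branch
  points; infinity is one precisely if \<open>F\<close> has odd degree.\<close>

locale double_cover =
  fixes i :: "'k::{alg_closed_field, field_char_0} \<Rightarrow> 'a::field"
    and w :: "'a \<Rightarrow> 'a" and p :: "'k poly fract \<Rightarrow> 'a"
    and y :: 'a and F :: "'k poly"
  assumes quot: "P1_quotient i w p"
    and y_neq_0: "y \<noteq> 0" and w_y: "w y = - y" and y_sq: "y * y = p (to_fract F)"
    and squarefree_F: "rsquarefree F"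
begin

lemma w_hom: "field_hom w" and p_hom: "field_hom p" and w_w [simp]: "w (w z) = z"
  and w_p [simp]: "w (p x) = p x" and fixed: "w z = z \<Longrightarrow> z \<in> range p"
  and p_const: "p (P1 c) = i c" and w_const [simp]: "w (i c) = i c"
proof -
  show "field_hom w" "field_hom p" "p (P1 c) = i c" "w (i c) = i c"
    using quot unfolding P1_quotient_def automorphism_def covering_def by auto
  show "w (w z) = z" using quot unfolding P1_quotient_def by (metis comp_apply id_apply)
  show "w (p x) = p x" "w z = z \<Longrightarrow> z \<in> range p" using quot unfolding P1_quotient_def by auto
qed

lemmas w = field_hom_simps[OF w_hom]
lemmas p = field_hom_simps[OF p_hom]

lemma covering_p: "covering i P1 p"
  using quot unfolding P1_quotient_def by auto

lemma i_hom: "field_hom i"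
proof -
  have "i = (\<lambda>c. p (P1 c))" by (simp add: p_const)
  then show ?thesis using field_hom_comp[OF p_hom field_hom_P1] by simp
qed

lemmas i = field_hom_simps[OF i_hom]

lemma two_neq_0: "(2 :: 'a) \<noteq> 0"
  using i(10)[of 2] by (simp add: i)

lemma four_neq_0: "(4 :: 'a) \<noteq> 0"
  using i(10)[of 4] by (simp add: i)

lemma F_neq_0: "F \<noteq> 0"
  using squarefree_F by (simp add: rsquarefree_def)

text \<open>Coordinates with respect to the basis 1, \<open>y\<close> over k(X). Both quotients are
  fixed by \<open>w\<close>, hence lie in the range of \<open>p\<close>.\<close>

definition re :: "'a \<Rightarrow> 'k poly fract" where "re z = inv p ((z + w z) / 2)"
definition im :: "'a \<Rightarrow> 'k poly fract" where "im z = inv p ((z - w z) / (2 * y))"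

lemma p_re: "p (re z) = (z + w z) / 2" and p_im: "p (im z) = (z - w z) / (2 * y)"
proof -
  have "w ((z + w z) / 2) = (z + w z) / 2" "w ((z - w z) / (2 * y)) = (z - w z) / (2 * y)"
    using y_neq_0 two_neq_0 by (simp_all add: w w_y field_simps)
  then show "p (re z) = (z + w z) / 2" "p (im z) = (z - w z) / (2 * y)"
    unfolding re_def im_def using fixed by (simp_all add: f_inv_into_f)
qed

lemma re_im: "z = p (re z) + p (im z) * y"
  unfolding p_re p_im using y_neq_0 two_neq_0 four_neq_0 by (simp add: field_simps)

lemma re_im_unique: "re (p A + p B * y) = A" "im (p A + p B * y) = B"
proof -
  have "p (re (p A + p B * y)) = p A" "p (im (p A + p B * y)) = p B"
    unfolding p_re p_im using y_neq_0 two_neq_0 by (simp_all add: w w_y field_simps)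
  then show "re (p A + p B * y) = A" "im (p A + p B * y) = B" by (simp_all add: p)
qed

lemma re_im_p: "re (p A) = A" "im (p A) = 0"
  using re_im_unique[of A 0] by (simp_all add: p)

text \<open>The norm to k(X); it turns questions about a pair of conjugate points into questions on
  the line.\<close>

lemma norm_eq: "z * w z = p (re z * re z - im z * im z * to_fract F)"
proof -
  have "z * w z = (p (re z) + p (im z) * y) * w (p (re z) + p (im z) * y)"
    using re_im[of z] by simp
  also have "\<dots> = p (re z) * p (re z) - p (im z) * p (im z) * (y * y)"
    by (simp add: w w_y algebra_simps)
  finally show ?thesis unfolding y_sq by (simp add: p)
qed

lemma point_w:
  assumes "v \<in> points i"
  shows "(\<lambda>z. v (w z)) \<in> points i" "image_point w v = (\<lambda>z. v (w z))"
    "image_point p (\<lambda>z. v (w z)) = image_point p v" "ram_index p (\<lambda>z. v (w z)) = ram_index p v"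
proof -
  interpret valuation v by (rule pointsD(1)[OF assms])
  obtain t where "v t = 1" using pointsD(3)[OF assms] by auto
  then show *: "(\<lambda>z. v (w z)) \<in> points i"
    unfolding points_iff using val_comp[OF w_hom] pointsD(2)[OF assms]
    by (intro conjI allI impI exI[of _ "w t"]) auto
  show "image_point w v = (\<lambda>z. v (w z))"
    by (rule restrict_point(2)[of _ _ 1, OF _ *]) auto
  show "image_point p (\<lambda>z. v (w z)) = image_point p v" "ram_index p (\<lambda>z. v (w z)) = ram_index p v"
    by (simp_all add: image_point_def ram_index_def)
qed

lemma over_pt:
  assumes "v \<in> points i"
  obtains a where "image_point p v = pt a" "0 < ram_index p v"
    "\<And>z. v (p z) = int (ram_index p v) * pt a z"
proof -
  interpret valuation v by (rule pointsD(1)[OF assms])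
  obtain t where t: "t \<noteq> 0" "v t = 1" using pointsD(3)[OF assms] by auto
  \<comment> \<open>Were \<open>v\<close> trivial on k(X), the norm of a uniformizer
    \<open>t\<close> would give \<open>w t\<close> the value -1, hence the trace
    \<open>w t + t\<close> as well; but the trace lies in k(X).\<close>
  have "\<exists>z. v (p z) \<noteq> 0"
  proof (rule ccontr)
    assume "\<not> ?thesis"
    then have triv: "v (p z) = 0" for z by blast
    have wt: "w t \<noteq> 0" using t by (simp add: w)
    have "v (w t) = -1"
      using val_mult[OF t(1) wt] triv t(2) unfolding norm_eq by simp
    then have "v (w t + t) = -1" using val_add_less[OF wt, of t] t by simp
    moreover have "w (w t + t) = w t + t" by (simp add: w add.commute)
    then obtain x where "w t + t = p x" using fixed by blast
    ultimately show False using triv by simp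
  qed
  then obtain z where z: "v (p z) \<noteq> 0" by blast
  note r = restrict_point_ex[OF assms covering_p z]
  from r(1) obtain a where "image_point p v = pt a"
    unfolding points_P1 by blast
  then show ?thesis using that r(2,3) by metis
qed

definition branch :: "'k option set" where
  "branch = {a. odd (pt a (to_fract F))}"

text \<open>At a branch point \<open>B * B * F\<close> has odd order and \<open>A * A\<close> has
  even order, so the two summands of \<open>A + B y\<close> never have equal value and the minimum
  is attained. This determines the value of \<open>z\<close> up to the factor
  \<open>e\<close>.\<close>

lemma proportional_if_branch:
  assumes "a \<in> branch" "u \<in> points i" "v \<in> points i" "0 < d" "0 < e"
    and u: "\<And>z. u (p z) = int d * pt a z" and v: "\<And>z. v (p z) = int e * pt a z"
  shows "v = u"
proof (rule proportional_points_eq[OF assms(2,3) _ assms(5,4)])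
  fix z
  \<comment> \<open>\<open>m\<close> depends on the coordinates of \<open>z\<close> only, not on the
    valuation. The factor 2 is there because the value of \<open>y\<close> is an odd multiple of
    half of \<open>e\<close>.\<close>
  have "\<exists>m. \<forall>v e. v \<in> points i \<longrightarrow> 0 < e \<longrightarrow> (\<forall>z. v (p z) = int e * pt a z) \<longrightarrow> 2 * v z = int e * m"
  proof -
    define A B where "A = re z" and "B = im z"
    have z: "z = p A + p B * y" unfolding A_def B_def by (rule re_im)
    define m where "m = (if B = 0 then 2 * pt a A else if A = 0 then pt a (B * B * to_fract F)
      else min (2 * pt a A) (pt a (B * B * to_fract F)))"
    have "2 * v z = int e * m" if v: "v \<in> points i" "0 < e" "\<And>z. v (p z) = int e * pt a z" for v e
    proof -
      interpret valuation v by (rule pointsD(1)[OF v(1)])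
      have By: "2 * v (p B * y) = int e * pt a (B * B * to_fract F)" if "B \<noteq> 0"
      proof -
        have "v ((p B * y) * (p B * y)) = 2 * v (p B * y)"
          using that y_neq_0 by (subst val_mult) (auto simp: p)
        moreover have "(p B * y) * (p B * y) = p (B * B * to_fract F)"
          by (simp add: p y_sq[symmetric])
        ultimately show ?thesis using v(3) by simp
      qed
      have odd: "odd (pt a (B * B * to_fract F))" if "B \<noteq> 0"
        using assms(1) that F_neq_0 by (simp add: valuation.val_mult[OF valuation_pt] branch_def)
      consider "B = 0" | "B \<noteq> 0" "A = 0" | "B \<noteq> 0" "A \<noteq> 0" by blast
      then show ?thesis
      proof cases
        case 1
        then show ?thesis unfolding z m_def using v(3) by (simp add: p)
      next
        case 2
        then show ?thesis unfolding z m_def using By by (simp add: p)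
      next
        case 3
        have neq: "2 * pt a A \<noteq> pt a (B * B * to_fract F)" using odd[OF 3(1)] by (metis even_mult_iff even_numeral)
        have vA: "2 * v (p A) = int e * (2 * pt a A)" using v(3) by simp
        have "2 * v (p A) \<noteq> 2 * v (p B * y)"
          unfolding vA By[OF 3(1)] using neq v(2) by simp
        then have "v (p A) \<noteq> v (p B * y)" by simp
        then have "v (p A + p B * y) = min (v (p A)) (v (p B * y))"
          using 3 y_neq_0 by (intro conjunct2[OF val_add_neq]) (auto simp: p)
        then have "2 * v z = min (2 * v (p A)) (2 * v (p B * y))"
          unfolding z by (simp add: min_def)
        also have "\<dots> = int e * m"
          unfolding vA By[OF 3(1)] m_def using 3 v(2) by (simp add: min_def)
        finally show ?thesis .
      qed
    qed
    then show ?thesis by blast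
  qed
  then obtain m where m: "2 * u z = int d * m" "2 * v z = int e * m"
    using assms by meson
  then have "2 * (int e * u z) = 2 * (int d * v z)"
    by (simp add: mult.left_commute)
  then show "int d * v z = int e * u z" by simp
qed

section \<open>Points away from the branch points\<close>

lemma at_least_p:
  assumes "v \<in> points i" "0 < e" "\<And>z. v (p z) = int e * pt a z" "valuation.at_least (pt a) 1 x"
  shows "valuation.at_least v 1 (p x)"
proof (cases "x = 0")
  case False
  then have "1 \<le> pt a x" using assms(4) by (simp add: valuation.at_least_def[OF valuation_pt])
  then have "1 * 1 \<le> int e * pt a x" using assms(2) by (intro mult_mono) auto
  then show ?thesis using assms(3) by (simp add: valuation.at_least_def[OF pointsD(1)[OF assms(1)]])
qed (simp add: p valuation.at_least_0[OF pointsD(1)[OF assms(1)]])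

text \<open>A power of a uniformizer of the line turns \<open>y\<close> into a unit
  \<open>y'\<close>. Its square has a nonzero residue \<open>s * s\<close>, so one factor of
  \<open>(y' - s) (y' + s)\<close> vanishes at each point over \<open>a\<close>. The statement
  ranges over all \<open>v\<close> and \<open>e\<close> because the index over \<open>a\<close> is
  not known yet.\<close>

lemma ex_unit_square_root:
  assumes "a \<notin> branch"
  shows "\<exists>s y'. s \<noteq> 0 \<and> w y' = - y' \<and> (\<forall>z. \<exists>A B. z = p A + p B * y') \<and>
    (\<forall>v e. v \<in> points i \<longrightarrow> 0 < e \<longrightarrow> (\<forall>z. v (p z) = int e * pt a z) \<longrightarrow>
      v y' = 0 \<and> (valuation.at_least v 1 (y' - i s) \<or> valuation.at_least v 1 (y' + i s)))"
proof -
  interpret va: valuation "pt a" by (rule valuation_pt)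
  obtain k where k: "pt a (to_fract F) = 2 * k" using assms by (auto simp: branch_def)
  obtain t where t: "pt a t = 1" using ex_uniformizer by blast
  then have t0: "t \<noteq> 0" using va.val_0 by auto
  define q where "q = t powi (- k)"
  have q0: "q \<noteq> 0" using t0 by (simp add: q_def power_int_eq_0_iff)
  define G where "G = q * q * to_fract F"
  have G: "G \<noteq> 0" "pt a G = 0"
    using q0 F_neq_0 by (simp_all add: G_def va.val_mult k) (simp add: q_def va.val_power_int t)
  obtain c where c: "va.at_least 1 (G - P1 c)" using pt_residue[of a G] G by auto
  have c0: "c \<noteq> 0"
    using c G by (auto simp: va.at_least_def field_hom_simps[OF field_hom_P1])
  obtain s where s: "s * s = c" using alg_closed_sqrt by blast
  define y' where "y' = p q * y"
  have y'2: "y' * y' = p G" by (simp add: y'_def G_def p flip: y_sq)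
  have decomp: "\<exists>A B. z = p A + p B * y'" for z
    using re_im[of z] q0 by (intro exI[of _ "re z"] exI[of _ "im z / q"]) (simp add: y'_def p)
  have "v y' = 0 \<and> (valuation.at_least v 1 (y' - i s) \<or> valuation.at_least v 1 (y' + i s))"
    if v: "v \<in> points i" "0 < e" "\<forall>z. v (p z) = int e * pt a z" for v e
  proof -
    interpret valuation v by (rule pointsD(1)[OF v(1)])
    have y'0: "y' \<noteq> 0" using q0 y_neq_0 by (simp add: y'_def p)
    have "2 * v y' = v (y' * y')" using y'0 by (simp add: val_mult)
    then have vy': "v y' = 0" unfolding y'2 using v(3) G(2) by simp
    have is0: "v (i s) = 0" using pointsD(2)[OF v(1), of s] s c0 by auto
    have "at_least 0 y'" "at_least 0 (i s)" by (simp_all add: at_least_def vy' is0)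
    then have ge: "at_least 0 (y' - i s)" "at_least 0 (y' + i s)"
      by (simp_all only: at_least_diff at_least_add)
    have "p (G - P1 c) = y' * y' - i s * i s"
      by (simp add: p p_const y'2 s flip: i(6))
    then have "(y' - i s) * (y' + i s) = p (G - P1 c)"
      by (simp add: algebra_simps)
    moreover have "at_least 1 (p (G - P1 c))"
      using at_least_p[OF v(1,2) _ c] v(3) by blast
    ultimately have "at_least 1 ((y' - i s) * (y' + i s))" by simp
    then have "at_least 1 (y' - i s) \<or> at_least 1 (y' + i s)"
      using ge val_mult[of "y' - i s" "y' + i s"]
      by (cases "y' - i s = 0"; cases "y' + i s = 0") (auto simp: at_least_def)
    then show ?thesis using vy' by simp
  qed
  moreover have "s \<noteq> 0" using c0 s by auto
  moreover have "w y' = - y'" by (simp add: y'_def w w_y)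
  ultimately show ?thesis using decomp by blast
qed

text \<open>The root \<open>s\<close> that \<open>y'\<close> approaches determines the point. After
  scaling, \<open>z\<close> has integral coordinates, one of them 1, and residue
  \<open>\<alpha> + \<beta> s\<close>. If this is 0, the conjugate has the nonzero residue
  \<open>\<alpha> - \<beta> s\<close>, and the value of \<open>z\<close> is that of its
  norm.\<close>

lemma proportional_if_same_root:
  assumes "s \<noteq> 0" "w y' = - y'" "\<And>z. \<exists>A B. z = p A + p B * y'"
  shows "\<exists>m. \<forall>v e. v \<in> points i \<longrightarrow> 0 < e \<longrightarrow> (\<forall>z. v (p z) = int e * pt a z) \<longrightarrow>
    v y' = 0 \<longrightarrow> valuation.at_least v 1 (y' - i s) \<longrightarrow> v z = int e * m"
proof (cases "z = 0")
  case True
  then show ?thesis using valuation.val_0[OF pointsD(1)] by (intro exI[of _ 0]) auto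
next
  case z0: False
  interpret va: valuation "pt a" by (rule valuation_pt)
  obtain A B where z: "z = p A + p B * y'" using assms(3) by blast
  \<comment> \<open>Divide by the coordinate of smaller value, so that both quotients are integral
    and one of them is 1.\<close>
  have "\<exists>\<gamma>. \<gamma> \<noteq> 0 \<and> va.at_least 0 (A / \<gamma>) \<and> va.at_least 0 (B / \<gamma>) \<and> (A / \<gamma> = 1 \<or> B / \<gamma> = 1)"
  proof (cases "A \<noteq> 0 \<and> (B = 0 \<or> pt a A \<le> pt a B)")
    case True
    then show ?thesis
      by (cases "B = 0"; intro exI[of _ A]) (auto simp: va.at_least_def va.val_divide va.val_1)
  next
    case False
    then have "B \<noteq> 0" using z z0 by (auto simp: p)
    then show ?thesis using False
      by (cases "A = 0"; intro exI[of _ B]) (auto simp: va.at_least_def va.val_divide va.val_1)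
  qed
  then obtain \<gamma> A1 B1 where \<gamma>: "\<gamma> \<noteq> 0" "A1 = A / \<gamma>" "B1 = B / \<gamma>"
    "va.at_least 0 A1" "va.at_least 0 B1" "A1 = 1 \<or> B1 = 1" by blast
  have "0 \<le> pt a A1" "0 \<le> pt a B1"
    using \<gamma>(4,5) va.val_0 by (auto simp: va.at_least_def)
  then obtain \<alpha> \<beta> where res: "va.at_least 1 (A1 - P1 \<alpha>)" "va.at_least 1 (B1 - P1 \<beta>)"
    using pt_residue by blast
  have \<alpha>\<beta>: "\<alpha> \<noteq> 0 \<or> \<beta> \<noteq> 0"
    using res \<gamma>(6) va.val_1 by (auto simp: va.at_least_def field_hom_simps[OF field_hom_P1])
  define z1 where "z1 = p A1 + p B1 * y'"
  have zz1: "z = p \<gamma> * z1" using \<gamma>(1) by (simp add: z1_def z \<gamma>(2,3) p field_simps)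
  have z10: "z1 \<noteq> 0" using zz1 z0 by auto
  obtain N where N: "z1 * w z1 = p N" using norm_eq by blast
  \<comment> \<open>Independent of \<open>v\<close>: the value of the scaling factor, plus that of
    the norm if the residue vanishes.\<close>
  define m where "m = pt a \<gamma> + (if \<alpha> + \<beta> * s \<noteq> 0 then 0 else pt a N)"
  have "v z = int e * m"
    if v: "v \<in> points i" "0 < e" "\<forall>z. v (p z) = int e * pt a z" "v y' = 0" "valuation.at_least v 1 (y' - i s)" for v e
  proof -
    interpret valuation v by (rule pointsD(1)[OF v(1)])
    have up: "at_least 1 (p x)" if "va.at_least 1 x" for x
      using at_least_p[OF v(1,2) _ that] v(3) by blast
    have y': "at_least 0 y'" using v(4) by (simp add: at_least_def)
    have ic: "at_least 0 (i c)" for c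
      using pointsD(2)[OF v(1), of c] by (cases "c = 0") (auto simp: at_least_def i)
    have parts: "at_least 1 (p (A1 - P1 \<alpha>))" "at_least 1 (p (B1 - P1 \<beta>) * y')" "at_least 1 (i \<beta> * (y' - i s))"
      using up[OF res(1)] at_least_mult[OF up[OF res(2)] y'] at_least_mult[OF ic v(5), of \<beta>] by simp_all
    have unit: "v x = 0" if "c \<noteq> 0" "at_least 1 (x - i c)" for x c
    proof -
      have "v (i c + (x - i c)) = v (i c)"
        using that pointsD(2)[OF v(1) that(1)] by (intro conjunct2[OF val_add_eq]) (auto simp: i)
      then show ?thesis using pointsD(2)[OF v(1) that(1)] by simp
    qed
    have "v z1 = int e * (if \<alpha> + \<beta> * s \<noteq> 0 then 0 else pt a N)"
    proof (cases "\<alpha> + \<beta> * s = 0")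
      case False
      have "z1 - i (\<alpha> + \<beta> * s) = p (A1 - P1 \<alpha>) + p (B1 - P1 \<beta>) * y' + i \<beta> * (y' - i s)"
        by (simp add: z1_def p p_const i algebra_simps)
      then have "at_least 1 (z1 - i (\<alpha> + \<beta> * s))"
        using parts by (simp add: at_least_add)
      then show ?thesis using unit[OF False] False by simp
    next
      case True
      then have ne: "\<alpha> - \<beta> * s \<noteq> 0"
      proof -
        have "\<alpha> = - (\<beta> * s)" using True by (simp add: eq_neg_iff_add_eq_0)
        then have "\<alpha> - \<beta> * s = - 2 * (\<beta> * s)" by simp
        then show ?thesis using \<alpha>\<beta> \<open>\<alpha> = - (\<beta> * s)\<close> assms(1) by auto
      qed
      have "w z1 - i (\<alpha> - \<beta> * s) = p (A1 - P1 \<alpha>) - p (B1 - P1 \<beta>) * y' - i \<beta> * (y' - i s)"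
        by (simp add: z1_def w p p_const i assms(2) algebra_simps)
      then have "at_least 1 (w z1 - i (\<alpha> - \<beta> * s))"
        using parts by (simp add: at_least_diff)
      then have "v (w z1) = 0" by (rule unit[OF ne])
      moreover have "v (z1 * w z1) = v z1 + v (w z1)"
        using z10 by (intro val_mult) (simp_all add: w)
      ultimately show ?thesis using True N v(3) by simp
    qed
    then show ?thesis
      unfolding m_def zz1 using z10 \<gamma>(1) v(3) by (subst val_mult) (simp_all add: p algebra_simps)
  qed
  then show ?thesis by blast
qed

text \<open>Replacing the parameter by its square at a branch point makes the order of
  \<open>F\<close> even; elsewhere it is even already. So \<open>F\<close> acquires a square root
  \<open>T\<close> in k((t)), and \<open>y\<close> is sent to \<open>T\<close>.\<close>

lemma ex_laurent_over:
  fixes a :: "'k option"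
  defines "e \<equiv> if a \<in> branch then 2 else 1"
  shows "\<exists>\<sigma>. field_hom \<sigma> \<and> (\<forall>c. \<sigma> (i c) = fls_const c) \<and>
    (\<forall>z. fls_subdegree (\<sigma> (p z)) = int e * pt a z) \<and> (\<exists>t. fls_subdegree (\<sigma> t) = 1)"
proof -
  have e: "0 < e" by (simp add: e_def)
  obtain \<rho> where \<rho>: "field_hom \<rho>" "\<And>c. \<rho> (P1 c) = fls_const c"
    "\<And>p. p \<noteq> 0 \<Longrightarrow> fls_subdegree (\<rho> (to_fract p)) = int e * ord a p"
    using ex_laurent_hom[OF e, of a] by metis
  note r = field_hom_simps[OF \<rho>(1)]
  have "valuation (\<lambda>z. fls_subdegree (\<rho> z))"
  proof
    fix x y :: "'k poly fract" assume "x \<noteq> 0" "y \<noteq> 0" "x + y \<noteq> 0"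
    then show "min (fls_subdegree (\<rho> x)) (fls_subdegree (\<rho> y)) \<le> fls_subdegree (\<rho> (x + y))"
      using fls_plus_subdegree[of "\<rho> x" "\<rho> y"] by (simp add: r flip: r(3))
  qed (simp_all add: r)
  then have sub: "fls_subdegree (\<rho> z) = int e * pt a z" for z
    using pt_multiple \<rho>(3) by blast
  have "even (fls_subdegree (\<rho> (to_fract F)))"
    unfolding sub e_def branch_def by auto
  then obtain T where T: "T * T = \<rho> (to_fract F)" using fls_sqrt by blast
  define \<sigma> where "\<sigma> z = \<rho> (re z) + \<rho> (im z) * T" for z
  have eq: "re (z + z') = re z + re z'" "im (z + z') = im z + im z'"
    "re (z * z') = re z * re z' + im z * im z' * to_fract F" "im (z * z') = re z * im z' + im z * re z'" for z z'
  proof -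
    have "z + z' = p (re z + re z') + p (im z + im z') * y"
      using re_im[of z] re_im[of z'] by (simp add: p algebra_simps)
    then show "re (z + z') = re z + re z'" "im (z + z') = im z + im z'" by (metis re_im_unique)+
    have "z * z' = (p (re z) + p (im z) * y) * (p (re z') + p (im z') * y)"
      using re_im[of z] re_im[of z'] by simp
    also have "\<dots> = p (re z) * p (re z') + p (im z) * p (im z') * (y * y) + (p (re z) * p (im z') + p (im z) * p (re z')) * y"
      by (simp add: algebra_simps)
    also have "\<dots> = p (re z * re z' + im z * im z' * to_fract F) + p (re z * im z' + im z * re z') * y"
      by (simp add: y_sq p)
    finally show "re (z * z') = re z * re z' + im z * im z' * to_fract F" "im (z * z') = re z * im z' + im z * re z'"
      by (metis re_im_unique)+
  qed
  have one: "re 1 = 1" "im 1 = 0" using re_im_p[of 1] by (simp_all add: p)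
  have "field_hom \<sigma>"
    unfolding field_hom_def
  proof (intro conjI allI)
    show "\<sigma> 1 = 1" by (simp add: \<sigma>_def one r)
    fix z z'
    show "\<sigma> (z + z') = \<sigma> z + \<sigma> z'" by (simp add: \<sigma>_def eq r algebra_simps)
    show "\<sigma> (z * z') = \<sigma> z * \<sigma> z'" by (simp add: \<sigma>_def eq r T[symmetric] algebra_simps)
  qed
  moreover have \<sigma>p: "\<sigma> (p z) = \<rho> z" for z by (simp add: \<sigma>_def re_im_p r)
  moreover have "\<sigma> (i c) = fls_const c" for c using \<sigma>p[of "P1 c"] \<rho>(2) p_const by simp
  moreover have "\<exists>t. fls_subdegree (\<sigma> t) = 1"
  proof -
    obtain t where t: "pt a t = 1" using ex_uniformizer by blast
    show ?thesis
    proof (cases "a \<in> branch")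
      case False
      then show ?thesis using t sub[of t] \<sigma>p[of t] by (intro exI[of _ "p t"]) (simp add: e_def)
    next
      case True
      have \<sigma>y: "\<sigma> y = T" using re_im_unique[of 0 1] by (simp add: \<sigma>_def p r)
      have T0: "T \<noteq> 0" using T F_neq_0 r(10)[of "to_fract F"] by auto
      have "2 * fls_subdegree T = 2 * pt a (to_fract F)"
        using sub[of "to_fract F"] True T0 by (simp add: e_def flip: T)
      \<comment> \<open>\<open>T\<close> has the odd order that \<open>F\<close> has on the line,
        while \<open>t\<close> has order 2; a power of \<open>t\<close> brings the order of
        \<open>T\<close> down to 1.\<close>
      then obtain k where k: "fls_subdegree T = 2 * k + 1"
        using True by (auto simp: branch_def elim: oddE)
      have "\<sigma> (y * p (t powi (- k))) = T * \<rho> t powi (- k)"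
        using \<open>field_hom \<sigma>\<close> by (simp add: field_hom_simps \<sigma>y \<sigma>p r)
      moreover have "\<rho> t \<noteq> 0" using t valuation.val_0[OF valuation_pt, of a] by (auto simp: r)
      moreover have "fls_subdegree (\<rho> t) = 2" using sub[of t] t True by (simp add: e_def)
      ultimately have "fls_subdegree (\<sigma> (y * p (t powi (- k)))) = 1"
        using T0 k by simp
      then show ?thesis by blast
    qed
  qed
  ultimately show ?thesis using sub by (intro exI[of _ \<sigma>]) auto
qed

text \<open>The Laurent expansion yields one point over \<open>a\<close>, and
  \<open>proportional_if_branch\<close> shows that it is the only one; hence it is fixed by
  \<open>w\<close>, and what the expansion shows holds for the whole fiber.\<close>

lemma points_over_branch:
  assumes "a \<in> branch"
  shows "\<exists>P \<in> points i. {Q \<in> points i. image_point p Q = pt a} = {P} \<and> ram_index p P = 2 \<and>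
    (\<lambda>z. P (w z)) = P \<and> (\<forall>z. 0 \<le> P z \<longrightarrow> (\<exists>c. valuation.at_least P 1 (z - i c)))"
proof -
  obtain \<sigma> t where \<sigma>: "field_hom \<sigma>" "\<And>c. \<sigma> (i c) = fls_const c"
    "\<And>z. fls_subdegree (\<sigma> (p z)) = int 2 * pt a z" "fls_subdegree (\<sigma> t) = 1"
    using ex_laurent_over[of a] assms by auto
  define P where "P = (\<lambda>z. fls_subdegree (\<sigma> z))"
  have P: "P \<in> points i" unfolding P_def by (rule laurent_point[where i=i, OF \<sigma>(1,2,4)])
  have Pp: "P (p z) = int 2 * pt a z" for z unfolding P_def by (rule \<sigma>(3))
  have ram: "ram_index p P = 2" "image_point p P = pt a"
    using restrict_point[where v=P, OF Pp pt_point] by auto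
  have uniq: "Q = P" if Q: "Q \<in> points i" "image_point p Q = pt a" for Q
  proof -
    obtain b where b: "image_point p Q = pt b" "0 < ram_index p Q" "\<And>z. Q (p z) = int (ram_index p Q) * pt b z"
      using over_pt[OF Q(1)] by blast
    have "b = a" using b(1) Q(2) by (simp add: pt_inj)
    show ?thesis
      using proportional_if_branch[OF assms P Q(1) _ b(2) Pp] b(3) \<open>b = a\<close> by simp
  qed
  have "(\<lambda>z. P (w z)) = P"
    by (rule uniq[OF point_w(1)[OF P]]) (simp only: point_w(3)[OF P] ram)
  moreover have "\<exists>c. valuation.at_least P 1 (z - i c)" if "0 \<le> P z" for z
    unfolding valuation.at_least_def[OF pointsD(1)[OF P]]
    using laurent_residue[where i=i, OF \<sigma>(1,2), of z] that by (auto simp: P_def)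
  moreover have "{Q \<in> points i. image_point p Q = pt a} = {P}"
    using uniq P ram(2) by blast
  ultimately show ?thesis using P ram(1) by (intro bexI[of _ P] conjI allI impI) assumption+
qed

text \<open>The sign of the root \<open>s\<close> is adjusted to the point \<open>R\<close> given by
  the Laurent expansion. At a point over \<open>a\<close>, either \<open>y'\<close> approaches
  \<open>s\<close> and the point is \<open>R\<close>, or it approaches \<open>- s\<close> and the
  conjugate point is \<open>R\<close>. Were \<open>R\<close> its own conjugate, \<open>2 * s\<close>
  would vanish there.\<close>

lemma points_over_nonbranch:
  assumes "a \<notin> branch"
  shows "\<exists>P \<in> points i. {Q \<in> points i. image_point p Q = pt a} = {P, \<lambda>z. P (w z)} \<and> ram_index p P = 1 \<and>
    (\<lambda>z. P (w z)) \<noteq> P \<and> (\<forall>z. 0 \<le> P z \<longrightarrow> (\<exists>c. valuation.at_least P 1 (z - i c)))"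
proof -
  obtain \<sigma> t where \<sigma>: "field_hom \<sigma>" "\<And>c. \<sigma> (i c) = fls_const c"
    "\<And>z. fls_subdegree (\<sigma> (p z)) = int 1 * pt a z" "fls_subdegree (\<sigma> t) = 1"
    using ex_laurent_over[of a] assms by auto
  define R where "R = (\<lambda>z. fls_subdegree (\<sigma> z))"
  have R: "R \<in> points i" unfolding R_def by (rule laurent_point[where i=i, OF \<sigma>(1,2,4)])
  have Rp: "R (p z) = int 1 * pt a z" for z unfolding R_def by (rule \<sigma>(3))
  have ram: "ram_index p R = 1" "image_point p R = pt a"
    using restrict_point[where v=R, OF Rp pt_point] by auto
  interpret R: valuation R by (rule pointsD(1)[OF R])
  obtain s y' where s: "s \<noteq> 0" "w y' = - y'" "\<And>z. \<exists>A B. z = p A + p B * y'"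
    and sv: "\<And>v e. v \<in> points i \<Longrightarrow> 0 < e \<Longrightarrow> (\<And>z. v (p z) = int e * pt a z) \<Longrightarrow>
      v y' = 0 \<and> (valuation.at_least v 1 (y' - i s) \<or> valuation.at_least v 1 (y' + i s))"
    using ex_unit_square_root[OF assms] by metis
  have "\<exists>s. s \<noteq> 0 \<and> R.at_least 1 (y' - i s) \<and> (\<forall>v e. v \<in> points i \<longrightarrow> 0 < e \<longrightarrow> (\<forall>z. v (p z) = int e * pt a z) \<longrightarrow>
      v y' = 0 \<and> (valuation.at_least v 1 (y' - i s) \<or> valuation.at_least v 1 (y' + i s)))"
  proof (cases "R.at_least 1 (y' - i s)")
    case True
    then show ?thesis using s sv by (intro exI[of _ s]) blast
  next
    case False
    then have "R.at_least 1 (y' + i s)" using sv[OF R _ Rp] by simp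
    then show ?thesis using s sv by (intro exI[of _ "- s"]) (auto simp: i)
  qed
  then obtain s where s: "s \<noteq> 0" "w y' = - y'" "\<And>z. \<exists>A B. z = p A + p B * y'" and Rs: "R.at_least 1 (y' - i s)"
    and sv: "\<And>v e. v \<in> points i \<Longrightarrow> 0 < e \<Longrightarrow> (\<And>z. v (p z) = int e * pt a z) \<Longrightarrow>
      v y' = 0 \<and> (valuation.at_least v 1 (y' - i s) \<or> valuation.at_least v 1 (y' + i s))"
    using s by metis
  have uniq: "v = R" if v: "v \<in> points i" "0 < e" "\<And>z. v (p z) = int e * pt a z"
    and vs: "valuation.at_least v 1 (y' - i s)" for v e
  proof (rule proportional_points_eq[OF R v(1) _ v(2), of 1])
    fix z
    have "v y' = 0" "R y' = 0" using sv[OF v] sv[OF R _ Rp] by simp_all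
    then obtain m where "R z = int 1 * m" "v z = int e * m"
      using proportional_if_same_root[OF s, of a z] R v(1,2) v(3) Rp Rs vs zero_less_one by metis
    then show "int 1 * v z = int e * R z" by simp
  qed simp
  have "{Q \<in> points i. image_point p Q = pt a} \<subseteq> {R, \<lambda>z. R (w z)}"
  proof
    fix Q assume "Q \<in> {Q \<in> points i. image_point p Q = pt a}"
    then have Q: "Q \<in> points i" "image_point p Q = pt a" by auto
    obtain b where b: "image_point p Q = pt b" "0 < ram_index p Q" "\<And>z. Q (p z) = int (ram_index p Q) * pt b z"
      using over_pt[OF Q(1)] by blast
    have "b = a" using b(1) Q(2) by (simp add: pt_inj)
    note Qp = b(3)[unfolded \<open>b = a\<close>]
    consider "valuation.at_least Q 1 (y' - i s)" | "valuation.at_least Q 1 (y' + i s)"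
      using sv[OF Q(1) b(2) Qp] by blast
    then show "Q \<in> {R, \<lambda>z. R (w z)}"
    proof cases
      case 1
      then show ?thesis using uniq[OF Q(1) b(2) Qp] by simp
    next
      case 2
      interpret Q: valuation Q by (rule pointsD(1)[OF Q(1)])
      interpret Qw: valuation "\<lambda>z. Q (w z)" by (rule pointsD(1)[OF point_w(1)[OF Q(1)]])
      have "w (y' - i s) = - (y' + i s)" by (simp add: w s(2))
      then have "Q (w (y' - i s)) = Q (y' + i s)" by (simp only: Q.val_minus)
      moreover have "y' - i s = 0 \<longleftrightarrow> y' + i s = 0"
        using \<open>w (y' - i s) = - (y' + i s)\<close> by (metis neg_equal_0_iff_equal w(10))
      ultimately have "Qw.at_least 1 (y' - i s)"
        using 2 by (auto simp: Q.at_least_def Qw.at_least_def)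
      then have "(\<lambda>z. Q (w z)) = R"
        using uniq[OF point_w(1)[OF Q(1)] b(2)] Qp by simp
      then have "Q z = R (w z)" for z by (metis w_w)
      then show ?thesis by auto
    qed
  qed
  then have "{Q \<in> points i. image_point p Q = pt a} = {R, \<lambda>z. R (w z)}"
    using R point_w(1)[OF R] ram by (auto simp only: point_w(3)[OF R])
  moreover have "(\<lambda>z. R (w z)) \<noteq> R"
  proof
    assume eq: "(\<lambda>z. R (w z)) = R"
    have "w (y' - i s) = - (y' + i s)" by (simp add: w s(2))
    then have "R (y' + i s) = R (w (y' - i s))" by (simp only: R.val_minus)
    also have "\<dots> = R (y' - i s)" using eq by metis
    finally have eq': "R (y' + i s) = R (y' - i s)" .
    have "y' - i s = 0 \<longleftrightarrow> y' + i s = 0"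
      using \<open>w (y' - i s) = - (y' + i s)\<close> by (metis neg_equal_0_iff_equal w(10))
    then have "R.at_least 1 (y' + i s)"
      using Rs eq' unfolding R.at_least_def by simp
    then have "R.at_least 1 ((y' + i s) - (y' - i s))" using Rs by (rule R.at_least_diff)
    moreover have "(y' + i s) - (y' - i s) = i (2 * s)" by (simp add: i)
    ultimately show False
      using pointsD(2)[OF R, of "2 * s"] s(1) by (simp add: R.at_least_def) (simp add: i two_neq_0)
  qed
  moreover have "\<exists>c. R.at_least 1 (z - i c)" if "0 \<le> R z" for z
    unfolding R.at_least_def
    using laurent_residue[where i=i, OF \<sigma>(1,2), of z] that by (auto simp: R_def)
  ultimately show ?thesis using R ram(1) by (intro bexI[of _ R] conjI allI impI) assumption+
qed

end

section \<open>Riemann-Roch spaces of double covers\<close>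

lemma (in vector_space) independent_familyI:
  assumes "finite S" "\<And>c. (\<Sum>s\<in>S. c s *s b s) = 0 \<Longrightarrow> \<forall>s\<in>S. c s = 0"
  shows "inj_on b S" "independent (b ` S)"
proof -
  show inj: "inj_on b S"
  proof (rule inj_onI, rule ccontr)
    fix s t assume st: "s \<in> S" "t \<in> S" "b s = b t" "s \<noteq> t"
    define c where "c x = (if x = s then 1 else if x = t then -1 else 0 :: 'a)" for x
    have "(\<Sum>x\<in>S. c x *s b x) = (\<Sum>x\<in>{s, t}. c x *s b x)"
      using st assms(1) by (intro sum.mono_neutral_right) (auto simp: c_def)
    also have "\<dots> = 0" using st by (simp add: c_def)
    finally show False using assms(2)[of c] st by (auto simp: c_def)
  qed
  show "independent (b ` S)"
  proof (rule independent_if_scalars_zero)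
    fix f x assume "(\<Sum>x\<in>b ` S. f x *s x) = 0" "x \<in> b ` S"
    then show "f x = 0"
      using assms(2)[of "f \<circ> b"] by (auto simp: sum.reindex[OF inj])
  qed (use assms in auto)
qed

lemma deg_eq_sum: "finite A \<Longrightarrow> Poly_Mapping.keys D \<subseteq> A \<Longrightarrow> deg D = (\<Sum>P\<in>A. Poly_Mapping.lookup D P)"
  unfolding deg_def by (intro sum.mono_neutral_left) (auto simp: in_keys_iff)

lemma deg_diff_single: "deg (D - Poly_Mapping.single P c) = deg D - c"
proof -
  let ?A = "insert P (Poly_Mapping.keys D)"
  have "deg (D - Poly_Mapping.single P c) = (\<Sum>Q\<in>?A. Poly_Mapping.lookup D Q - Poly_Mapping.lookup (Poly_Mapping.single P c) Q)"
    unfolding lookup_minus[symmetric]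
    by (rule deg_eq_sum) (auto simp: in_keys_iff lookup_minus lookup_single when_def split: if_splits)
  also have "\<dots> = deg D - (\<Sum>Q\<in>?A. Poly_Mapping.lookup (Poly_Mapping.single P c) Q)"
    unfolding sum_subtractf by (subst deg_eq_sum[of ?A D]) auto
  also have "(\<Sum>Q\<in>?A. Poly_Mapping.lookup (Poly_Mapping.single P c) Q) = c"
    by (simp add: lookup_single when_def)
  finally show ?thesis .
qed

lemma RR_space_iff:
  "z \<in> RR_space i D \<longleftrightarrow> (\<forall>P\<in>points i. valuation.at_least P (- Poly_Mapping.lookup D P) z)"
  if "points i \<noteq> {}"
  using that by (auto simp: RR_space_def valuation.at_least_def[OF pointsD(1)])

lemma RR_space_mono:
  "(\<And>P. P \<in> points i \<Longrightarrow> Poly_Mapping.lookup D P \<le> Poly_Mapping.lookup D' P) \<Longrightarrow> RR_space i D \<subseteq> RR_space i D'"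
  unfolding RR_space_def by force

context double_cover begin

lemma vector_space_i: "vector_space (\<lambda>c z. i c * z)"
  by unfold_locales (simp_all add: i algebra_simps)

section \<open>Fibers of the quotient map\<close>

definition fiber :: "'k option \<Rightarrow> ('a \<Rightarrow> int) set" where
  "fiber a = {Q \<in> points i. image_point p Q = pt a}"

lemma fiberE:
  assumes "P \<in> points i"
  obtains a where "P \<in> fiber a"
  using over_pt[OF assms] assms unfolding fiber_def by blast

lemma fiber_ram:
  assumes "P \<in> fiber a"
  shows "ram_index p P = (if a \<in> branch then 2 else 1)"
proof (cases "a \<in> branch")
  case True
  then obtain R where "fiber a = {R}" "ram_index p R = 2"
    using points_over_branch[OF True, folded fiber_def] by blast
  then show ?thesis using True assms by simp
next
  case False
  then obtain R where R: "R \<in> points i" "fiber a = {R, \<lambda>z. R (w z)}" "ram_index p R = 1"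
    using points_over_nonbranch[OF False, folded fiber_def] by blast
  then consider "P = R" | "P = (\<lambda>z. R (w z))" using assms by blast
  then show ?thesis by cases (use False R(3) point_w(4)[OF R(1)] in simp_all)
qed

lemma fiber_val:
  assumes "P \<in> fiber a"
  shows "P (p z) = (if a \<in> branch then 2 else 1) * pt a z"
proof -
  have P: "P \<in> points i" "image_point p P = pt a" using assms by (auto simp: fiber_def)
  obtain b where b: "image_point p P = pt b" "\<And>z. P (p z) = int (ram_index p P) * pt b z"
    using over_pt[OF P(1)] by blast
  then have "b = a" using P(2) by (simp add: pt_inj)
  then show ?thesis using b(2)[of z] fiber_ram[OF assms] by simp
qed

lemma fiber_point: "P \<in> fiber a \<Longrightarrow> P \<in> points i"
  by (simp add: fiber_def)

lemma fiber_unique: "P \<in> fiber a \<Longrightarrow> P \<in> fiber b \<Longrightarrow> a = b"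
  by (simp add: fiber_def pt_inj)

lemma fiber_w: "P \<in> fiber a \<Longrightarrow> (\<lambda>z. P (w z)) \<in> fiber a"
  using point_w[of P] by (simp add: fiber_def)

lemma fiber_branch:
  assumes "a \<in> branch"
  obtains P where "fiber a = {P}" "(\<lambda>z. P (w z)) = P"
  using points_over_branch[OF assms] unfolding fiber_def by blast

lemma fiber_nonbranch:
  assumes "a \<notin> branch"
  obtains P where "fiber a = {P, \<lambda>z. P (w z)}" "(\<lambda>z. P (w z)) \<noteq> P"
  using points_over_nonbranch[OF assms] unfolding fiber_def by blast

lemma fiber_nonbranch_eq:
  assumes "a \<notin> branch" "P \<in> fiber a"
  shows "fiber a = {P, \<lambda>z. P (w z)}" "(\<lambda>z. P (w z)) \<noteq> P"
proof -
  obtain Q where Q: "fiber a = {Q, \<lambda>z. Q (w z)}" "(\<lambda>z. Q (w z)) \<noteq> Q"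
    by (rule fiber_nonbranch[OF assms(1)])
  then consider "P = Q" | "P = (\<lambda>z. Q (w z))" using assms(2) by blast
  then have "fiber a = {P, \<lambda>z. P (w z)} \<and> (\<lambda>z. P (w z)) \<noteq> P"
  proof cases
    case 2
    then have "(\<lambda>z. P (w z)) = Q" by simp
    then show ?thesis using 2 Q by (metis insert_commute)
  qed (use Q in blast)
  then show "fiber a = {P, \<lambda>z. P (w z)}" "(\<lambda>z. P (w z)) \<noteq> P" by auto
qed

lemma fiber_nonempty: "\<exists>P. P \<in> fiber a"
  using fiber_branch[of a] fiber_nonbranch[of a] by (metis insertI1)

lemma finite_fiber: "finite (fiber a)"
  using fiber_branch[of a] fiber_nonbranch[of a] by (metis finite.emptyI finite.insertI)

lemma sum_fiber_ram: "(\<Sum>P\<in>fiber a. int (ram_index p P)) = 2"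
proof -
  have "(\<Sum>P\<in>fiber a. int (ram_index p P)) = (\<Sum>P\<in>fiber a. if a \<in> branch then 2 else 1)"
    by (rule sum.cong) (auto simp: fiber_ram)
  also have "\<dots> = 2"
  proof (cases "a \<in> branch")
    case True
    obtain P where "fiber a = {P}" by (rule fiber_branch[OF True])
    then show ?thesis using True by simp
  next
    case False
    obtain P where "fiber a = {P, \<lambda>z. P (w z)}" "(\<lambda>z. P (w z)) \<noteq> P" by (rule fiber_nonbranch[OF False])
    then show ?thesis using False by auto
  qed
  finally show ?thesis .
qed

text \<open>Residues are known at one point of each fiber; \<open>w\<close> carries them to the
  conjugate point.\<close>

lemma point_residue:
  assumes "P \<in> points i" "0 \<le> P z"
  shows "\<exists>c. valuation.at_least P 1 (z - i c)"
proof -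
  obtain a where a: "P \<in> fiber a" by (rule fiberE[OF assms(1)])
  show ?thesis
  proof (cases "a \<in> branch")
    case True
    then obtain R where "fiber a = {R}" "\<And>z. 0 \<le> R z \<Longrightarrow> \<exists>c. valuation.at_least R 1 (z - i c)"
      using points_over_branch[OF True, folded fiber_def] by blast
    then show ?thesis using a assms(2) by simp
  next
    case False
    then obtain R where R: "R \<in> points i" "fiber a = {R, \<lambda>z. R (w z)}"
      and res: "\<And>z. 0 \<le> R z \<Longrightarrow> \<exists>c. valuation.at_least R 1 (z - i c)"
      using points_over_nonbranch[OF False] unfolding fiber_def by blast
    from a R(2) consider "P = R" | "P = (\<lambda>z. R (w z))" by blast
    then show ?thesis
    proof cases
      case 1
      then show ?thesis using res assms(2) by blast
    next
      case 2
      then obtain c where c: "valuation.at_least R 1 (w z - i c)" using res[of "w z"] assms(2) by blast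
      have eq: "w z - i c = w (z - i c)" by (simp add: w)
      have "w (z - i c) = 0 \<longleftrightarrow> z - i c = 0" by (rule w(10))
      then have "valuation.at_least P 1 (z - i c)"
        using c fun_cong[OF 2, of "z - i c"]
        unfolding valuation.at_least_def[OF pointsD(1)[OF assms(1)]] valuation.at_least_def[OF pointsD(1)[OF R(1)]] eq
        by argo
      then show ?thesis by blast
    qed
  qed
qed

lemma points_nonempty: "points i \<noteq> {}"
  using fiber_nonempty fiber_point by blast

text \<open>If \<open>z0\<close> has the full pole order allowed at \<open>P\<close>, any other
  \<open>z\<close> loses it after subtracting the multiple of \<open>z0\<close> given by the residue
  of \<open>z / z0\<close>. The spanning set \<open>B\<close> ensures finite dimension, as
  \<open>dim\<close> is 0 otherwise.\<close>

lemma ell_le_Suc: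
  assumes P: "P \<in> points i" and B: "finite B" "RR_space i D \<subseteq> module.span (\<lambda>c z. i c * z) B"
  shows "ell i D \<le> ell i (D - Poly_Mapping.single P 1) + 1"
proof -
  interpret V: vector_space "\<lambda>c z. i c * z" by (rule vector_space_i)
  let ?D = "D - Poly_Mapping.single P 1"
  have look: "Poly_Mapping.lookup ?D Q = Poly_Mapping.lookup D Q - (if Q = P then 1 else 0)" for Q
    by (simp add: lookup_minus lookup_single when_def)
  have sub: "RR_space i ?D \<subseteq> RR_space i D"
    by (rule RR_space_mono) (simp add: look)
  obtain B' where B': "B' \<subseteq> RR_space i ?D" "V.independent B'" "RR_space i ?D \<subseteq> V.span B'" "card B' = V.dim (RR_space i ?D)"
    by (rule V.basis_exists)
  have "B' \<subseteq> V.span B" using B'(1) sub B(2) by blast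
  then have fin: "finite B'" using V.independent_span_bound[OF B(1) B'(2)] by blast
  have "\<exists>z0. RR_space i D \<subseteq> V.span (insert z0 B')"
  proof (cases "RR_space i D \<subseteq> RR_space i ?D")
    case True
    then show ?thesis using B'(3) V.span_mono[of B' "insert 0 B'"] by blast
  next
    case False
    then obtain z0 where z0: "z0 \<in> RR_space i D" "z0 \<notin> RR_space i ?D" by blast
    interpret P: valuation P by (rule pointsD(1)[OF P])
    have z00: "z0 \<noteq> 0" using z0(2) by (auto simp: RR_space_def)
    obtain Q where Q: "Q \<in> points i" "Q z0 < - Poly_Mapping.lookup ?D Q"
      using z0(2) z00 by (auto simp: RR_space_def not_le)
    have ge: "- Poly_Mapping.lookup D R \<le> R z0" if "R \<in> points i" for R
      using z0(1) z00 that by (auto simp: RR_space_def)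
    have "Q = P" using Q(2) ge[OF Q(1)] by (auto simp: look split: if_splits)
    then have Pz0: "P z0 = - Poly_Mapping.lookup D P" using Q(2) ge[OF P] by (simp add: look)
    have "RR_space i D \<subseteq> V.span (insert z0 B')"
    proof
      fix z assume z: "z \<in> RR_space i D"
      have zge: "valuation.at_least R (- Poly_Mapping.lookup D R) z" if "R \<in> points i" for R
        using z that RR_space_iff[OF points_nonempty] by blast
      have "0 \<le> P (z / z0)"
        using zge[OF P] Pz0 z00 P.val_divide[of z z0] P.val_0 by (cases "z = 0") (auto simp: P.at_least_def)
      then obtain c where c: "P.at_least 1 (z / z0 - i c)" using point_residue[OF P] by blast
      have "z - i c * z0 \<in> RR_space i ?D"
        unfolding RR_space_iff[OF points_nonempty]
      proof
        fix R assume R: "R \<in> points i"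
        interpret R: valuation R by (rule pointsD(1)[OF R])
        show "R.at_least (- Poly_Mapping.lookup ?D R) (z - i c * z0)"
        proof (cases "R = P")
          case True
          have "P.at_least (1 + P z0) ((z / z0 - i c) * z0)"
            using c by (intro P.at_least_mult) (simp_all add: P.at_least_def)
          then show ?thesis using True z00 Pz0 by (simp add: look left_diff_distrib)
        next
          case False
          have "R.at_least 0 (i c)" using pointsD(2)[OF R, of c] by (cases "c = 0") (auto simp: R.at_least_def i)
          then have "R.at_least (- Poly_Mapping.lookup D R) (i c * z0)"
            using ge[OF R] by (intro R.at_least_mult0) (auto simp: R.at_least_def)
          then show ?thesis using False zge[OF R] by (simp add: look R.at_least_diff)
        qed
      qed
      then have "z - i c * z0 \<in> V.span (insert z0 B')"
        using B'(3) V.span_mono[of B' "insert z0 B'"] by blast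
      moreover have "i c * z0 \<in> V.span (insert z0 B')" by (intro V.span_scale V.span_base) simp
      ultimately have "(z - i c * z0) + i c * z0 \<in> V.span (insert z0 B')" by (rule V.span_add)
      then show "z \<in> V.span (insert z0 B')" by simp
    qed
    then show ?thesis by blast
  qed
  then obtain z0 where z0: "RR_space i D \<subseteq> V.span (insert z0 B')" by blast
  have "V.dim (RR_space i D) \<le> card (insert z0 B')"
    by (rule V.dim_le_card[OF z0]) (simp add: fin)
  also have "\<dots> \<le> card B' + 1" using fin by (simp add: card_insert_if)
  finally show ?thesis unfolding ell_def B'(4) .
qed

text \<open>Removing one point from a divisor lowers the degree by 1 and the dimension by at most 1.
  Hence the maximum that defines the genus can be sought among arbitrarily large divisors.\<close>

lemma deg_minus_ell_mono:
  assumes "D \<in> divisors i" "D' \<in> divisors i" "\<And>P. Poly_Mapping.lookup D P \<le> Poly_Mapping.lookup D' P"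
    and "finite B" "RR_space i D' \<subseteq> module.span (\<lambda>c z. i c * z) B"
  shows "deg D - int (ell i D) \<le> deg D' - int (ell i D')"
  using assms(2,3,5)
proof (induction "nat (deg D' - deg D)" arbitrary: D' rule: less_induct)
  case less
  show ?case
  proof (cases "D' = D")
    case False
    then obtain P where "Poly_Mapping.lookup D P \<noteq> Poly_Mapping.lookup D' P"
      by (metis poly_mapping_eqI)
    then have P: "Poly_Mapping.lookup D P < Poly_Mapping.lookup D' P"
      using less.prems(2)[of P] by simp
    have "P \<in> Poly_Mapping.keys D \<or> P \<in> Poly_Mapping.keys D'"
      using P by (auto simp: in_keys_iff)
    then have Pp: "P \<in> points i" using assms(1) less.prems(1) by (auto simp: divisors_def)
    let ?D = "D' - Poly_Mapping.single P 1"
    have look: "Poly_Mapping.lookup ?D Q = Poly_Mapping.lookup D' Q - (if Q = P then 1 else 0)" for Q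
      by (simp add: lookup_minus lookup_single when_def)
    have deg: "deg D' - deg D = (\<Sum>Q\<in>Poly_Mapping.keys D \<union> Poly_Mapping.keys D'. Poly_Mapping.lookup D' Q - Poly_Mapping.lookup D Q)"
      unfolding sum_subtractf by (subst (1 2) deg_eq_sum[of "Poly_Mapping.keys D \<union> Poly_Mapping.keys D'"]) auto
    have "0 < deg D' - deg D"
      unfolding deg using P less.prems(2) \<open>P \<in> _ \<or> _\<close> by (intro sum_pos2[of _ P]) auto
    then have lt: "nat (deg ?D - deg D) < nat (deg D' - deg D)" by (simp add: deg_diff_single)
    have "deg D - int (ell i D) \<le> deg ?D - int (ell i ?D)"
    proof (rule less.hyps[OF lt])
      show "?D \<in> divisors i"
        using less.prems(1) Pp by (auto simp: divisors_def in_keys_iff look split: if_splits)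
      show "Poly_Mapping.lookup D Q \<le> Poly_Mapping.lookup ?D Q" for Q
        using less.prems(2)[of Q] P by (auto simp: look)
      have "RR_space i ?D \<subseteq> RR_space i D'" by (rule RR_space_mono) (simp add: look)
      then show "RR_space i ?D \<subseteq> module.span (\<lambda>c z. i c * z) B" using less.prems(3) by blast
    qed
    moreover have "ell i D' \<le> ell i ?D + 1" by (rule ell_le_Suc[OF Pp assms(4) less.prems(3)])
    ultimately show ?thesis by (simp add: deg_diff_single)
  qed simp
qed

text \<open>\<open>M\<close> times the pullback along \<open>p\<close> of the sum of the points of
  \<open>A\<close>; the indices are the multiplicities of the pullback.\<close>

definition pull :: "'k option set \<Rightarrow> nat \<Rightarrow> ('a \<Rightarrow> int) \<Rightarrow>\<^sub>0 int" where
  "pull A M = (\<Sum>P\<in>(\<Union>a\<in>A. fiber a). Poly_Mapping.single P (int (M * ram_index p P)))"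

lemma lookup_pull:
  assumes "finite A" "P \<in> fiber a"
  shows "Poly_Mapping.lookup (pull A M) P = (if a \<in> A then int (M * ram_index p P) else 0)"
proof -
  have "Poly_Mapping.lookup (pull A M) P = (\<Sum>Q\<in>(\<Union>a\<in>A. fiber a). if Q = P then int (M * ram_index p Q) else 0)"
    unfolding pull_def lookup_sum by (intro sum.cong) (auto simp: lookup_single when_def)
  also have "\<dots> = (if P \<in> (\<Union>a\<in>A. fiber a) then int (M * ram_index p P) else 0)"
    using assms(1) finite_fiber by (subst sum.delta) auto
  also have "P \<in> (\<Union>a\<in>A. fiber a) \<longleftrightarrow> a \<in> A" using assms(2) fiber_unique by blast
  finally show ?thesis .
qed

lemma lookup_pull_notin: "P \<notin> (\<Union>a\<in>A. fiber a) \<Longrightarrow> Poly_Mapping.lookup (pull A M) P = 0"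
  unfolding pull_def lookup_sum by (intro sum.neutral) (auto simp: lookup_single when_def)

lemma keys_pull: "Poly_Mapping.keys (pull A M) \<subseteq> (\<Union>a\<in>A. fiber a)"
  by (meson in_keys_iff lookup_pull_notin subsetI)

lemma pull_divisor: "pull A M \<in> divisors i"
  using keys_pull[of A M] fiber_point by (auto simp: divisors_def)

lemma deg_pull:
  assumes "finite A"
  shows "deg (pull A M) = 2 * int M * int (card A)"
proof -
  have fin: "finite (\<Union>a\<in>A. fiber a)" using assms finite_fiber by auto
  have "deg (pull A M) = (\<Sum>P\<in>(\<Union>a\<in>A. fiber a). Poly_Mapping.lookup (pull A M) P)"
    by (rule deg_eq_sum[OF fin keys_pull])
  also have "\<dots> = (\<Sum>a\<in>A. \<Sum>P\<in>fiber a. Poly_Mapping.lookup (pull A M) P)"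
    using assms finite_fiber fiber_unique by (intro sum.UNION_disjoint) auto
  also have "\<dots> = (\<Sum>a\<in>A. int M * (\<Sum>P\<in>fiber a. int (ram_index p P)))"
    unfolding sum_distrib_left by (intro sum.cong refl) (simp add: lookup_pull[OF assms])
  also have "\<dots> = 2 * int M * int (card A)" by (simp add: sum_fiber_ram)
  finally show ?thesis .
qed

end

text \<open>A denominator with simple zeros at the finite points of \<open>A\<close>. Whether or not
  infinity lies in \<open>A\<close>, \<open>pt_lin_prod\<close> counts it like any other point and
  then subtracts \<open>card A\<close> there.\<close>

definition lin_prod :: "'k::alg_closed_field option set \<Rightarrow> 'k poly" where
  "lin_prod A = (\<Prod>c\<in>{c. Some c \<in> A}. [:-c, 1:])"

lemma finite_Some_vimage: "finite A \<Longrightarrow> finite {c. Some c \<in> A}"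
  using finite_vimageI[of A Some] by (simp add: vimage_def)

lemma lin_prod_neq_0: "lin_prod A \<noteq> 0"
  unfolding lin_prod_def by (cases "finite {c. Some c \<in> A}") auto

lemma pt_lin_prod:
  assumes "finite A"
  shows "pt a (to_fract (lin_prod A)) = (if a \<in> A then 1 else 0) - (if a = None then int (card A) else 0)"
proof -
  have "pt a (to_fract (\<Prod>c\<in>B. [:-c, 1:])) = (\<Sum>c\<in>B. ord a [:-c, 1:])" if "finite B" for B
    using that
  proof (induction B)
    case (insert c B)
    then show ?case
      by (simp add: valuation.val_mult[OF valuation_pt] pt_poly del: mult_pCons_left)
  qed (simp add: valuation.val_1[OF valuation_pt])
  then have "pt a (to_fract (lin_prod A)) = (\<Sum>c\<in>{c. Some c \<in> A}. ord a [:-c, 1:])"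
    unfolding lin_prod_def using finite_Some_vimage[OF assms] by blast
  also have "\<dots> = (if a \<in> A then 1 else 0) - (if a = None then int (card A) else 0)"
  proof (cases a)
    case None
    have "A - {None} = Some ` {c. Some c \<in> A}"
    proof (intro set_eqI iffI)
      fix x assume "x \<in> A - {None}"
      then show "x \<in> Some ` {c. Some c \<in> A}" by (cases x) auto
    qed auto
    then have "card (A - {None}) = card {c. Some c \<in> A}" by (simp add: card_image)
    then have "int (card A) = int (card {c. Some c \<in> A}) + (if None \<in> A then 1 else 0)"
      using assms by (auto simp: card_Diff_singleton_if card_gt_0_iff of_nat_diff split: if_splits) (metis One_nat_def Suc_pred card_gt_0_iff empty_iff of_nat_Suc add.commute)
    then show ?thesis using None by simp
  next
    case (Some b)
    have "ord a [:-c, 1:] = (if c = b then 1 else 0)" for c using Some by (simp add: ord_linear del: ord.simps)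
    then show ?thesis using Some finite_Some_vimage[OF assms] by simp
  qed
  finally show ?thesis .
qed

text \<open>Multiplication by the common denominator moves all poles to infinity.\<close>

lemma bounded_poles_iff:
  fixes x :: "'k::alg_closed_field poly fract"
  assumes "finite A"
  shows "(\<forall>a. valuation.at_least (pt a) (- int M * (if a \<in> A then 1 else 0)) x) \<longleftrightarrow>
    (\<exists>s. degree s \<le> M * card A \<and> x = to_fract s / to_fract (lin_prod A) ^ M)"
proof (cases "x = 0")
  case True
  then show ?thesis by (auto simp: valuation.at_least_0[OF valuation_pt] intro!: exI[of _ 0])
next
  case False
  define g where "g = to_fract (lin_prod A) ^ M"
  have g0: "g \<noteq> 0" by (simp add: g_def lin_prod_neq_0)
  have pg: "pt a g = int M * (if a \<in> A then 1 else 0) - (if a = None then int (M * card A) else 0)" for a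
    unfolding g_def valuation.val_power[OF valuation_pt] pt_lin_prod[OF assms] by (simp add: right_diff_distrib)
  have *: "valuation.at_least (pt a) (- int M * (if a \<in> A then 1 else 0)) x \<longleftrightarrow>
    - (if a = None then int (M * card A) else 0) \<le> pt a (x * g)" for a
    using False g0 unfolding valuation.at_least_def[OF valuation_pt]
    by (simp add: valuation.val_mult[OF valuation_pt] pg) linarith
  show ?thesis unfolding * g_def[symmetric]
  proof
    assume pole: "\<forall>a. - (if a = None then int (M * card A) else 0) \<le> pt a (x * g)"
    have "0 \<le> pt (Some a) (x * g)" for a using pole[rule_format, of "Some a"] by simp
    then obtain s where s: "x * g = to_fract s" using poly_if_no_finite_poles by blast
    then have "s \<noteq> 0" using False g0 by auto
    then have "degree s \<le> M * card A" using pole[rule_format, of None] unfolding s by (simp add: pt_poly flip: of_nat_mult)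
    moreover have "x = to_fract s / g" using s g0 by (metis nonzero_mult_div_cancel_right)
    ultimately show "\<exists>s. degree s \<le> M * card A \<and> x = to_fract s / g" by blast
  next
    assume "\<exists>s. degree s \<le> M * card A \<and> x = to_fract s / g"
    then obtain s where s: "degree s \<le> M * card A" "x = to_fract s / g" by blast
    then have "x * g = to_fract s" "s \<noteq> 0" using g0 False by auto
    moreover have "- (if a = None then int (M * card A) else 0) \<le> ord a s" for a
      using s(1) by (cases a) (auto simp flip: of_nat_mult)
    ultimately show "\<forall>a. - (if a = None then int (M * card A) else 0) \<le> pt a (x * g)" by (simp add: pt_poly)
  qed
qed

context double_cover begin

text \<open>Rounded up, since infinity joins the roots of \<open>F\<close> if the degree is odd. It
  will turn out to be the genus plus 1, and it bounds the pole of \<open>y\<close> at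
  infinity.\<close>

definition half_branch :: nat where "half_branch = (degree F + 1) div 2"

lemma ord_Some_F: "ord (Some a) F = (if poly F a = 0 then 1 else 0)"
proof -
  have "order a F = 0 \<or> order a F = 1" using squarefree_F unfolding rsquarefree_def by blast
  then show ?thesis using F_neq_0 order_root[of F a] by auto
qed

lemma branch_eq: "branch = Some ` {a. poly F a = 0} \<union> (if odd (degree F) then {None} else {})"
proof (intro set_eqI)
  fix a show "a \<in> branch \<longleftrightarrow> a \<in> Some ` {a. poly F a = 0} \<union> (if odd (degree F) then {None} else {})"
  proof (cases a)
    case (Some b)
    then show ?thesis using ord_Some_F[of b] F_neq_0 by (auto simp: branch_def pt_poly simp del: ord.simps)
  qed (use F_neq_0 in \<open>auto simp: branch_def pt_poly\<close>)
qed

lemma card_branch: "card branch = 2 * half_branch"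
proof -
  have fin: "finite {a. poly F a = 0}" using F_neq_0 by (simp add: poly_roots_finite)
  have "degree F = (\<Sum>a\<in>{a. poly F a = 0}. order a F)"
    using sum_order_eq_degree[OF F_neq_0 fin] by simp
  also have "\<dots> = card {a. poly F a = 0}"
  proof -
    have "order a F = 1" if "a \<in> {a. poly F a = 0}" for a using ord_Some_F[of a] that by simp
    then show ?thesis by simp
  qed
  finally have *: "card {a. poly F a = 0} = degree F" by simp
  have "card branch = card (Some ` {a. poly F a = 0}) + card (if odd (degree F) then {None :: 'k option} else {})"
    unfolding branch_eq using fin by (intro card_Un_disjoint) auto
  also have "\<dots> = degree F + (if odd (degree F) then 1 else 0)" by (simp add: card_image *)
  also have "\<dots> = 2 * half_branch" unfolding half_branch_def by (auto elim!: oddE)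
  finally show ?thesis .
qed

text \<open>The condition on \<open>x y\<close> is squared, as its order need not be integral on the
  line. At a finite point \<open>F\<close> has order 0 or 1, which does not affect the integral
  bound on \<open>x\<close>; at infinity \<open>F\<close> costs \<open>half_branch\<close>
  degrees.\<close>

lemma im_bounded_iff:
  assumes "finite A"
  shows "(\<forall>a. x \<noteq> 0 \<longrightarrow> - 2 * int M * (if a \<in> A then 1 else 0) \<le> pt a (x * x * to_fract F)) \<longleftrightarrow>
    (\<exists>s. (s = 0 \<or> degree s + half_branch \<le> M * card A) \<and> x = to_fract s / to_fract (lin_prod A) ^ M)"
    (is "?L \<longleftrightarrow> ?R")
proof (cases "x = 0")
  case False
  have pF: "pt a (x * x * to_fract F) = 2 * pt a x + ord a F" for a
    using False F_neq_0 by (simp add: valuation.val_mult[OF valuation_pt] pt_poly)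
  define g where "g = to_fract (lin_prod A) ^ M"
  have g0: "g \<noteq> 0" by (simp add: g_def lin_prod_neq_0)
  have pg: "pt None g = int M * (if None \<in> A then 1 else 0) - int (M * card A)"
    unfolding g_def valuation.val_power[OF valuation_pt] pt_lin_prod[OF assms] by (simp add: right_diff_distrib)
  have inf: "- 2 * int M * (if None \<in> A then 1 else 0) \<le> pt None (x * x * to_fract F) \<longleftrightarrow>
      degree s + half_branch \<le> M * card A" if s: "x = to_fract s / g" for s
  proof -
    have "s \<noteq> 0" using s False by auto
    then have px: "pt None x = - int (degree s) - pt None g"
      using g0 s by (simp add: valuation.val_divide[OF valuation_pt] pt_poly)
    have half: "2 * d + degree F \<le> 2 * e \<longleftrightarrow> d + half_branch \<le> e" for d e :: nat
      unfolding half_branch_def by linarith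
    have "- 2 * int M * (if None \<in> A then 1 else 0) \<le> pt None (x * x * to_fract F) \<longleftrightarrow>
       int (2 * degree s + degree F) \<le> int (2 * (M * card A))"
      unfolding pF px pg by (cases "None \<in> A") auto
    also have "\<dots> \<longleftrightarrow> degree s + half_branch \<le> M * card A" unfolding of_nat_le_iff half ..
    finally show ?thesis .
  qed
  have fin: "- 2 * int M * (if Some a \<in> A then 1 else 0) \<le> pt (Some a) (x * x * to_fract F) \<longleftrightarrow>
      - int M * (if Some a \<in> A then 1 else 0) \<le> pt (Some a) x" for a
    unfolding pF ord_Some_F by auto
  show ?thesis
  proof
    assume L: ?L
    have poles: "0 \<le> pt (Some a) (x * g)" for a
    proof -
      have "pt (Some a) g = int M * (if Some a \<in> A then 1 else 0)"
        unfolding g_def valuation.val_power[OF valuation_pt] pt_lin_prod[OF assms] by simp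
      then show ?thesis
        using L False fin[of a] g0 by (simp add: valuation.val_mult[OF valuation_pt])
    qed
    then obtain s where "x * g = to_fract s" using poly_if_no_finite_poles by blast
    then have s: "x = to_fract s / g" using g0 by (metis nonzero_mult_div_cancel_right)
    then show ?R unfolding g_def[symmetric] using inf[OF s] L False by blast
  next
    assume ?R
    then obtain s where s: "s = 0 \<or> degree s + half_branch \<le> M * card A" "x = to_fract s / g"
      unfolding g_def by blast
    then have d: "degree s + half_branch \<le> M * card A" using False by auto
    then have "\<forall>a. valuation.at_least (pt a) (- int M * (if a \<in> A then 1 else 0)) x"
      unfolding bounded_poles_iff[OF assms] using s(2) g_def by (intro exI[of _ s]) auto
    then have "- int M * (if Some a \<in> A then 1 else 0) \<le> pt (Some a) x" for a
      using False by (auto simp: valuation.at_least_def[OF valuation_pt])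
    then show ?L using fin inf[OF s(2)] d by (metis option.exhaust)
  qed
qed (auto intro!: exI[of _ 0])

text \<open>The divisor is invariant under \<open>w\<close>, so the space contains with
  \<open>z\<close> its conjugate, hence both summands \<open>(z + w z) / 2\<close> and
  \<open>(z - w z) / 2\<close>. Their conditions can be read on the line.\<close>

lemma RR_pull_iff_re_im:
  assumes "finite A"
  shows "z \<in> RR_space i (pull A M) \<longleftrightarrow>
    (\<forall>a. valuation.at_least (pt a) (- int M * (if a \<in> A then 1 else 0)) (re z)) \<and>
    (\<forall>a. im z \<noteq> 0 \<longrightarrow> - 2 * int M * (if a \<in> A then 1 else 0) \<le> pt a (im z * im z * to_fract F))"
    (is "_ \<longleftrightarrow> ?R")
proof -
  let ?b = "\<lambda>a. if a \<in> A then 1 else (0::int)"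
  let ?r = "\<lambda>a. if a \<in> branch then 2 else (1::int)"
  have look: "- Poly_Mapping.lookup (pull A M) P = - int M * ?b a * ?r a" if "P \<in> fiber a" for P a
    using fiber_ram[OF that] by (simp add: lookup_pull[OF assms that])
  have r0: "0 < ?r a" for a by simp
  have RR: "z \<in> RR_space i (pull A M) \<longleftrightarrow> (\<forall>a. \<forall>P\<in>fiber a. valuation.at_least P (- int M * ?b a * ?r a) z)" for z
    unfolding RR_space_iff[OF points_nonempty] using look fiberE fiber_point by metis
  have re: "valuation.at_least P (- int M * ?b a * ?r a) (p (re z)) \<longleftrightarrow>
      valuation.at_least (pt a) (- int M * ?b a) (re z)" if P: "P \<in> fiber a" for P a
  proof -
    have "P (p (re z)) = pt a (re z) * ?r a" using fiber_val[OF P] by simp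
    then show ?thesis
      unfolding valuation.at_least_def[OF pointsD(1)[OF fiber_point[OF P]]] valuation.at_least_def[OF valuation_pt]
      using r0[of a] by (simp only: p mult_le_cancel_right_pos)
  qed
  have im: "valuation.at_least P (- int M * ?b a * ?r a) (p (im z) * y) \<longleftrightarrow>
      (im z \<noteq> 0 \<longrightarrow> - 2 * int M * ?b a \<le> pt a (im z * im z * to_fract F))" if P: "P \<in> fiber a" for P a
  proof (cases "im z = 0")
    case False
    interpret P: valuation P by (rule pointsD(1)[OF fiber_point[OF P]])
    have "2 * P (p (im z) * y) = P ((p (im z) * y) * (p (im z) * y))"
      using False y_neq_0 by (subst (2) P.val_mult) (auto simp: p)
    also have "(p (im z) * y) * (p (im z) * y) = p (im z * im z * to_fract F)"
      by (simp add: p y_sq[symmetric])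
    finally have "2 * P (p (im z) * y) = pt a (im z * im z * to_fract F) * ?r a"
      using fiber_val[OF P] by simp
    moreover have "- int M * ?b a * ?r a \<le> P (p (im z) * y) \<longleftrightarrow>
        (- 2 * int M * ?b a) * ?r a \<le> 2 * P (p (im z) * y)" by auto
    ultimately show ?thesis
      using False y_neq_0 r0[of a] unfolding P.at_least_def by (simp only: p mult_eq_0_iff mult_le_cancel_right_pos) simp
  qed (simp add: p valuation.at_least_0[OF pointsD(1)[OF fiber_point[OF P]]])
  have "z \<in> RR_space i (pull A M) \<longleftrightarrow> (\<forall>a. \<forall>P\<in>fiber a.
      valuation.at_least P (- int M * ?b a * ?r a) (p (re z)) \<and> valuation.at_least P (- int M * ?b a * ?r a) (p (im z) * y))"
  proof
    assume z: "z \<in> RR_space i (pull A M)"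
    show "\<forall>a. \<forall>P\<in>fiber a. valuation.at_least P (- int M * ?b a * ?r a) (p (re z)) \<and> valuation.at_least P (- int M * ?b a * ?r a) (p (im z) * y)"
    proof (intro allI ballI)
      fix a P assume P: "P \<in> fiber a"
      interpret P: valuation P by (rule pointsD(1)[OF fiber_point[OF P]])
      interpret Pw: valuation "\<lambda>z. P (w z)" by (rule pointsD(1)[OF fiber_point[OF fiber_w[OF P]]])
      have 1: "P.at_least (- int M * ?b a * ?r a) z" using z P RR by blast
      have "Pw.at_least (- int M * ?b a * ?r a) z" using z fiber_w[OF P] RR by blast
      then have 2: "P.at_least (- int M * ?b a * ?r a) (w z)"
        unfolding Pw.at_least_def P.at_least_def by (simp add: w)
      have c: "P.at_least 0 (i (1 / 2))"
        using pointsD(2)[OF fiber_point[OF P], of "1 / 2"] by (simp add: P.at_least_def)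
      have "p (re z) = i (1 / 2) * (z + w z)" "p (im z) * y = i (1 / 2) * (z - w z)"
        unfolding p_re p_im using y_neq_0 by (simp_all add: i)
      then show "P.at_least (- int M * ?b a * ?r a) (p (re z)) \<and> P.at_least (- int M * ?b a * ?r a) (p (im z) * y)"
        using P.at_least_mult0[OF c P.at_least_add[OF 1 2]] P.at_least_mult0[OF c P.at_least_diff[OF 1 2]] by simp
    qed
  next
    assume *: "\<forall>a. \<forall>P\<in>fiber a. valuation.at_least P (- int M * ?b a * ?r a) (p (re z)) \<and> valuation.at_least P (- int M * ?b a * ?r a) (p (im z) * y)"
    show "z \<in> RR_space i (pull A M)"
      unfolding RR
    proof (intro allI ballI)
      fix a P assume P: "P \<in> fiber a"
      interpret P: valuation P by (rule pointsD(1)[OF fiber_point[OF P]])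
      have "P.at_least (- int M * ?b a * ?r a) (p (re z) + p (im z) * y)" using * P by (intro P.at_least_add) blast+
      then show "P.at_least (- int M * ?b a * ?r a) z" by (simp only: re_im[symmetric])
    qed
  qed
  also have "\<dots> \<longleftrightarrow> (\<forall>a. \<forall>P\<in>fiber a. valuation.at_least (pt a) (- int M * ?b a) (re z) \<and>
      (im z \<noteq> 0 \<longrightarrow> - 2 * int M * ?b a \<le> pt a (im z * im z * to_fract F)))"
    using re im by blast
  also have "\<dots> \<longleftrightarrow> ?R" using fiber_nonempty by blast
  finally show ?thesis .
qed

lemma RR_pull_iff:
  assumes "finite A"
  shows "z \<in> RR_space i (pull A M) \<longleftrightarrow> (\<exists>s r. degree s \<le> M * card A \<and> (r = 0 \<or> degree r + half_branch \<le> M * card A) \<and>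
    z = (p (to_fract s) + p (to_fract r) * y) / p (to_fract (lin_prod A)) ^ M)"
proof -
  let ?g = "to_fract (lin_prod A) ^ M"
  have *: "re z = to_fract s / ?g \<and> im z = to_fract r / ?g \<longleftrightarrow>
      z = (p (to_fract s) + p (to_fract r) * y) / p (to_fract (lin_prod A)) ^ M" for s r
  proof -
    have eq: "(p (to_fract s) + p (to_fract r) * y) / p (to_fract (lin_prod A)) ^ M = p (to_fract s / ?g) + p (to_fract r / ?g) * y"
      by (simp add: p add_divide_distrib)
    show ?thesis unfolding eq using re_im[of z] re_im_unique by metis
  qed
  have "z \<in> RR_space i (pull A M) \<longleftrightarrow> (\<exists>s. degree s \<le> M * card A \<and> re z = to_fract s / ?g) \<and>
    (\<exists>r. (r = 0 \<or> degree r + half_branch \<le> M * card A) \<and> im z = to_fract r / ?g)"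
    unfolding RR_pull_iff_re_im[OF assms] bounded_poles_iff[OF assms] im_bounded_iff[OF assms] ..
  also have "\<dots> \<longleftrightarrow> (\<exists>s r. degree s \<le> M * card A \<and> (r = 0 \<or> degree r + half_branch \<le> M * card A) \<and>
      re z = to_fract s / ?g \<and> im z = to_fract r / ?g)" by blast
  finally show ?thesis unfolding * .
qed

text \<open>So few poles leave no room for a multiple of \<open>y\<close>; such functions live on
  the line.\<close>

lemma RR_pull_subset_range:
  assumes "finite A" "M * card A < half_branch"
  shows "RR_space i (pull A M) \<subseteq> range p"
proof
  fix z assume "z \<in> RR_space i (pull A M)"
  then obtain s r where "r = 0 \<or> degree r + half_branch \<le> M * card A"
    "z = (p (to_fract s) + p (to_fract r) * y) / p (to_fract (lin_prod A)) ^ M"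
    unfolding RR_pull_iff[OF assms(1)] by blast
  then have "z = p (to_fract s / to_fract (lin_prod A) ^ M)" using assms(2) by (simp add: p)
  then show "z \<in> range p" by blast
qed

text \<open>The numerators \<open>s\<close> and \<open>r\<close> are arbitrary polynomials of
  bounded degree, so monomials give a basis. Truncated subtraction is right here: if
  \<open>half_branch\<close> exceeds the degree bound, only \<open>r = 0\<close> remains.\<close>

lemma
  assumes "finite A"
  shows ell_pull: "ell i (pull A M) = (M * card A + 1) + (M * card A + 1 - half_branch)"
    and RR_pull_finite: "\<exists>B. finite B \<and> RR_space i (pull A M) \<subseteq> module.span (\<lambda>c z. i c * z) B"
proof -
  interpret V: vector_space "\<lambda>c z. i c * z" by (rule vector_space_i)
  let ?N = "M * card A" and ?G = "p (to_fract (lin_prod A)) ^ M"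
  \<comment> \<open>Left summands index the monomials of \<open>s\<close>, right summands those of
    \<open>r\<close>.\<close>
  define S where "S = {..?N} <+> {..<?N + 1 - half_branch}"
  define b where "b = case_sum (\<lambda>j. p (to_fract (monom 1 j)) / ?G) (\<lambda>j. p (to_fract (monom 1 j)) * y / ?G)"
  have finS: "finite S" by (simp add: S_def)
  have G0: "?G \<noteq> 0" by (simp add: p lin_prod_neq_0)
  have poly_sum: "p (to_fract (\<Sum>j\<in>J. monom (c j) j)) = (\<Sum>j\<in>J. i (c j) * p (to_fract (monom 1 j)))" for c :: "nat \<Rightarrow> 'k" and J
  proof -
    have "p (to_fract (monom (c j) j)) = i (c j) * p (to_fract (monom 1 j))" for j
    proof -
      have "monom (c j) j = [:c j:] * monom 1 j" by (simp add: smult_monom)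
      then show ?thesis by (simp only: to_fract_mult p p_const[symmetric] P1_def)
    qed
    then show ?thesis by (induction J rule: infinite_finite_induct) (simp_all add: p)
  qed
  have comb: "(\<Sum>x\<in>S. i (c x) * b x) = (p (to_fract (\<Sum>j\<le>?N. monom (c (Inl j)) j)) + p (to_fract (\<Sum>j<?N + 1 - half_branch. monom (c (Inr j)) j)) * y) / ?G" for c
    unfolding S_def poly_sum by (simp add: sum.Plus b_def add_divide_distrib sum_divide_distrib sum_distrib_right mult.assoc)
  have coeffs: "coeff (\<Sum>j\<in>J. monom (c j) j) k = (if k \<in> J then c k else 0)" if "finite J" for c :: "nat \<Rightarrow> 'k" and J k
    using that by (simp add: coeff_sum if_distrib sum.delta cong: if_cong)
  have indep: "\<forall>s\<in>S. c s = 0" if "(\<Sum>s\<in>S. i (c s) * b s) = 0" for c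
  proof -
    let ?s = "\<Sum>j\<le>?N. monom (c (Inl j)) j" and ?r = "\<Sum>j<?N + 1 - half_branch. monom (c (Inr j)) j"
    have "p (to_fract ?s) + p (to_fract ?r) * y = 0" using that G0 unfolding comb divide_eq_0_iff by blast
    then have "to_fract ?s = 0" "to_fract ?r = 0"
      using re_im_unique[of "to_fract ?s" "to_fract ?r"] re_im_p[of 0] by (simp_all add: p)
    then have "?s = 0" "?r = 0" by (simp_all only: to_fract_eq_0_iff)
    then have "j \<le> ?N \<Longrightarrow> c (Inl j) = 0" "j < ?N + 1 - half_branch \<Longrightarrow> c (Inr j) = 0" for j
      using coeffs[of "{..?N}" "\<lambda>j. c (Inl j)" j] coeffs[of "{..<?N + 1 - half_branch}" "\<lambda>j. c (Inr j)" j] by auto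
    then show ?thesis by (auto simp: S_def)
  qed
  have inj: "inj_on b S" "V.independent (b ` S)"
    using V.independent_familyI[OF finS indep] by blast+
  have monoms: "q = (\<Sum>j\<in>J. monom (coeff q j) j)" if "\<And>j. j \<notin> J \<Longrightarrow> coeff q j = 0" "finite J" for q :: "'k poly" and J
    using that by (intro poly_eqI) (auto simp: coeffs)
  have mem: "z \<in> RR_space i (pull A M) \<longleftrightarrow> (\<exists>c. z = (\<Sum>x\<in>S. i (c x) * b x))" for z
  proof
    assume "z \<in> RR_space i (pull A M)"
    then obtain s r where sr: "degree s \<le> ?N" "r = 0 \<or> degree r + half_branch \<le> ?N"
      "z = (p (to_fract s) + p (to_fract r) * y) / ?G" unfolding RR_pull_iff[OF assms] by blast
    have "s = (\<Sum>j\<le>?N. monom (coeff s j) j)" using sr(1) by (intro monoms) (auto intro: coeff_eq_0)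
    moreover have "r = (\<Sum>j<?N + 1 - half_branch. monom (coeff r j) j)"
    proof (rule monoms)
      fix j assume "j \<notin> {..<?N + 1 - half_branch}"
      then show "coeff r j = 0" using sr(2) by (cases "r = 0") (auto intro!: coeff_eq_0)
    qed simp
    ultimately show "\<exists>c. z = (\<Sum>x\<in>S. i (c x) * b x)"
      unfolding comb by (intro exI[of _ "case_sum (coeff s) (coeff r)"]) (simp add: sr(3))
  next
    assume "\<exists>c. z = (\<Sum>x\<in>S. i (c x) * b x)"
    then obtain c where z: "z = (\<Sum>x\<in>S. i (c x) * b x)" by blast
    let ?s = "\<Sum>j\<le>?N. monom (c (Inl j)) j" and ?r = "\<Sum>j<?N + 1 - half_branch. monom (c (Inr j)) j"
    have "degree ?s \<le> ?N" by (intro degree_le) (auto simp: coeffs)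
    moreover have "?r = 0 \<or> degree ?r + half_branch \<le> ?N"
    proof (cases "half_branch \<le> ?N")
      case True
      have "degree ?r \<le> ?N - half_branch" by (intro degree_le) (auto simp: coeffs)
      then show ?thesis using True by linarith
    next
      case False
      then have "?N + 1 - half_branch = 0" by linarith
      then show ?thesis by simp
    qed
    ultimately show "z \<in> RR_space i (pull A M)" unfolding RR_pull_iff[OF assms] z comb by blast
  qed
  have sub: "b ` S \<subseteq> RR_space i (pull A M)"
  proof
    fix z assume "z \<in> b ` S"
    then obtain s where s: "s \<in> S" "z = b s" by blast
    have "(\<Sum>x\<in>S. i (if x = s then 1 else 0) * b x) = (\<Sum>x\<in>S. if x = s then b x else 0)"
      by (intro sum.cong) (auto simp: i)
    also have "\<dots> = z" using s finS by simp
    finally show "z \<in> RR_space i (pull A M)" unfolding mem by (intro exI) (rule sym)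
  qed
  have span: "RR_space i (pull A M) \<subseteq> V.span (b ` S)"
  proof
    fix z assume "z \<in> RR_space i (pull A M)"
    then obtain c where z: "z = (\<Sum>x\<in>S. i (c x) * b x)" unfolding mem by blast
    show "z \<in> V.span (b ` S)" unfolding z by (intro V.span_sum V.span_scale V.span_base imageI)
  qed
  show "\<exists>B. finite B \<and> RR_space i (pull A M) \<subseteq> V.span B" using span finS by blast
  have "ell i (pull A M) = card (b ` S)"
    unfolding ell_def using V.basis_card_eq_dim[OF sub span inj(2)] by simp
  also have "\<dots> = card S" by (rule card_image[OF inj(1)])
  also have "\<dots> = (?N + 1) + (?N + 1 - half_branch)" by (simp add: S_def card_Plus)
  finally show "ell i (pull A M) = (?N + 1) + (?N + 1 - half_branch)" .
qed

section \<open>The genus and the Weierstrass points\<close>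

lemma finite_fibers_support:
  assumes "finite K"
  shows "finite {a. \<exists>P\<in>K. P \<in> fiber a}"
proof -
  have "{a. \<exists>P\<in>K. P \<in> fiber a} \<subseteq> (\<lambda>P. THE a. P \<in> fiber a) ` K"
  proof
    fix a assume "a \<in> {a. \<exists>P\<in>K. P \<in> fiber a}"
    then obtain P where P: "P \<in> K" "P \<in> fiber a" by blast
    then have "(THE a. P \<in> fiber a) = a" using fiber_unique by blast
    then show "a \<in> (\<lambda>P. THE a. P \<in> fiber a) ` K" using P(1) by force
  qed
  then show ?thesis using assms finite_surj by blast
qed

text \<open>A divisor that attains the maximum lies below some \<open>pull A M\<close>, which
  therefore attains it too. With N = \<open>M * card A\<close>, the degree there is 2 N and the
  dimension 2 N + 2 - \<open>half_branch\<close>.\<close>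

lemma genus_half_branch:
  assumes "has_genus i g"
  shows "half_branch = g + 1"
proof -
  obtain D where D: "D \<in> divisors i" "deg D - int (ell i D) + 1 = int g"
    and ub: "\<And>D. D \<in> divisors i \<Longrightarrow> deg D - int (ell i D) + 1 \<le> int g"
    using assms unfolding has_genus_def by blast
  \<comment> \<open>Infinity keeps \<open>A\<close> nonempty, and the summand
    \<open>half_branch\<close> of \<open>M\<close> makes N so large that the subtraction in
    \<open>ell_pull\<close> is not truncated.\<close>
  define A where "A = insert None {a. \<exists>P\<in>Poly_Mapping.keys D. P \<in> fiber a}"
  define M where "M = nat (\<Sum>P\<in>Poly_Mapping.keys D. \<bar>Poly_Mapping.lookup D P\<bar>) + half_branch"
  have A: "finite A"
    unfolding A_def finite_insert by (rule finite_fibers_support[OF finite_keys])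
  have cardA: "1 \<le> card A" using A by (simp add: A_def card_gt_0_iff Suc_le_eq)
  have le: "Poly_Mapping.lookup D P \<le> Poly_Mapping.lookup (pull A M) P" for P
  proof (cases "P \<in> Poly_Mapping.keys D")
    case True
    then have "P \<in> points i" using D(1) by (auto simp: divisors_def)
    then obtain a where a: "P \<in> fiber a" by (rule fiberE)
    then have "a \<in> A" using True by (auto simp: A_def)
    have "\<bar>Poly_Mapping.lookup D P\<bar> \<le> (\<Sum>P\<in>Poly_Mapping.keys D. \<bar>Poly_Mapping.lookup D P\<bar>)"
      using True by (intro member_le_sum) auto
    then have "Poly_Mapping.lookup D P \<le> int M" unfolding M_def by linarith
    also have "int M \<le> int (M * ram_index p P)" using fiber_ram[OF a] by simp
    finally show ?thesis using lookup_pull[OF A a] \<open>a \<in> A\<close> by simp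
  next
    case False
    have "0 \<le> Poly_Mapping.lookup (pull A M) P"
    proof (cases "P \<in> (\<Union>a\<in>A. fiber a)")
      case True
      then obtain a where "P \<in> fiber a" by blast
      then show ?thesis by (simp add: lookup_pull[OF A])
    qed (simp add: lookup_pull_notin)
    then show ?thesis using False by (simp add: in_keys_iff)
  qed
  obtain B where B: "finite B" "RR_space i (pull A M) \<subseteq> module.span (\<lambda>c z. i c * z) B"
    using RR_pull_finite[OF A] by blast
  have "half_branch \<le> M * card A"
    using cardA mult_le_mono[of half_branch M 1 "card A"] by (simp add: M_def)
  then have "deg (pull A M) - int (ell i (pull A M)) + 1 = int half_branch - 1"
    by (simp add: deg_pull[OF A] ell_pull[OF A] of_nat_diff)
  moreover have "deg D - int (ell i D) \<le> deg (pull A M) - int (ell i (pull A M))"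
    by (rule deg_minus_ell_mono[OF D(1) pull_divisor le B])
  ultimately show ?thesis using D(2) ub[OF pull_divisor[of A M]] by linarith
qed

lemma RR_single_subset:
  assumes "P \<in> fiber a" "0 \<le> k" "k \<le> int (M * ram_index p P)"
  shows "RR_space i (Poly_Mapping.single P k) \<subseteq> RR_space i (pull {a} M)"
proof (rule RR_space_mono)
  fix Q assume "Q \<in> points i"
  then obtain b where b: "Q \<in> fiber b" by (rule fiberE)
  show "Poly_Mapping.lookup (Poly_Mapping.single P k) Q \<le> Poly_Mapping.lookup (pull {a} M) Q"
  proof (cases "Q = P")
    case True
    then have "b = a" using assms(1) b fiber_unique by blast
    then show ?thesis using assms True lookup_pull[OF _ b, of "{a}" M] by simp
  next
    case False
    then show ?thesis using lookup_pull[OF _ b, of "{a}" M] by (simp add: lookup_single when_def)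
  qed
qed

text \<open>With no poles allowed the numerator has degree 0, and \<open>y\<close> cannot occur
  unless \<open>half_branch = 0\<close>. In that case \<open>F\<close> would be constant, hence
  \<open>y\<close> too, against \<open>w y = - y\<close>.\<close>

lemma RR_0: "RR_space i 0 \<subseteq> range i"
proof (cases "half_branch = 0")
  case True
  show ?thesis
  proof
    fix z assume "z \<in> RR_space i 0"
    have "degree F = 0" using True by (simp add: half_branch_def)
    then obtain c where c: "F = [:c:]" by (metis degree_eq_zeroE)
    obtain s where s: "s * s = c" using alg_closed_sqrt by blast
    have "(y - i s) * (y + i s) = p (to_fract F) - i s * i s" by (simp add: algebra_simps flip: y_sq)
    also have "\<dots> = 0" by (simp add: c s flip: i(6)) (simp add: p_const[symmetric] P1_def)
    finally have "y = i s \<or> y = i (- s)" by (auto simp: i eq_neg_iff_add_eq_0)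
    then obtain s' where "y = i s'" by blast
    then have "y = - y" using w_y by simp
    then have "y + y = 0" by (metis add.right_inverse)
    then have "2 * y = 0" by (simp only: mult_2)
    then show "z \<in> range i" using y_neq_0 two_neq_0 by simp
  qed
next
  case False
  show ?thesis
  proof
    fix z assume z: "z \<in> RR_space i 0"
    have "pull {} 0 = 0" by (simp add: pull_def)
    then obtain s r where sr: "degree s \<le> 0" "r = 0 \<or> degree r + half_branch \<le> 0"
      "z = (p (to_fract s) + p (to_fract r) * y) / p (to_fract (lin_prod {})) ^ 0"
      using z RR_pull_iff[of "{}" z 0] by auto
    obtain c where "s = [:c:]" using sr(1) by (metis degree_eq_zeroE le_zero_eq)
    then have "z = p (P1 c)" using sr False by (simp add: p P1_def)
    then have "z = i c" by (simp only: p_const)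
    then show "z \<in> range i" by blast
  qed
qed

text \<open>At a branch point, 2 P is the pullback of a point of the line, where a nonconstant
  function with a simple pole exists. At any other P, a function with poles bounded by 2 P lives on
  the line, so a pole at P would come with one at the conjugate point.\<close>

lemma weierstrass_points_eq:
  assumes "half_branch = 3"
  shows "weierstrass_points 2 i = (\<Union>a\<in>branch. fiber a)"
proof (intro equalityI subsetI)
  fix P assume "P \<in> (\<Union>a\<in>branch. fiber a)"
  then obtain a where a: "a \<in> branch" "P \<in> fiber a" by blast
  obtain R where "fiber a = {R}" by (rule fiber_branch[OF a(1)])
  then have "fiber a = {P}" using a(2) by simp
  then have "Poly_Mapping.single P 2 = pull {a} 1"
    using fiber_ram[OF a(2)] a(1) by (simp add: pull_def)
  then have "ell i (Poly_Mapping.single P 2) = 2"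
    using ell_pull[of "{a}" 1] assms by simp
  then show "P \<in> weierstrass_points 2 i"
    using fiber_point[OF a(2)] by (simp add: weierstrass_points_def)
next
  fix P assume "P \<in> weierstrass_points 2 i"
  then have P: "P \<in> points i" "2 \<le> ell i (Poly_Mapping.single P 2)" by (auto simp: weierstrass_points_def)
  obtain a where a: "P \<in> fiber a" by (rule fiberE[OF P(1)])
  have "a \<in> branch"
  proof (rule ccontr)
    assume nb: "a \<notin> branch"
    interpret V: vector_space "\<lambda>c z. i c * z" by (rule vector_space_i)
    have "RR_space i (Poly_Mapping.single P 2) \<subseteq> V.span {1}"
    proof
      fix z assume z: "z \<in> RR_space i (Poly_Mapping.single P 2)"
      then have "z \<in> RR_space i (pull {a} 2)"
        using RR_single_subset[OF a, of 2 2] fiber_ram[OF a] nb by auto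
      then obtain x where x: "z = p x"
        using RR_pull_subset_range[of "{a}" 2] assms by auto
      have "z \<in> RR_space i 0"
      proof (cases "z = 0")
        case False
        have ge: "- Poly_Mapping.lookup (Poly_Mapping.single P 2) Q \<le> Q z" if "Q \<in> points i" for Q
          using z False that by (auto simp: RR_space_def)
        have ne: "(\<lambda>z. P (w z)) \<noteq> P" by (rule fiber_nonbranch_eq(2)[OF nb a])
        have "0 \<le> P (w z)"
          using ge[OF point_w(1)[OF P(1)]] ne by (simp add: lookup_single when_def)
        then have "0 \<le> P z" by (simp add: x)
        then have "0 \<le> Q z" if "Q \<in> points i" for Q
          using ge[OF that] by (cases "Q = P") (auto simp: lookup_single when_def)
        then show ?thesis by (simp add: RR_space_def)
      qed (simp add: RR_space_def)
      then obtain c where "z = i c * 1" using RR_0 by auto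
      then show "z \<in> V.span {1}" using V.span_scale[OF V.span_base[of 1 "{1}"], of c] by simp
    qed
    then have "ell i (Poly_Mapping.single P 2) \<le> card {1 :: 'a}"
      unfolding ell_def by (rule V.dim_le_card) simp
    then show False using P(2) by simp
  qed
  then show "P \<in> (\<Union>a\<in>branch. fiber a)" using a by blast
qed

section \<open>Principal divisors and the group law\<close>

lemma sum_fiber_val:
  assumes "z \<noteq> 0" "z * w z = p N"
  shows "(\<Sum>Q\<in>fiber a. Q z) = pt a N"
proof -
  obtain P where P: "P \<in> fiber a" using fiber_nonempty by blast
  interpret P: valuation P by (rule pointsD(1)[OF fiber_point[OF P]])
  have sum: "P z + P (w z) = (if a \<in> branch then 2 else 1) * pt a N"
    using fiber_val[OF P, of N] P.val_mult[of z "w z"] assms by (simp add: w)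
  show ?thesis
  proof (cases "a \<in> branch")
    case True
    obtain R where "fiber a = {R}" "(\<lambda>z. R (w z)) = R" by (rule fiber_branch[OF True])
    then have "fiber a = {P}" "P (w z) = P z" using P by (auto dest: fun_cong[of _ _ z])
    then show ?thesis using sum True by simp
  next
    case False
    note f = fiber_nonbranch_eq[OF False P]
    have "(\<Sum>Q\<in>fiber a. Q z) = P z + P (w z)" unfolding f(1) using f(2) by simp
    then show ?thesis using sum False by simp
  qed
qed

text \<open>
  Fiberwise, the orders of a function sum up to those of its norm, so principal divisors have degree \<open>0\<close>.
\<close>

lemma effective_degree_1:
  assumes "z \<noteq> 0" "D \<in> divisors i" "deg D = 1" "\<And>P. P \<in> points i \<Longrightarrow> 0 \<le> Poly_Mapping.lookup D P + P z"
  shows "\<exists>R\<in>points i. \<forall>P\<in>points i. Poly_Mapping.lookup D P + P z = (if P = R then 1 else 0)"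
proof -
  obtain N where N: "z * w z = p N" using norm_eq by blast
  have N0: "N \<noteq> 0"
  proof
    assume "N = 0"
    then show False using N assms(1) by (simp add: p w)
  qed
  \<comment> \<open>\<open>d\<close> is \<open>D\<close> plus the divisor of \<open>z\<close>. Being
    nonnegative of total 1, it is concentrated in one fiber and there at one point.\<close>
  define d where "d P = Poly_Mapping.lookup D P + P z" for P
  define K where "K = {a. \<exists>P\<in>Poly_Mapping.keys D. P \<in> fiber a}"
  define A where "A = K \<union> {a. pt a N \<noteq> 0}"
  have finK: "finite K" unfolding K_def by (rule finite_fibers_support) simp
  have A: "finite A" unfolding A_def using finK pt_finite_support(1)[OF N0] by simp
  define T where "T a = (\<Sum>P\<in>fiber a. d P)" for a
  have T_eq: "T a = (\<Sum>P\<in>fiber a. Poly_Mapping.lookup D P) + pt a N" for a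
    unfolding T_def d_def sum.distrib sum_fiber_val[OF assms(1) N] ..
  have d0: "0 \<le> d P" if "P \<in> fiber a" for P a using assms(4) fiber_point[OF that] by (simp add: d_def)
  have T0: "0 \<le> T a" for a unfolding T_def by (rule sum_nonneg) (rule d0)
  have "(\<Sum>a\<in>A. \<Sum>P\<in>fiber a. Poly_Mapping.lookup D P) = (\<Sum>P\<in>(\<Union>a\<in>A. fiber a). Poly_Mapping.lookup D P)"
    using A finite_fiber fiber_unique by (intro sum.UNION_disjoint[symmetric]) auto
  also have "\<dots> = deg D"
  proof (rule deg_eq_sum[symmetric])
    show "finite (\<Union>a\<in>A. fiber a)" using A finite_fiber by blast
    show "Poly_Mapping.keys D \<subseteq> (\<Union>a\<in>A. fiber a)"
    proof
      fix P assume P: "P \<in> Poly_Mapping.keys D"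
      then have "P \<in> points i" using assms(2) by (auto simp: divisors_def)
      then obtain a where "P \<in> fiber a" by (rule fiberE)
      then show "P \<in> (\<Union>a\<in>A. fiber a)" using P by (auto simp: A_def K_def)
    qed
  qed
  finally have "(\<Sum>a\<in>A. T a) = 1"
    unfolding T_eq sum.distrib using pt_finite_support(2)[OF N0 A] assms(3) by (auto simp: A_def)
  moreover have "T a = 0" if "a \<notin> A" for a
  proof -
    have "Poly_Mapping.lookup D P = 0" if "P \<in> fiber a" for P
      using that \<open>a \<notin> A\<close> by (auto simp: A_def K_def in_keys_iff)
    then show ?thesis unfolding T_eq using that by (simp add: A_def)
  qed
  ultimately have "\<exists>a. T a = 1 \<and> (\<forall>b. b \<noteq> a \<longrightarrow> T b = 0)"
  proof -
    assume s: "(\<Sum>a\<in>A. T a) = 1" and out: "\<And>a. a \<notin> A \<Longrightarrow> T a = 0"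
    then obtain a where a: "a \<in> A" "T a \<noteq> 0" by (metis sum.neutral zero_neq_one)
    have "(\<Sum>b\<in>A. T b) = T a + (\<Sum>b\<in>A - {a}. T b)" using A a(1) by (rule sum.remove)
    moreover have nn: "0 \<le> (\<Sum>b\<in>A - {a}. T b)" using T0 by (simp add: sum_nonneg)
    ultimately have "T a = 1" "(\<Sum>b\<in>A - {a}. T b) = 0" using s a(2) T0[of a] by linarith+
    moreover from this have "T b = 0" if "b \<noteq> a" for b
      using sum_nonneg_eq_0_iff[of "A - {a}" T] A T0 that out by (cases "b \<in> A") auto
    ultimately show ?thesis by blast
  qed
  then obtain a where a: "T a = 1" "\<And>b. b \<noteq> a \<Longrightarrow> T b = 0" by blast
  obtain R where R: "R \<in> fiber a" "d R \<noteq> 0" using a(1) unfolding T_def by (metis sum.neutral zero_neq_one)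
  have "T a = d R + (\<Sum>P\<in>fiber a - {R}. d P)" unfolding T_def using finite_fiber R(1) by (rule sum.remove)
  moreover have "0 \<le> (\<Sum>P\<in>fiber a - {R}. d P)" using d0 by (intro sum_nonneg) blast
  ultimately have dR: "d R = 1" "(\<Sum>P\<in>fiber a - {R}. d P) = 0" using a(1) R(2) d0[OF R(1)] by linarith+
  have "d P = (if P = R then 1 else 0)" if "P \<in> points i" for P
  proof -
    obtain b where b: "P \<in> fiber b" by (rule fiberE[OF \<open>P \<in> points i\<close>])
    show ?thesis
    proof (cases "b = a")
      case True
      then show ?thesis
        using dR b sum_nonneg_eq_0_iff[of "fiber a - {R}" d] finite_fiber d0 by (cases "P = R") auto
    next
      case False
      then have "d P = 0" using a(2)[OF False] b sum_nonneg_eq_0_iff[of "fiber b" d] finite_fiber d0 unfolding T_def by auto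
      moreover have "P \<noteq> R" using False b R(1) fiber_unique by blast
      ultimately show ?thesis by simp
    qed
  qed
  then show ?thesis using fiber_point[OF R(1)] unfolding d_def by blast
qed

text \<open>A function whose only pole is a simple one at \<open>R'\<close> lives on the line, as
  \<open>half_branch\<close> exceeds 1. But such functions have poles of even order over branch
  points and conjugate pairs of poles elsewhere.\<close>

lemma unique_lin_equiv_point:
  assumes "2 \<le> half_branch" "R \<in> points i" "R' \<in> points i" "z \<noteq> 0"
    "\<And>P. P \<in> points i \<Longrightarrow> P z = (if P = R then 1 else 0) - (if P = R' then 1 else 0)"
  shows "R = R'"
proof (rule ccontr)
  assume ne: "R \<noteq> R'"
  obtain a where a: "R' \<in> fiber a" by (rule fiberE[OF assms(3)])
  have "- Poly_Mapping.lookup (Poly_Mapping.single R' 1) P \<le> P z" if "P \<in> points i" for P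
    using assms(5)[OF that] by (simp add: lookup_single when_def)
  then have "z \<in> RR_space i (Poly_Mapping.single R' 1)"
    by (simp add: RR_space_def)
  then have "z \<in> RR_space i (pull {a} 1)"
    using RR_single_subset[OF a, of 1 1] fiber_ram[OF a] by (cases "a \<in> branch") auto
  then obtain x where x: "z = p x"
    using RR_pull_subset_range[of "{a}" 1] assms(1) by auto
  have R': "R' z = -1" using assms(5)[OF assms(3)] ne by auto
  show False
  proof (cases "a \<in> branch")
    case True
    then have "2 * pt a x = -1" using fiber_val[OF a, of x] R' x by simp
    then show False by presburger
  next
    case False
    have "R' (w z) = -1" using R' x by simp
    then have "(\<lambda>z. R' (w z)) = R'"
      using assms(5)[OF point_w(1)[OF assms(3)]] by (auto split: if_splits)
    then show False using fiber_nonbranch_eq(2)[OF False a] by simp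
  qed
qed

lemma lin_equiv_iff:
  "lin_equiv i (Poly_Mapping.single P 1 + Poly_Mapping.single Q 1) (Poly_Mapping.single R 1 + Poly_Mapping.single S 1) \<longleftrightarrow>
    (\<exists>z. z \<noteq> 0 \<and> (\<forall>X\<in>points i. X z = of_bool (X = P) + of_bool (X = Q) - of_bool (X = R) - of_bool (X = S)))"
proof -
  have "Poly_Mapping.lookup (Poly_Mapping.single P 1 + Poly_Mapping.single Q 1) X -
      Poly_Mapping.lookup (Poly_Mapping.single R 1 + Poly_Mapping.single S 1) X = X z \<longleftrightarrow>
    X z = of_bool (X = P) + of_bool (X = Q) - of_bool (X = R) - of_bool (X = S)" for X z
    by (auto simp: lookup_add lookup_single when_def)
  then show ?thesis unfolding lin_equiv_def by simp
qed

lemma fiber_branch_iff: "P \<in> fiber a \<Longrightarrow> a \<in> branch \<longleftrightarrow> (\<lambda>z. P (w z)) = P"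
  using fiber_branch[of a] fiber_nonbranch_eq(2)[of a P] by (metis singletonD)

text \<open>Both sides are multiplicities in the pullback of the point \<open>a\<close>: a fixed
  point twice, or two conjugate points.\<close>

lemma conjugate_points_divisor:
  assumes "P \<in> fiber a" "X \<in> fiber b"
  shows "of_bool (X = P) + of_bool (X = (\<lambda>z. P (w z))) = (if b \<in> branch then 2 else 1) * (of_bool (b = a) :: int)"
proof (cases "b = a")
  case True
  show ?thesis
  proof (cases "a \<in> branch")
    case a: True
    obtain R where "fiber a = {R}" by (rule fiber_branch[OF a])
    then have "X = P" using assms True by auto
    moreover have "(\<lambda>z. P (w z)) = P" using a fiber_branch_iff[OF assms(1)] by blast
    ultimately show ?thesis using True a by simp
  next
    case a: False
    then show ?thesis using fiber_nonbranch_eq[OF a assms(1)] assms(2) True by auto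
  qed
next
  case False
  then have "X \<noteq> P" "X \<noteq> (\<lambda>z. P (w z))" using assms fiber_w[OF assms(1)] fiber_unique by blast+
  then show ?thesis using False by simp
qed

text \<open>Points of the line are equivalent, by a function with zero \<open>a\<close> and pole
  \<open>c\<close>, and so are their pullbacks. The orders of the two factors at infinity balance,
  so that infinity needs no case of its own.\<close>

lemma conjugate_points_equiv:
  assumes "P \<in> points i" "Z \<in> points i"
  shows "lin_equiv i (Poly_Mapping.single P 1 + Poly_Mapping.single (\<lambda>z. P (w z)) 1)
    (Poly_Mapping.single Z 1 + Poly_Mapping.single (\<lambda>z. Z (w z)) 1)"
  unfolding lin_equiv_iff
proof -
  obtain a c where ac: "P \<in> fiber a" "Z \<in> fiber c" using assms by (meson fiberE)
  let ?x = "to_fract (lin_prod {a}) / to_fract (lin_prod {c})"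
  have x: "pt b ?x = of_bool (b = a) - of_bool (b = c)" for b
    by (simp add: valuation.val_divide[OF valuation_pt] lin_prod_neq_0 pt_lin_prod)
  show "\<exists>z. z \<noteq> 0 \<and> (\<forall>X\<in>points i. X z = of_bool (X = P) + of_bool (X = (\<lambda>z. P (w z))) - of_bool (X = Z) - of_bool (X = (\<lambda>z. Z (w z))))"
  proof (intro exI conjI ballI)
    show "p ?x \<noteq> 0" by (simp add: p lin_prod_neq_0)
    fix X assume "X \<in> points i"
    then obtain b where b: "X \<in> fiber b" by (rule fiberE)
    have "X (p ?x) = (if b \<in> branch then 2 else 1) * of_bool (b = a) - (if b \<in> branch then 2 else 1) * of_bool (b = c)"
      unfolding fiber_val[OF b] x by (simp add: right_diff_distrib)
    then show "X (p ?x) = of_bool (X = P) + of_bool (X = (\<lambda>z. P (w z))) - of_bool (X = Z) - of_bool (X = (\<lambda>z. Z (w z)))"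
      unfolding conjugate_points_divisor[OF ac(1) b, symmetric] conjugate_points_divisor[OF ac(2) b, symmetric] by linarith
  qed
qed

text \<open>Negation fixes \<open>Z\<close>, so P and its conjugate P' satisfy P + P' ~ 2 Z. Hence 2
  P ~ 2 Z means that P and P' are equivalent, and thus equal.\<close>

lemma two_torsion_eq:
  assumes "has_genus i 1" "Z \<in> points i" "is_negation i Z w"
  shows "two_torsion i Z = (\<Union>a\<in>branch. fiber a)"
proof -
  have hb: "2 \<le> half_branch" using genus_half_branch[OF assms(1)] by simp
  let ?lin = "\<lambda>P Q R S. lin_equiv i (Poly_Mapping.single P 1 + Poly_Mapping.single Q 1) (Poly_Mapping.single R 1 + Poly_Mapping.single S 1)"
  have cancel: "R = R'" if R: "?lin P Q R S" "?lin P Q R' S" "R \<in> points i" "R' \<in> points i" for P Q R R' S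
  proof -
    obtain z z' where z: "z \<noteq> 0" "\<And>X. X \<in> points i \<Longrightarrow> X z = of_bool (X = P) + of_bool (X = Q) - of_bool (X = R) - of_bool (X = S)"
      "z' \<noteq> 0" "\<And>X. X \<in> points i \<Longrightarrow> X z' = of_bool (X = P) + of_bool (X = Q) - of_bool (X = R') - of_bool (X = S)"
      using R(1,2) unfolding lin_equiv_iff by blast
    show ?thesis
    proof (rule unique_lin_equiv_point[OF hb R(3,4), of "z' / z"])
      show "z' / z \<noteq> 0" using z by simp
      fix X assume X: "X \<in> points i"
      show "X (z' / z) = (if X = R then 1 else 0) - (if X = R' then 1 else 0)"
        using valuation.val_divide[OF pointsD(1)[OF X] z(3,1)] z(2,4)[OF X] by simp
    qed
  qed
  have add_eq: "ec_add i Z P Q = R" if "R \<in> points i" "?lin P Q R Z" for P Q R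
    unfolding ec_add_def using that cancel by (intro the_equality) blast+
  \<comment> \<open>As the genus is 1, the space of P + Q - Z, a divisor of degree 1, contains some
    \<open>z\<close> other than 0. Adding the divisor of \<open>z\<close> makes it effective of
    degree 1, that is, a single point \<open>R\<close>.\<close>
  have add_ex: "\<exists>R\<in>points i. ?lin P Q R Z" if PQ: "P \<in> points i" "Q \<in> points i" for P Q
  proof -
    let ?D = "Poly_Mapping.single P 1 + Poly_Mapping.single Q 1 - Poly_Mapping.single Z 1 :: ('a \<Rightarrow> int) \<Rightarrow>\<^sub>0 int"
    have look: "Poly_Mapping.lookup ?D X = of_bool (X = P) + of_bool (X = Q) - of_bool (X = Z)" for X
      by (auto simp: lookup_add lookup_minus lookup_single when_def)
    have D: "?D \<in> divisors i"
    proof -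
      have "Poly_Mapping.keys ?D \<subseteq> {P, Q, Z}" by (auto simp: in_keys_iff look of_bool_def split: if_splits)
      then show ?thesis using PQ assms(2) unfolding divisors_def by blast
    qed
    \<comment> \<open>Written with subtractions of \<open>single\<close> only, the form that
      \<open>deg_diff_single\<close> evaluates.\<close>
    have "?D = (0 - Poly_Mapping.single P (-1) - Poly_Mapping.single Q (-1)) - Poly_Mapping.single Z 1"
      by (simp add: single_uminus)
    also have "deg \<dots> = 1" unfolding deg_diff_single by (simp add: deg_def)
    finally have deg: "deg ?D = 1" .
    have "1 \<le> ell i ?D" using assms(1) D deg unfolding has_genus_def by fastforce
    have "\<exists>z\<in>RR_space i ?D. z \<noteq> 0"
    proof (rule ccontr)
      interpret V: vector_space "\<lambda>c z. i c * z" by (rule vector_space_i)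
      assume "\<not> ?thesis"
      then have "RR_space i ?D \<subseteq> V.span {}" by auto
      then have "ell i ?D \<le> card ({} :: 'a set)" unfolding ell_def by (rule V.dim_le_card) simp
      then show False using \<open>1 \<le> ell i ?D\<close> by simp
    qed
    then obtain z where z: "z \<in> RR_space i ?D" "z \<noteq> 0" by blast
    have "0 \<le> Poly_Mapping.lookup ?D X + X z" if "X \<in> points i" for X
    proof -
      have "- Poly_Mapping.lookup ?D X \<le> X z" using z that unfolding RR_space_def by blast
      then show ?thesis by linarith
    qed
    then obtain R where R: "R \<in> points i" "\<And>X. X \<in> points i \<Longrightarrow> Poly_Mapping.lookup ?D X + X z = (if X = R then 1 else 0)"
      using effective_degree_1[OF z(2) D deg] by blast
    have "?lin P Q R Z" unfolding lin_equiv_iff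
    proof (intro exI conjI ballI)
      show "inverse z \<noteq> 0" using z by simp
      fix X assume X: "X \<in> points i"
      show "X (inverse z) = of_bool (X = P) + of_bool (X = Q) - of_bool (X = R) - of_bool (X = Z)"
        using R(2)[OF X, folded of_bool_def]
        unfolding look valuation.val_inverse[OF pointsD(1)[OF X]] by linarith
    qed
    then show ?thesis using R(1) by blast
  qed
  have add_Z: "ec_add i Z Z R = R" if "R \<in> points i" for R
    using that valuation.val_1[OF pointsD(1)]
    by (intro add_eq) (auto simp: lin_equiv_iff intro!: exI[of _ 1])
  have "ec_neg i Z Z = Z"
    unfolding ec_neg_def using assms(2) add_Z by (intro the_equality) auto
  then have Zw: "(\<lambda>z. Z (w z)) = Z"
    using assms(2,3) point_w(2)[OF assms(2)] by (simp add: is_negation_def)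
  have fixed_iff: "P \<in> two_torsion i Z \<longleftrightarrow> P \<in> points i \<and> (\<lambda>z. P (w z)) = P" for P
  proof (intro iffI conjI)
    assume P: "P \<in> points i \<and> (\<lambda>z. P (w z)) = P"
    then have "?lin P P Z Z" using conjugate_points_equiv[of P Z] assms(2) Zw by simp
    then show "P \<in> two_torsion i Z" using P add_eq[OF assms(2)] by (simp add: two_torsion_def)
  next
    assume "P \<in> two_torsion i Z"
    then have P: "P \<in> points i" "ec_add i Z P P = Z" by (auto simp: two_torsion_def)
    then show "P \<in> points i" by simp
    obtain R where "R \<in> points i" "?lin P P R Z" using add_ex[OF P(1) P(1)] by blast
    moreover from this have "R = Z" using add_eq P(2) by simp
    ultimately have "?lin P P Z Z" by simp
    then obtain z where z: "z \<noteq> 0" "\<And>X. X \<in> points i \<Longrightarrow> X z = of_bool (X = P) + of_bool (X = P) - of_bool (X = Z) - of_bool (X = Z)"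
      unfolding lin_equiv_iff by blast
    have "?lin P (\<lambda>z. P (w z)) Z Z" using conjugate_points_equiv[OF P(1) assms(2)] Zw by simp
    then obtain z' where z': "z' \<noteq> 0" "\<And>X. X \<in> points i \<Longrightarrow> X z' = of_bool (X = P) + of_bool (X = (\<lambda>z. P (w z))) - of_bool (X = Z) - of_bool (X = Z)"
      unfolding lin_equiv_iff by blast
    show "(\<lambda>z. P (w z)) = P"
    proof (rule unique_lin_equiv_point[OF hb point_w(1)[OF P(1)] P(1), of "z' / z"])
      show "z' / z \<noteq> 0" using z z' by simp
      fix X assume X: "X \<in> points i"
      show "X (z' / z) = (if X = (\<lambda>z. P (w z)) then 1 else 0) - (if X = P then 1 else 0)"
        using valuation.val_divide[OF pointsD(1)[OF X] z'(1) z(1)] z(2)[OF X] z'(2)[OF X] by simp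
    qed
  qed
  show ?thesis
  proof (intro set_eqI iffI)
    fix P assume "P \<in> two_torsion i Z"
    then have P: "P \<in> points i" "(\<lambda>z. P (w z)) = P" using fixed_iff by auto
    obtain a where "P \<in> fiber a" by (rule fiberE[OF P(1)])
    then show "P \<in> (\<Union>a\<in>branch. fiber a)" using P(2) fiber_branch_iff by blast
  next
    fix P assume "P \<in> (\<Union>a\<in>branch. fiber a)"
    then show "P \<in> two_torsion i Z" using fixed_iff fiber_branch_iff fiber_point by blast
  qed
qed

end

text \<open>Any \<open>z\<close> moved by \<open>w\<close> yields the anti-invariant
  \<open>z - w z\<close>. Its square is a fraction \<open>q / d\<close>; the factor
  \<open>d / s\<close> with \<open>q d = s^2 F\<close> turns this into a squarefree
  polynomial.\<close>

lemma ex_double_cover: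
  fixes i :: "'k::{alg_closed_field, field_char_0} \<Rightarrow> 'a::field"
  assumes "P1_quotient i w p"
  shows "\<exists>y F. double_cover i w p y F"
proof -
  have "field_hom w" "field_hom p" and ww: "w (w z) = z" and fixed: "w z = z \<Longrightarrow> z \<in> range p"
    and wp: "w (p x) = p x" and "w \<noteq> id" for z x
    using assms unfolding P1_quotient_def automorphism_def covering_def by (auto dest: fun_cong)
  note w = field_hom_simps[OF \<open>field_hom w\<close>] and p = field_hom_simps[OF \<open>field_hom p\<close>]
  obtain z where z: "w z \<noteq> z" using \<open>w \<noteq> id\<close> by (auto simp: fun_eq_iff)
  define y where "y = z - w z"
  have y: "y \<noteq> 0" "w y = - y" using z by (auto simp: y_def w ww)
  have "w (y * y) = y * y" by (simp add: w y)
  then obtain f where f: "y * y = p f" using fixed by blast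
  obtain q d where qd: "f = to_fract q / to_fract d" "d \<noteq> 0" by (rule fract_cases_to_fract)
  have "q * d \<noteq> 0"
  proof
    assume "q * d = 0"
    then have "p f = 0" using qd by (simp add: p)
    then show False using f y by simp
  qed
  then obtain s F where F: "s \<noteq> 0" "rsquarefree F" "q * d = s * s * F" using ex_squarefree_part by blast
  define y' where "y' = p (to_fract d / to_fract s) * y"
  have "y' * y' = p (to_fract d / to_fract s * (to_fract d / to_fract s) * f)"
    by (simp add: y'_def p f[symmetric])
  also have "to_fract d / to_fract s * (to_fract d / to_fract s) * f = to_fract (q * d) / (to_fract s * to_fract s)"
    using qd by (simp add: field_simps)
  also have "\<dots> = to_fract F" unfolding F(3) using F(1) by simp
  finally have "y' * y' = p (to_fract F)" .
  moreover have "y' \<noteq> 0" "w y' = - y'" using y qd(2) F(1) by (simp_all add: y'_def p w wp)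
  ultimately have "double_cover i w p y' F" using assms F(2) by unfold_locales
  then show ?thesis by blast
qed

section \<open>Self-maps of the projective line\<close>

lemma order_linear_power_mult: "poly q a \<noteq> 0 \<Longrightarrow> order a ([:-a, 1:] ^ e * q) = e"
  by (subst order_mult) (auto simp: order_power_n_n order_0I)

text \<open>In characteristic 0 differentiation lowers the order of \<open>P\<close> at
  \<open>a\<close> by exactly 1, while the other product keeps at least the order of
  \<open>P\<close>.\<close>

lemma wronskian_order:
  fixes P Q :: "'k::field_char_0 poly"
  assumes "P \<noteq> 0" "poly P a = 0" "poly Q a \<noteq> 0"
  shows "order a (pderiv P * Q - P * pderiv Q) = order a P - 1"
proof -
  obtain e where e: "order a P = Suc e" using assms(1,2) by (metis not0_implies_Suc order_root)
  define L where "L = [:-a, 1:]"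
  obtain R where R: "P = L ^ Suc e * R" "poly R a \<noteq> 0"
    using order_decomp[OF assms(1), of a] unfolding e L_def by (metis poly_eq_0_iff_dvd)
  have L: "pderiv L = 1" "poly L a = 0" by (simp_all add: L_def pderiv_pCons one_pCons)
  have dlin: "pderiv (L ^ Suc e) = of_nat (Suc e) * L ^ e"
    by (simp add: pderiv_power_Suc L of_nat_poly del: power_Suc of_nat_Suc)
  have "pderiv P * Q - P * pderiv Q =
      L ^ e * (of_nat (Suc e) * R * Q + L * (pderiv R * Q - R * pderiv Q))"
    unfolding R(1) pderiv_mult dlin by (simp add: algebra_simps del: of_nat_Suc)
  moreover have "poly (of_nat (Suc e) * R * Q + L * (pderiv R * Q - R * pderiv Q)) a \<noteq> 0"
    using R(2) assms(3) by (simp add: of_nat_poly L del: of_nat_Suc)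
  ultimately show ?thesis
    using order_linear_power_mult[folded L_def, of _ a e] e L_def by (metis diff_Suc_1)
qed

text \<open>The counterpart at infinity: the top coefficient is \<open>degree P - degree Q\<close>
  times the leading coefficients, which is nonzero in characteristic 0.\<close>

lemma wronskian_degree:
  fixes P Q :: "'k::field_char_0 poly"
  assumes "P \<noteq> 0" "degree P < degree Q"
  shows "pderiv P * Q - P * pderiv Q \<noteq> 0" "degree (pderiv P * Q - P * pderiv Q) = degree P + degree Q - 1"
proof -
  let ?m = "degree P" and ?n = "degree Q"
  have le: "degree (pderiv P * Q - P * pderiv Q) \<le> ?m + ?n - 1"
  proof (rule degree_diff_le)
    show "degree (P * pderiv Q) \<le> ?m + ?n - 1"
      using degree_mult_le[of P "pderiv Q"] assms(2) by (simp add: degree_pderiv)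
    show "degree (pderiv P * Q) \<le> ?m + ?n - 1"
    proof (cases "?m = 0")
      case True
      then have "pderiv P = 0" by (simp add: pderiv_eq_0_iff)
      then show ?thesis by simp
    next
      case False
      then show ?thesis using degree_mult_le[of "pderiv P" Q] by (simp add: degree_pderiv)
    qed
  qed
  have c2: "coeff (P * pderiv Q) (?m + ?n - 1) = of_nat ?n * (lead_coeff P * lead_coeff Q)"
  proof -
    have "coeff (P * pderiv Q) (?m + ?n - 1) = lead_coeff P * coeff (pderiv Q) (?n - 1)"
      using coeff_mult_degree_sum[of P "pderiv Q"] assms(2) by (simp add: degree_pderiv)
    then show ?thesis using assms(2) by (simp add: coeff_pderiv)
  qed
  have c1: "coeff (pderiv P * Q) (?m + ?n - 1) = of_nat ?m * (lead_coeff P * lead_coeff Q)"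
  proof (cases "?m = 0")
    case True
    then have "pderiv P = 0" by (simp add: pderiv_eq_0_iff)
    then show ?thesis using True by simp
  next
    case False
    have "coeff (pderiv P * Q) (?m + ?n - 1) = coeff (pderiv P) (?m - 1) * lead_coeff Q"
      using coeff_mult_degree_sum[of "pderiv P" Q] False by (simp add: degree_pderiv)
    then show ?thesis using False by (simp add: coeff_pderiv)
  qed
  have "coeff (pderiv P * Q - P * pderiv Q) (?m + ?n - 1) = (of_nat ?m - of_nat ?n) * (lead_coeff P * lead_coeff Q)"
    by (simp only: coeff_diff c1 c2 left_diff_distrib)
  also have "\<dots> \<noteq> 0" using assms by auto
  finally have ne: "coeff (pderiv P * Q - P * pderiv Q) (?m + ?n - 1) \<noteq> 0" .
  then show "pderiv P * Q - P * pderiv Q \<noteq> 0" by (metis coeff_0)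
  show "degree (pderiv P * Q - P * pderiv Q) = ?m + ?n - 1"
    using le le_degree[OF ne] by simp
qed

text \<open>The roots of \<open>P\<close> count \<open>degree P\<close>, and infinity adds
  \<open>degree Q - degree P\<close> if this is positive.\<close>

lemma sum_zeros_quotient:
  fixes P Q :: "'k::alg_closed_field poly"
  assumes "P \<noteq> 0" "Q \<noteq> 0" "\<And>a. poly P a = 0 \<Longrightarrow> poly Q a \<noteq> 0"
  defines "Z \<equiv> {a. 0 < pt a (to_fract P / to_fract Q)}"
  shows "finite Z" "(\<Sum>a\<in>Z. pt a (to_fract P / to_fract Q)) = int (max (degree P) (degree Q))"
proof -
  let ?R = "{a. poly P a = 0}" and ?I = "if degree P < degree Q then {None :: 'k option} else {}"
  have fin: "finite ?R" using assms(1) by (rule poly_roots_finite)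
  have Z: "Z = Some ` ?R \<union> ?I"
  proof (intro set_eqI)
    fix a show "a \<in> Z \<longleftrightarrow> a \<in> Some ` ?R \<union> ?I"
    proof (cases a)
      case None
      then show ?thesis by (auto simp: Z_def pt_quotient assms(1,2))
    next
      case (Some c)
      have "0 < int (order c P) - int (order c Q) \<longleftrightarrow> poly P c = 0"
        using assms(1,2) assms(3)[of c] order_root[of P c] order_0I[of Q c] by (cases "poly P c = 0") auto
      then show ?thesis using Some by (auto simp: Z_def pt_quotient assms(1,2))
    qed
  qed
  show "finite Z" unfolding Z using fin by auto
  have "(\<Sum>a\<in>Z. pt a (to_fract P / to_fract Q)) = (\<Sum>a\<in>Some ` ?R. pt a (to_fract P / to_fract Q)) + (\<Sum>a\<in>?I. pt a (to_fract P / to_fract Q))"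
    unfolding Z using fin by (intro sum.union_disjoint) auto
  also have "(\<Sum>a\<in>Some ` ?R. pt a (to_fract P / to_fract Q)) = (\<Sum>c\<in>?R. int (order c P))"
  proof -
    have "pt (Some c) (to_fract P / to_fract Q) = int (order c P)" if "c \<in> ?R" for c
      using assms(3)[of c] that order_0I[of Q c] by (simp add: pt_quotient assms(1,2))
    then show ?thesis by (simp add: sum.reindex)
  qed
  also have "\<dots> = int (degree P)" by (simp only: sum_order_eq_degree[OF assms(1) fin order_refl] flip: of_nat_sum)
  also have "(\<Sum>a\<in>?I. pt a (to_fract P / to_fract Q)) = (if degree P < degree Q then int (degree Q) - int (degree P) else 0)"
    by (simp add: pt_quotient assms(1,2))
  finally show "(\<Sum>a\<in>Z. pt a (to_fract P / to_fract Q)) = int (max (degree P) (degree Q))" by simp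
qed

lemma ex_reduced_fraction:
  fixes z :: "'k::field poly fract"
  shows "\<exists>p q. q \<noteq> 0 \<and> z = to_fract p / to_fract q \<and> (\<forall>a. poly p a = 0 \<longrightarrow> poly q a \<noteq> 0)"
proof -
  have "\<exists>p' q'. q' \<noteq> 0 \<and> to_fract p / to_fract q = to_fract p' / to_fract q' \<and> (\<forall>a. poly p' a = 0 \<longrightarrow> poly q' a \<noteq> 0)"
    if "q \<noteq> 0" for p q :: "'k poly"
    using that
  proof (induction "degree q" arbitrary: p q rule: less_induct)
    case less
    show ?case
    proof (cases "\<exists>a. poly p a = 0 \<and> poly q a = 0")
      case True
      then obtain a p' q' where pq: "p = [:-a, 1:] * p'" "q = [:-a, 1:] * q'"
        by (metis dvdE poly_eq_0_iff_dvd)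
      then have q': "q' \<noteq> 0" using less.prems by auto
      have "degree q = Suc (degree q')" unfolding pq(2) using q' by (subst degree_mult_eq) auto
      moreover have "to_fract p / to_fract q = to_fract p' / to_fract q'"
        unfolding pq to_fract_mult by (rule mult_divide_mult_cancel_left) simp
      ultimately show ?thesis using less.hyps[of q' p'] q' by simp
    qed (use less.prems in blast)
  qed
  then show ?thesis by (metis fract_cases_to_fract)
qed

lemma to_fract_power: "to_fract (p ^ n) = to_fract p ^ n"
  by (induction n) simp_all

abbreviation X :: "'k::field poly fract" where "X \<equiv> to_fract [:0, 1:]"

lemma X_neq_const: "X \<noteq> P1 c"
  by (simp add: P1_def)

lemma pt_X_minus_const: "pt a (X - P1 c) = ord a [:-c, 1:]"
proof -
  have "X - P1 c = to_fract [:-c, 1:]" by (simp add: P1_def flip: to_fract_diff)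
  then show ?thesis by (simp add: pt_poly)
qed

locale P1_map =
  fixes \<phi> :: "'k::{alg_closed_field, field_char_0} poly fract \<Rightarrow> 'k poly fract"
  assumes cov: "covering P1 P1 \<phi>"
begin

lemma \<phi>_hom: "field_hom \<phi>" and \<phi>_const [simp]: "\<phi> (P1 c) = P1 c"
  using cov by (auto simp: covering_def)

lemmas \<phi> = field_hom_simps[OF \<phi>_hom]

definition f :: "'k option \<Rightarrow> 'k option" where "f a = (THE b. image_point \<phi> (pt a) = pt b)"
definition e :: "'k option \<Rightarrow> nat" where "e a = ram_index \<phi> (pt a)"

lemma image_pt: "image_point \<phi> (pt a) = pt (f a)" and e_pos: "0 < e a"
  and pt_\<phi>: "pt a (\<phi> u) = int (e a) * pt (f a) u"
proof -
  interpret va: valuation "pt a" by (rule valuation_pt)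
  \<comment> \<open>The restriction is nontrivial: either \<open>\<phi> X\<close> has a pole at
    \<open>a\<close>, or subtracting its residue produces a zero.\<close>
  have "\<exists>u. pt a (\<phi> u) \<noteq> 0"
  proof (cases "pt a (\<phi> X) < 0")
    case True
    then show ?thesis by (intro exI[of _ X]) simp
  next
    case False
    then obtain c where c: "va.at_least 1 (\<phi> X - P1 c)" using pt_residue[of a "\<phi> X"] by auto
    have "\<phi> X - P1 c = \<phi> (X - P1 c)" by (simp add: \<phi>)
    moreover have "\<phi> (X - P1 c) \<noteq> 0" using X_neq_const[of c] by (simp only: \<phi>(10)) simp
    ultimately have "1 \<le> pt a (\<phi> (X - P1 c))" using c by (simp add: va.at_least_def)
    then show ?thesis by (intro exI[of _ "X - P1 c"]) simp
  qed
  then obtain u where "pt a (\<phi> u) \<noteq> 0" by blast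
  note r = restrict_point_ex[OF pt_point cov this]
  from r(1) obtain b where "image_point \<phi> (pt a) = pt b" unfolding points_P1 by blast
  then have "f a = b" unfolding f_def by (auto simp: pt_inj)
  then show im: "image_point \<phi> (pt a) = pt (f a)" using \<open>image_point \<phi> (pt a) = pt b\<close> by simp
  show "0 < e a" using r(2) by (simp add: e_def)
  show "pt a (\<phi> u) = int (e a) * pt (f a) u" for u using r(3)[of u] im by (simp add: e_def)
qed

text \<open>A uniformizer at \<open>b\<close> without any other zero: the fiber over
  \<open>b\<close> is the set of zeros of \<open>\<phi> (unif b)\<close>, and the indices are their
  orders.\<close>

definition unif :: "'k option \<Rightarrow> 'k poly fract" where
  "unif b = (case b of None \<Rightarrow> inverse X | Some c \<Rightarrow> X - P1 c)"

lemma pt_unif: "0 < pt a (unif b) \<longleftrightarrow> a = b" "pt b (unif b) = 1"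
proof -
  have "pt a (unif b) = (case b of None \<Rightarrow> - ord a [:0, 1:] | Some c \<Rightarrow> ord a [:-c, 1:])" for a
    using pt_X_minus_const[of a 0]
    by (cases b) (simp_all add: unif_def pt_X_minus_const valuation.val_inverse[OF valuation_pt] pt_poly)
  then show "0 < pt a (unif b) \<longleftrightarrow> a = b" "pt b (unif b) = 1"
    using ord_linear[of a 0] ord_linear[of b 0]
    by (auto simp: ord_linear simp del: ord.simps split: option.splits if_splits)
qed

lemma fiber_iff: "f a = b \<longleftrightarrow> 0 < pt a (\<phi> (unif b))"
  using pt_unif(1)[of "f a" b] e_pos[of a] by (simp add: pt_\<phi> zero_less_mult_iff)

lemma e_eq: "f a = b \<Longrightarrow> int (e a) = pt a (\<phi> (unif b))"
  using pt_unif(2)[of b] by (simp add: pt_\<phi>)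

section \<open>Fibers described by a reduced fraction\<close>

definition reduced :: "'k poly \<Rightarrow> 'k poly \<Rightarrow> bool" where
  "reduced p q \<longleftrightarrow> q \<noteq> 0 \<and> \<phi> X = to_fract p / to_fract q \<and> (\<forall>a. poly p a = 0 \<longrightarrow> poly q a \<noteq> 0)"

definition num :: "'k poly" where "num = fst (SOME pq. reduced (fst pq) (snd pq))"
definition den :: "'k poly" where "den = snd (SOME pq. reduced (fst pq) (snd pq))"

lemma num_den: "den \<noteq> 0" "\<phi> X = to_fract num / to_fract den" "poly num a = 0 \<Longrightarrow> poly den a \<noteq> 0"
proof -
  have "\<exists>pq. reduced (fst pq) (snd pq)"
    using ex_reduced_fraction[of "\<phi> X"] unfolding reduced_def by auto
  from someI_ex[OF this] have "reduced num den" unfolding num_def den_def .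
  then show "den \<noteq> 0" "\<phi> X = to_fract num / to_fract den" "poly num a = 0 \<Longrightarrow> poly den a \<noteq> 0"
    by (auto simp: reduced_def)
qed

definition N :: nat where "N = max (degree num) (degree den)"

lemma num_neq: "num \<noteq> smult c den"
proof
  assume "num = smult c den"
  then have "num = [:c:] * den" by simp
  then have "\<phi> X = P1 c" using num_den(1,2) unfolding P1_def by (simp only: to_fract_mult) simp
  also have "P1 c = \<phi> (P1 c)" by simp
  finally have "X = P1 c" using \<phi>(11) by blast
  then show False using X_neq_const by blast
qed

text \<open>The numerator of \<open>\<phi> (unif b)\<close>, with \<open>denb\<close> its
  denominator. As \<open>unif b\<close> arises from \<open>X\<close> by a fractional linear
  substitution of determinant 1 or -1, the maximal degree \<open>N\<close> and, up to sign, the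
  Wronskian are the same for all \<open>b\<close>.\<close>

definition numb :: "'k option \<Rightarrow> 'k poly" where
  "numb b = (case b of None \<Rightarrow> den | Some c \<Rightarrow> num - smult c den)"

definition denb :: "'k option \<Rightarrow> 'k poly" where
  "denb b = (case b of None \<Rightarrow> num | Some c \<Rightarrow> den)"

lemma numb_denb: "numb b \<noteq> 0" "denb b \<noteq> 0" "\<phi> (unif b) = to_fract (numb b) / to_fract (denb b)"
  "poly (numb b) a = 0 \<Longrightarrow> poly (denb b) a \<noteq> 0" "max (degree (numb b)) (degree (denb b)) = N"
  and wronskian_numb: "pderiv (numb b) * denb b - numb b * pderiv (denb b) =
    (if b = None then - (pderiv num * den - num * pderiv den) else pderiv num * den - num * pderiv den)"
proof -
  have n0: "num \<noteq> 0" using num_neq[of 0] by simp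
  show "numb b \<noteq> 0" "denb b \<noteq> 0"
    using n0 num_neq num_den(1) by (auto simp: numb_def denb_def split: option.split)
  show "poly (numb b) a = 0 \<Longrightarrow> poly (denb b) a \<noteq> 0"
    using num_den(3)[of a] by (auto simp: numb_def denb_def split: option.splits)
  show "\<phi> (unif b) = to_fract (numb b) / to_fract (denb b)"
  proof (cases b)
    case None
    then show ?thesis by (simp add: unif_def numb_def denb_def \<phi> num_den(2))
  next
    case (Some c)
    have "to_fract (smult c den) = P1 c * to_fract den" by (simp add: P1_def flip: to_fract_mult)
    then show ?thesis
      using Some num_den(1) by (simp add: unif_def numb_def denb_def \<phi> num_den(2) diff_divide_distrib)
  qed
  show "max (degree (numb b)) (degree (denb b)) = N"
  proof (cases b)
    case (Some c)
    have "max (degree (num - smult c den)) (degree den) = max (degree num) (degree den)"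
    proof (cases "degree den < degree num")
      case True
      then have "degree (- smult c den) < degree num"
        using degree_smult_le[of c den] by (simp add: order_le_less_trans)
      then have "degree (num - smult c den) = degree num"
        using degree_add_eq_left[of "- smult c den" num] by simp
      then show ?thesis by simp
    next
      case False
      then show ?thesis using degree_diff_le[of num "degree den" "smult c den"] by simp
    qed
    then show ?thesis using Some by (simp add: numb_def denb_def N_def)
  qed (simp add: numb_def denb_def N_def max.commute)
  show "pderiv (numb b) * denb b - numb b * pderiv (denb b) =
    (if b = None then - (pderiv num * den - num * pderiv den) else pderiv num * den - num * pderiv den)"
  proof (cases b)
    case None
    then show ?thesis by (simp add: numb_def denb_def mult.commute)
  next
    case (Some c)
    then show ?thesis
      by (simp add: numb_def denb_def pderiv_diff pderiv_smult left_diff_distrib)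
        (simp only: mult.commute)
  qed
qed

lemma finite_fiber: "finite {a. f a = b}" and sum_fiber: "(\<Sum>a\<in>{a. f a = b}. e a) = N"
proof -
  have eq: "{a. f a = b} = {a. 0 < pt a (to_fract (numb b) / to_fract (denb b))}"
    unfolding fiber_iff numb_denb(3) ..
  note z = sum_zeros_quotient[OF numb_denb(1)[of b] numb_denb(2)[of b] numb_denb(4)[of b], folded eq]
  show "finite {a. f a = b}" by (rule z(1))
  have "int (\<Sum>a\<in>{a. f a = b}. e a) = (\<Sum>a\<in>{a. f a = b}. pt a (to_fract (numb b) / to_fract (denb b)))"
    unfolding of_nat_sum by (intro sum.cong refl) (simp add: e_eq numb_denb(3))
  also have "\<dots> = int N" using z(2) numb_denb(5)[of b] by simp
  finally show "(\<Sum>a\<in>{a. f a = b}. e a) = N" by (simp only: of_nat_eq_iff)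
qed

abbreviation wr :: "'k poly" where "wr \<equiv> pderiv num * den - num * pderiv den"

text \<open>If \<open>b\<close> is the image of infinity, \<open>denb b\<close> has degree
  \<open>N\<close> and \<open>numb b\<close> falls short of it by the index at infinity.\<close>

lemma wr_infinity: "wr \<noteq> 0" "int (degree wr) = 2 * int N - int (e None) - 1"
proof -
  let ?b = "f None"
  have "int (e None) = int (degree (denb ?b)) - int (degree (numb ?b))"
    using e_eq[of None ?b] numb_denb(1,2) by (simp add: numb_denb(3) pt_quotient)
  then have lt: "degree (numb ?b) < degree (denb ?b)" and en: "int (e None) = int (degree (denb ?b)) - int (degree (numb ?b))"
    using e_pos[of None] by linarith+
  note w = wronskian_degree[OF numb_denb(1) lt]
  have deg: "degree wr = degree (pderiv (numb ?b) * denb ?b - numb ?b * pderiv (denb ?b))"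
    unfolding wronskian_numb using degree_minus[of wr] by (simp del: degree_minus)
  show "wr \<noteq> 0" using w(1) unfolding wronskian_numb by (auto split: if_splits)
  show "int (degree wr) = 2 * int N - int (e None) - 1"
    unfolding deg w(2) using en lt numb_denb(5)[of ?b] by simp
qed

lemma order_wr: "order c wr = e (Some c) - 1"
proof -
  let ?b = "f (Some c)"
  have en: "int (e (Some c)) = int (order c (numb ?b)) - int (order c (denb ?b))"
    using e_eq[of "Some c" ?b] numb_denb(1,2) by (simp add: numb_denb(3) pt_quotient)
  then have "order c (numb ?b) \<noteq> 0" using e_pos[of "Some c"] by linarith
  then have root: "poly (numb ?b) c = 0" by (metis order_0I)
  then have "poly (denb ?b) c \<noteq> 0" by (rule numb_denb(4))
  then have "order c (pderiv (numb ?b) * denb ?b - numb ?b * pderiv (denb ?b)) = e (Some c) - 1"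
    using wronskian_order[OF numb_denb(1) root] en order_0I[of "denb ?b" c] by simp
  then show ?thesis unfolding wronskian_numb if_distrib[of "order c"] order_uminus if_cancel .
qed

text \<open>With e the index at infinity, the finite points contribute the degree 2 N - e - 1 of the
  Wronskian and infinity contributes e - 1.\<close>

lemma riemann_hurwitz:
  assumes "finite R" "{a. e a \<noteq> 1} \<subseteq> R"
  shows "(\<Sum>a\<in>R. int (e a) - 1) = 2 * int N - 2"
proof -
  let ?Z = "{c. poly wr c = 0}"
  have fin: "finite ?Z" using wr_infinity(1) by (rule poly_roots_finite)
  have e1: "e a = 1" if na: "a \<notin> insert None (Some ` ?Z)" for a
  proof -
    obtain c where c: "a = Some c" using na by (cases a) auto
    then have "poly wr c \<noteq> 0" using na by blast
    then have "order c wr = 0" by (intro order_0I)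
    then show ?thesis using order_wr[of c] e_pos[of a] c by simp
  qed
  have "(\<Sum>a\<in>R. int (e a) - 1) = (\<Sum>a\<in>R \<union> insert None (Some ` ?Z). int (e a) - 1)"
    using assms fin by (intro sum.mono_neutral_left) auto
  also have "\<dots> = (\<Sum>a\<in>insert None (Some ` ?Z). int (e a) - 1)"
    using assms fin e1 by (intro sum.mono_neutral_right) auto
  also have "\<dots> = (int (e None) - 1) + (\<Sum>c\<in>?Z. int (e (Some c)) - 1)"
    using fin by (simp add: sum.reindex)
  also have "(\<Sum>c\<in>?Z. int (e (Some c)) - 1) = (\<Sum>c\<in>?Z. int (order c wr))"
  proof (rule sum.cong[OF refl])
    fix c
    show "int (e (Some c)) - 1 = int (order c wr)"
      unfolding order_wr using e_pos[of "Some c"] by linarith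
  qed
  also have "\<dots> = int (degree wr)" by (simp only: sum_order_eq_degree[OF wr_infinity(1) fin order_refl] flip: of_nat_sum)
  finally show ?thesis using wr_infinity(2) by simp
qed

lemma finite_ramified: "finite {a. e a \<noteq> 1}"
proof -
  have "{a. e a \<noteq> 1} \<subseteq> insert None (Some ` {c. poly wr c = 0})"
  proof
    fix a assume a: "a \<in> {a. e a \<noteq> 1}"
    show "a \<in> insert None (Some ` {c. poly wr c = 0})"
    proof (cases a)
      case (Some c)
      then have "order c wr \<noteq> 0" using a order_wr[of c] e_pos[of a] by simp
      then have "poly wr c = 0" by (metis order_0I)
      then show ?thesis unfolding Some by (intro insertI2 imageI CollectI)
    qed simp
  qed
  then show ?thesis using poly_roots_finite[OF wr_infinity(1)] finite_subset by blast
qed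

section \<open>The degree as a vector space dimension\<close>

lemma N_pos: "0 < N"
  using sum_fiber[of "f None"] e_pos[of None] finite_fiber[of "f None"]
  by (metis (mono_tags, lifting) gr0I mem_Collect_eq not_less0 sum_eq_0_iff)

text \<open>Reduce a relation modulo a point \<open>b\<close>: scaled so that its coefficients are
  integral at \<open>b\<close> and do not all vanish there, it leaves a nonzero polynomial
  \<open>s\<close> of degree below \<open>N\<close> that vanishes on the fiber over \<open>b\<close>
  with multiplicities, that is, \<open>N\<close> times.\<close>

lemma powers_independent:
  assumes "(\<Sum>j<N. \<phi> (u j) * X ^ j) = 0" "j < N"
  shows "u j = 0"
proof (rule ccontr)
  assume "u j \<noteq> 0"
  \<comment> \<open>The fiber over \<open>b\<close> must avoid infinity, where the powers of
    \<open>X\<close> have poles. If \<open>num\<close> has degree \<open>N\<close>, 0 will do;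
    otherwise \<open>den\<close> has the larger degree and 1 will do.\<close>
  obtain b where b: "degree (numb (Some b)) = N"
  proof (cases "degree num = N")
    case True
    then show ?thesis using that[of 0] by (simp add: numb_def)
  next
    case False
    then have "degree num < degree den" "degree den = N" by (auto simp: N_def)
    then have "degree (num - smult 1 den) = N"
      by (metis degree_add_eq_right degree_minus diff_conv_add_uminus smult_1_left)
    then show ?thesis using that[of 1] by (simp add: numb_def)
  qed
  interpret vb: valuation "pt (Some b)" by (rule valuation_pt)
  let ?v = "pt (Some b)" and ?J = "{j. j < N \<and> u j \<noteq> 0}"
  have J: "finite ?J" "?J \<noteq> {}" using \<open>u j \<noteq> 0\<close> assms(2) by auto
  obtain l where l: "l \<in> ?J" "\<And>k. k \<in> ?J \<Longrightarrow> ?v (u l) \<le> ?v (u k)"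
    using ex_min_if_finite[of "(\<lambda>j. ?v (u j)) ` ?J"] J by (metis (no_types, lifting) arg_min_if_finite(1) arg_min_least)
  define u' where "u' k = u k / u l" for k
  have ul: "u l \<noteq> 0" "l < N" using l(1) by auto
  have "0 \<le> ?v (u' k)" if "k < N" for k
    using l(2)[of k] that ul(1) vb.val_divide[of "u k" "u l"] vb.val_0 by (cases "u k = 0") (auto simp: u'_def)
  then have "\<forall>k. \<exists>c. k < N \<longrightarrow> vb.at_least 1 (u' k - P1 c)" using pt_residue by blast
  then obtain c where c: "\<And>k. k < N \<Longrightarrow> vb.at_least 1 (u' k - P1 (c k))" by metis
  have "c l \<noteq> 0"
    using c[OF ul(2)] ul(1) vb.val_1 by (auto simp: u'_def vb.at_least_def field_hom_simps[OF field_hom_P1])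
  define s where "s = (\<Sum>k<N. monom (c k) k)"
  have coeff_s: "coeff s k = (if k < N then c k else 0)" for k
    by (simp add: s_def coeff_sum if_distrib sum.delta cong: if_cong)
  have s0: "s \<noteq> 0" using coeff_s[of l] ul(2) \<open>c l \<noteq> 0\<close> by (metis coeff_0)
  have degs: "degree s < N" using coeff_s N_pos degree_lessI[of s N] s0 by auto
  \<comment> \<open>The relation itself contributes 0, so \<open>s\<close> is minus the sum of the
    remainders, whose coefficients vanish at \<open>b\<close> before \<open>\<phi>\<close> is
    applied.\<close>
  have s_eq: "to_fract s = - (\<Sum>k<N. \<phi> (u' k - P1 (c k)) * X ^ k)"
  proof -
    have "to_fract (monom (c k) k) = P1 (c k) * X ^ k" for k
    proof -
      have "monom (c k) k = [:c k:] * [:0, 1:] ^ k" by (simp add: monom_altdef)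
      then show ?thesis by (simp only: to_fract_mult to_fract_power P1_def)
    qed
    then have "to_fract s = (\<Sum>k<N. P1 (c k) * X ^ k)" by (simp add: s_def)
    moreover have "(\<Sum>k<N. \<phi> (u' k) * X ^ k) = 0"
    proof -
      have "(\<Sum>k<N. \<phi> (u' k) * X ^ k) = (\<Sum>k<N. \<phi> (u k) * X ^ k) / \<phi> (u l)"
        unfolding sum_divide_distrib by (intro sum.cong refl) (simp add: u'_def \<phi>)
      then show ?thesis using assms(1) by simp
    qed
    ultimately show ?thesis by (simp add: \<phi> left_diff_distrib sum_subtractf)
  qed
  let ?P = "numb (Some b)"
  have fin: "finite {a. poly ?P a = 0}" by (rule poly_roots_finite[OF numb_denb(1)])
  have "order a ?P \<le> order a s" if a: "poly ?P a = 0" for a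
  proof -
    interpret va: valuation "pt (Some a)" by (rule valuation_pt)
    have "order a (denb (Some b)) = 0" using numb_denb(4)[OF a] by (rule order_0I)
    then have pe: "pt (Some a) (\<phi> (unif (Some b))) = int (order a ?P)"
      by (simp add: numb_denb(3) pt_quotient numb_denb(1,2))
    moreover have "order a ?P \<noteq> 0" using a numb_denb(1) order_root by blast
    ultimately have fa: "f (Some a) = Some b" using fiber_iff by simp
    then have ea: "e (Some a) = order a ?P" using e_eq[OF fa] pe by simp
    have "va.at_least (int (order a ?P)) (\<phi> (u' k - P1 (c k)) * X ^ k)" if "k < N" for k
    proof -
      have "va.at_least (int (order a ?P)) (\<phi> (u' k - P1 (c k)))"
      proof (cases "u' k - P1 (c k) = 0")
        case False
        then have "1 \<le> ?v (u' k - P1 (c k))" using c[OF that] by (simp add: vb.at_least_def)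
        then have "int (order a ?P) * 1 \<le> int (order a ?P) * ?v (u' k - P1 (c k))" by (intro mult_left_mono) auto
        then show ?thesis unfolding va.at_least_def pt_\<phi> fa ea by simp
      qed (simp add: \<phi>)
      moreover have "va.at_least 0 (X ^ k)"
        by (simp add: va.at_least_def va.val_power pt_poly)
      ultimately show ?thesis using va.at_least_mult by fastforce
    qed
    then have "va.at_least (int (order a ?P)) (to_fract s)"
      unfolding s_eq va.at_least_minus by (intro va.at_least_sum) simp
    then show ?thesis using s0 by (simp add: va.at_least_def pt_poly)
  qed
  then have "(\<Sum>a\<in>{a. poly ?P a = 0}. order a ?P) \<le> (\<Sum>a\<in>{a. poly ?P a = 0}. order a s)"
    by (intro sum_mono) simp
  also have "\<dots> \<le> (\<Sum>a\<in>{a. poly ?P a = 0} \<union> {a. poly s a = 0}. order a s)"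
    using fin poly_roots_finite[OF s0] by (intro sum_mono2) auto
  also have "\<dots> = degree s"
    using fin poly_roots_finite[OF s0] by (intro sum_order_eq_degree[OF s0]) auto
  also have "(\<Sum>a\<in>{a. poly ?P a = 0}. order a ?P) = N"
    using sum_order_eq_degree[OF numb_denb(1) fin order_refl] b by simp
  finally show False using degs by simp
qed

lemma vector_space_\<phi>: "vector_space (\<lambda>c z. \<phi> c * z)"
  by unfold_locales (simp_all add: \<phi> algebra_simps)

text \<open>The equation \<open>num - \<phi> X * den = 0\<close> expresses \<open>X^N\<close> by
  lower powers, so the span of these is closed under multiplication by polynomials. Denominators are
  handled by dimension: multiplying the powers by the denominator of \<open>g\<close> gives
  \<open>N\<close> independent vectors in a space of dimension \<open>N\<close>, so its numerator is
  a combination of them.\<close>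

lemma powers_span: "\<exists>u. g = (\<Sum>j<N. \<phi> (u j) * X ^ j)"
proof -
  interpret V: vector_space "\<lambda>c z. \<phi> c * z" by (rule vector_space_\<phi>)
  have inj: "inj_on (\<lambda>j. X ^ j :: 'k poly fract) {..<N}" and indep: "V.independent ((\<lambda>j. X ^ j) ` {..<N})"
    using V.independent_familyI[of "{..<N}" "\<lambda>j. X ^ j"] powers_independent by auto
  define S where "S = V.span ((\<lambda>j. X ^ j) ` {..<N})"
  have base: "X ^ j \<in> S" if "j < N" for j unfolding S_def using that by (intro V.span_base) auto
  have SN: "X ^ N \<in> S"
  proof -
    \<comment> \<open>Coefficients of that equation before \<open>\<phi>\<close> is applied; the
      leading one is nonzero, as \<open>N\<close> is the larger degree and \<open>X\<close> is not
      constant.\<close>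
    define c where "c j = P1 (coeff num j) - X * P1 (coeff den j)" for j
    have poly_eq: "to_fract q = (\<Sum>j\<le>N. P1 (coeff q j) * X ^ j)" if "degree q \<le> N" for q :: "'k poly"
    proof -
      have "q = (\<Sum>j\<le>N. [:coeff q j:] * [:0, 1:] ^ j)"
        using poly_as_sum_of_monoms'[OF that] by (simp add: monom_altdef)
      then have "to_fract q = to_fract (\<Sum>j\<le>N. [:coeff q j:] * [:0, 1:] ^ j)" by simp
      then show ?thesis by (simp only: to_fract_sum to_fract_mult to_fract_power P1_def)
    qed
    have "\<phi> X * to_fract den = to_fract num" using num_den by simp
    then have "(\<Sum>j\<le>N. \<phi> (c j) * X ^ j) = 0"
      using poly_eq[of num] poly_eq[of den]
      by (simp add: N_def c_def \<phi> left_diff_distrib sum_subtractf sum_distrib_left mult.assoc)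
    then have "\<phi> (c N) * X ^ N = - (\<Sum>j<N. \<phi> (c j) * X ^ j)"
      by (simp add: lessThan_Suc_atMost[symmetric] eq_neg_iff_add_eq_0 add.commute)
    moreover have cN: "c N \<noteq> 0"
    proof
      assume "c N = 0"
      then have eq: "X * P1 (coeff den N) = P1 (coeff num N)" by (simp add: c_def)
      show False
      proof (cases "coeff den N = 0")
        case True
        then have "coeff num N = 0" using eq by (simp add: P1_def)
        moreover have "num \<noteq> 0" using num_neq[of 0] by simp
        ultimately show False using True num_den(1) unfolding N_def
          by (metis leading_coeff_0_iff max_def)
      next
        case False
        then have "X = P1 (coeff num N / coeff den N)"
          using eq by (simp add: field_hom_simps[OF field_hom_P1] nonzero_eq_divide_eq)
        then show False using X_neq_const by blast
      qed
    qed
    ultimately have "X ^ N = \<phi> (- inverse (c N)) * (\<Sum>j<N. \<phi> (c j) * X ^ j)"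
      by (simp add: \<phi> field_simps)
    moreover have "(\<Sum>j<N. \<phi> (c j) * X ^ j) \<in> S"
      using base unfolding S_def by (intro V.span_sum V.span_scale) auto
    then have "\<phi> (- inverse (c N)) * (\<Sum>j<N. \<phi> (c j) * X ^ j) \<in> S"
      unfolding S_def by (rule V.span_scale)
    ultimately show ?thesis by (simp only:)
  qed
  have X_closed: "X * v \<in> S" if "v \<in> S" for v
    using that unfolding S_def
  proof (induction rule: V.span_induct_alt)
    case (step c x y)
    then obtain j where j: "j < N" "x = X ^ j" by auto
    have "X * x \<in> S"
    proof (cases "Suc j = N")
      case True
      then show ?thesis using SN j by (metis power_Suc)
    next
      case False
      then show ?thesis using base[of "Suc j"] j by simp
    qed
    then have "\<phi> c * (X * x) + X * y \<in> S" using step.IH unfolding S_def by (intro V.span_add V.span_scale) auto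
    then show ?case unfolding S_def by (simp only: distrib_left mult.left_commute[of X])
  qed (simp add: V.span_zero)
  have poly_closed: "to_fract q * v \<in> S" if "v \<in> S" for q v
    using that
  proof (induction q arbitrary: v)
    case (pCons a q)
    have "pCons a q = [:a:] + [:0, 1:] * q" by simp
    then have "to_fract (pCons a q) * v = \<phi> (P1 a) * v + X * (to_fract q * v)"
      by (simp only: to_fract_add to_fract_mult) (simp add: P1_def algebra_simps \<phi>_const[unfolded P1_def])
    then show ?case
      using pCons X_closed unfolding S_def by (metis V.span_add V.span_scale)
  qed (simp add: S_def V.span_zero)
  obtain r s where g: "g = to_fract r / to_fract s" "s \<noteq> 0" by (rule fract_cases_to_fract)
  let ?b = "\<lambda>j. to_fract s * X ^ j"
  have ind2: "\<forall>j\<in>{..<N}. u j = 0" if "(\<Sum>j\<in>{..<N}. \<phi> (u j) * ?b j) = 0" for u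
  proof -
    have "(\<Sum>j\<in>{..<N}. \<phi> (u j) * ?b j) = to_fract s * (\<Sum>j<N. \<phi> (u j) * X ^ j)"
      by (simp add: sum_distrib_left mult_ac)
    then show ?thesis using that g(2) powers_independent by simp
  qed
  have inj2: "inj_on ?b {..<N}" and indep2: "V.independent (?b ` {..<N})"
    using V.independent_familyI[of "{..<N}" ?b] ind2 by auto
  have "to_fract r \<in> V.span (?b ` {..<N})"
  proof (rule ccontr)
    assume nr: "to_fract r \<notin> V.span (?b ` {..<N})"
    have "to_fract r \<in> S" using poly_closed[of 1 r] base[of 0] N_pos by simp
    moreover have "?b j \<in> S" if "j < N" for j using poly_closed base that by blast
    ultimately have "insert (to_fract r) (?b ` {..<N}) \<subseteq> V.span ((\<lambda>j. X ^ j) ` {..<N})" unfolding S_def by auto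
    then have "card (insert (to_fract r) (?b ` {..<N})) \<le> card ((\<lambda>j. X ^ j) ` {..<N} :: 'k poly fract set)"
      using V.independent_span_bound[OF _ V.independent_insertI[OF nr indep2]] by blast
    moreover have "to_fract r \<notin> ?b ` {..<N}" by (rule contrapos_nn[OF nr V.span_base])
    ultimately show False using card_image[OF inj] card_image[OF inj2] by simp
  qed
  then obtain u where "to_fract r = (\<Sum>v\<in>?b ` {..<N}. \<phi> (u v) * v)"
    using V.span_finite[of "?b ` {..<N}"] by auto
  then have "to_fract r = (\<Sum>j<N. \<phi> (u (?b j)) * ?b j)" by (simp add: sum.reindex[OF inj2])
  also have "\<dots> = to_fract s * (\<Sum>j<N. \<phi> (u (?b j)) * X ^ j)"
    by (simp add: sum_distrib_left mult_ac)
  finally have "g = (\<Sum>j<N. \<phi> (u (?b j)) * X ^ j)" using g by simp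
  then show ?thesis by (rule exI[of _ "\<lambda>j. u (?b j)"])
qed

end

section \<open>Counting ramification\<close>

text \<open>An even nonnegative term is 0 or at least 2. Applied to the excess of the indices and to
  the numbers of branch points in the special fibers, each diminished by 1.\<close>

lemma sum_even_eq_2:
  fixes c :: "'o \<Rightarrow> int"
  assumes "finite T" "(\<Sum>a\<in>T. c a) = 2" "\<And>a. a \<in> T \<Longrightarrow> 0 \<le> c a" "\<And>a. a \<in> T \<Longrightarrow> even (c a)"
  shows "\<exists>a\<in>T. c a = 2 \<and> (\<forall>b\<in>T. b \<noteq> a \<longrightarrow> c b = 0)"
proof -
  obtain a where a: "a \<in> T" "c a \<noteq> 0" using assms(2) by (metis sum.neutral zero_neq_numeral)
  have ca: "2 \<le> c a" using a assms(3,4)[OF a(1)] by (auto elim!: evenE)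
  have "(\<Sum>b\<in>T. c b) = c a + (\<Sum>b\<in>T - {a}. c b)" using assms(1) a(1) by (rule sum.remove)
  moreover have "0 \<le> (\<Sum>b\<in>T - {a}. c b)" using assms(3) by (intro sum_nonneg) auto
  ultimately have "c a = 2" "(\<Sum>b\<in>T - {a}. c b) = 0" using assms(2) ca by linarith+
  then have "\<forall>b\<in>T - {a}. c b = 0"
    using sum_nonneg_eq_0_iff[of "T - {a}" c] assms(1,3) by simp
  then show ?thesis using a(1) \<open>c a = 2\<close> by blast
qed

text \<open>What the counting needs to know about \<open>\<phi>\<close>, stripped of algebra:
  \<open>S\<close> stands for the branch points of \<open>\<pi>\<^sub>E\<close>, \<open>B\<close>
  for those of \<open>\<pi>\<^sub>C\<close>.\<close>

locale branched_map =
  fixes f :: "'o \<Rightarrow> 'o" and e :: "'o \<Rightarrow> nat" and n :: nat and B S :: "'o set"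
  assumes e_pos: "0 < e a" and finite_fiber: "finite {a. f a = b}"
    and sum_fiber: "(\<Sum>a\<in>{a. f a = b}. e a) = n" and odd_n: "odd n"
    and finite_ramified: "finite {a. e a \<noteq> 1}"
    and hurwitz: "finite R \<Longrightarrow> {a. e a \<noteq> 1} \<subseteq> R \<Longrightarrow> (\<Sum>a\<in>R. int (e a) - 1) = 2 * int n - 2"
    and card_B: "card B = 6" and card_S: "card S = 4"
    and B_iff: "a \<in> B \<longleftrightarrow> f a \<in> S \<and> odd (e a)"
begin

text \<open>The least index that \<open>B_iff\<close> admits: over \<open>S\<close> and off
  \<open>B\<close> the index is even.\<close>

definition std :: "'o \<Rightarrow> nat" where "std a = (if f a \<in> S \<and> a \<notin> B then 2 else 1)"

lemma finite_S: "finite S" and finite_B: "finite B"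
  using card_S card_B by (auto intro: card_ge_0_finite)

text \<open>
  The excess of \<open>e\<close> over its least possible value is even over \<open>S\<close>; counted with weight \<open>2\<close> elsewhere
  it has total \<open>2\<close>, so exactly one point is exceptional.
\<close>

lemma ex_exceptional: "\<exists>a0. e a0 = std a0 + (if f a0 \<in> S then 2 else 1) \<and> (\<forall>a. a \<noteq> a0 \<longrightarrow> e a = std a)"
proof -
  define T' where "T' = (\<Union>s\<in>S. {a. f a = s})"
  define T where "T = T' \<union> {a. e a \<noteq> 1}"
  have finT': "finite T'" unfolding T'_def using finite_S finite_fiber by blast
  then have finT: "finite T" unfolding T_def using finite_ramified by blast
  have T': "a \<in> T' \<longleftrightarrow> f a \<in> S" for a by (auto simp: T'_def)
  have BT': "B \<subseteq> T'" using B_iff T' by blast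
  define c where "c a = (if f a \<in> S then int (e a) - int (std a) else 2 * (int (e a) - 1))" for a
  have std_le: "std a \<le> e a" for a
    using e_pos[of a] B_iff[of a] by (auto simp: std_def elim!: evenE)
  have "(\<Sum>a\<in>T'. int (e a)) = (\<Sum>s\<in>S. \<Sum>a\<in>{a. f a = s}. int (e a))"
    unfolding T'_def using finite_S finite_fiber by (intro sum.UNION_disjoint) auto
  also have "\<dots> = 4 * int n" by (simp add: sum_fiber card_S flip: of_nat_sum)
  finally have sumT': "(\<Sum>a\<in>T'. int (e a)) = 4 * int n" .
  \<comment> \<open>Over \<open>S\<close>, \<open>2 (e - 1)\<close> is the excess plus
    \<open>e\<close>, minus 1 on \<open>B\<close>. Summed up, 4 n - 4 equals the total excess plus 4
    n - 6.\<close>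
  have "2 * (\<Sum>a\<in>T. int (e a) - 1) = (\<Sum>a\<in>T. c a + (if a \<in> T' then int (e a) else 0) - (if a \<in> B then 1 else 0))"
    unfolding sum_distrib_left
  proof (rule sum.cong[OF refl])
    fix a
    show "2 * (int (e a) - 1) = c a + (if a \<in> T' then int (e a) else 0) - (if a \<in> B then 1 else 0)"
      using BT' by (auto simp: c_def std_def T')
  qed
  also have "\<dots> = (\<Sum>a\<in>T. c a) + (\<Sum>a\<in>T. if a \<in> T' then int (e a) else 0) - (\<Sum>a\<in>T. if a \<in> B then 1 else 0)"
    by (simp only: sum.distrib sum_subtractf)
  also have "(\<Sum>a\<in>T. if a \<in> T' then int (e a) else 0) = (\<Sum>a\<in>T'. int (e a))"
    using finT by (subst sum.inter_restrict[symmetric]) (auto simp: T_def Int_absorb1 intro!: sum.cong)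
  also have "(\<Sum>a\<in>T. if a \<in> B then 1 else 0 :: int) = (\<Sum>a\<in>B. 1)"
  proof -
    have "T \<inter> B = B" using BT' by (auto simp: T_def)
    then show ?thesis using finT by (subst sum.inter_restrict[symmetric]) simp_all
  qed
  finally have "(\<Sum>a\<in>T. c a) = 2"
    using hurwitz[OF finT] sumT' card_B by (simp add: T_def)
  moreover have "0 \<le> c a" for a using std_le[of a] e_pos[of a] by (auto simp: c_def)
  moreover have "even (c a)" for a using B_iff[of a] by (auto simp: c_def std_def)
  ultimately obtain a0 where a0: "c a0 = 2" "\<forall>b\<in>T. b \<noteq> a0 \<longrightarrow> c b = 0"
    using sum_even_eq_2[OF finT, of c] by blast
  have "e a = std a" if "a \<noteq> a0" for a
  proof (cases "a \<in> T")
    case True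
    then have "c a = 0" using a0(2) that by blast
    then show ?thesis by (auto simp: c_def std_def split: if_splits)
  next
    case False
    then show ?thesis using T' by (auto simp: T_def std_def)
  qed
  moreover have "e a0 = std a0 + (if f a0 \<in> S then 2 else 1)"
    using a0(1) by (auto simp: c_def std_def split: if_splits)
  ultimately show ?thesis by blast
qed

definition m :: "'o \<Rightarrow> nat" where "m s = card {a \<in> B. f a = s}"

lemma ex_triple_fiber: "\<exists>s4\<in>S. m s4 = 3 \<and> (\<forall>s\<in>S - {s4}. m s = 1)"
proof -
  \<comment> \<open>The sum of the indices in a fiber has the parity of the number of odd
    ones.\<close>
  have odd_m: "odd (m s)" if "s \<in> S" for s
  proof -
    have "{a \<in> B. f a = s} = {a \<in> {a. f a = s}. odd (e a)}" using that B_iff by auto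
    then show ?thesis
      using even_sum_iff[OF finite_fiber, of e s] odd_n by (simp add: m_def sum_fiber)
  qed
  have "B = (\<Union>s\<in>S. {a \<in> B. f a = s})" using B_iff by auto
  then have "card B = card (\<Union>s\<in>S. {a \<in> B. f a = s})" by simp
  also have "\<dots> = (\<Sum>s\<in>S. m s)"
    unfolding m_def using finite_S finite_B by (intro card_UN_disjoint) auto
  finally have "(\<Sum>s\<in>S. int (m s)) = 6" using card_B by (simp flip: of_nat_sum)
  then have "(\<Sum>s\<in>S. int (m s) - 1) = 2" by (simp add: sum_subtractf card_S)
  moreover have "0 \<le> int (m s) - 1" "even (int (m s) - 1)" if "s \<in> S" for s
    using odd_m[OF that] by (auto elim!: oddE)
  ultimately obtain s4 where "s4 \<in> S" "int (m s4) - 1 = 2" "\<forall>s\<in>S. s \<noteq> s4 \<longrightarrow> int (m s) - 1 = 0"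
    using sum_even_eq_2[OF finite_S, of "\<lambda>s. int (m s) - 1"] by blast
  then show ?thesis by (intro bexI[of _ s4]) auto
qed

definition ft :: "'o \<Rightarrow> nat multiset" where
  "ft b = image_mset e (mset_set {a. 1 < e a \<and> f a = b})"

text \<open>\<open>k\<close> counts the points over \<open>s\<close> that are neither exceptional
  nor in \<open>B\<close>, all of index 2. As \<open>m s\<close> counts points of \<open>B\<close>
  with weight 1, an exceptional one, of index 3, adds 2; off \<open>B\<close> the exceptional index
  is 4.\<close>

lemma
  assumes a0: "e a0 = std a0 + (if f a0 \<in> S then 2 else 1)" "\<forall>a. a \<noteq> a0 \<longrightarrow> e a = std a"
  shows ft_outside: "b \<notin> S \<Longrightarrow> ft b = (if f a0 = b then {#2#} else {#})"
    and ft_inside: "s \<in> S \<Longrightarrow> \<exists>k. ft s = (if f a0 = s then {#e a0#} else {#}) + replicate_mset k 2 \<and>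
      n = 2 * k + m s + (if f a0 = s then (if a0 \<in> B then 2 else 4) else 0)"
proof -
  show "ft b = (if f a0 = b then {#2#} else {#})" if "b \<notin> S"
  proof -
    have "{a. 1 < e a \<and> f a = b} = (if f a0 = b then {a0} else {})"
    proof (intro set_eqI iffI)
      fix a assume a: "a \<in> {a. 1 < e a \<and> f a = b}"
      have "a = a0"
      proof (rule ccontr)
        assume "a \<noteq> a0"
        then have "e a = 1" using a0(2) a that by (simp add: std_def)
        then show False using a by simp
      qed
      then show "a \<in> (if f a0 = b then {a0} else {})" using a by auto
    next
      fix a assume "a \<in> (if f a0 = b then {a0} else {})"
      then show "a \<in> {a. 1 < e a \<and> f a = b}" using that a0(1) by (simp add: std_def split: if_splits)
    qed
    then show ?thesis using that a0(1) by (simp add: ft_def std_def)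
  qed
  assume s: "s \<in> S"
  define A where "A = {a. f a = s} - {a0}"
  have finA: "finite A" unfolding A_def using finite_fiber by blast
  let ?K = "A - B" and ?Z = "if f a0 = s then {a0} else {}"
  have e0: "f a0 = s \<Longrightarrow> 1 < e a0" using a0(1) s by simp
  have eA: "e a = (if a \<in> B then 1 else 2)" if "a \<in> A" for a
    using a0(2)[rule_format, of a] that s by (auto simp: A_def std_def)
  have set: "{a. 1 < e a \<and> f a = s} = ?Z \<union> ?K"
  proof (intro set_eqI)
    fix a show "a \<in> {a. 1 < e a \<and> f a = s} \<longleftrightarrow> a \<in> ?Z \<union> ?K"
      using e0 eA[of a] by (cases "a = a0") (auto simp: A_def)
  qed
  have "mset_set (?Z \<union> ?K) = mset_set ?Z + mset_set ?K"
    using finA by (intro mset_set_Union) (auto simp: A_def)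
  moreover have "image_mset e (mset_set ?K) = replicate_mset (card ?K) 2"
  proof -
    have "image_mset e (mset_set ?K) = image_mset (\<lambda>_. 2) (mset_set ?K)"
      using eA finA by (intro image_mset_cong) auto
    then show ?thesis by (simp add: image_mset_const_eq)
  qed
  ultimately have ft: "ft s = (if f a0 = s then {#e a0#} else {#}) + replicate_mset (card ?K) 2"
    unfolding ft_def set by simp
  have "{a. f a = s} = ?Z \<union> A" by (auto simp: A_def)
  then have "n = (\<Sum>a\<in>?Z \<union> A. e a)" using sum_fiber[of s] by simp
  also have "\<dots> = (\<Sum>a\<in>?Z. e a) + (\<Sum>a\<in>A. e a)" using finA by (intro sum.union_disjoint) (auto simp: A_def)
  also have "(\<Sum>a\<in>A. e a) = (\<Sum>a\<in>A \<inter> B. e a) + (\<Sum>a\<in>?K. e a)" using finA by (rule sum.Int_Diff)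
  also have "(\<Sum>a\<in>A \<inter> B. e a) = card (A \<inter> B)" using eA by simp
  also have "(\<Sum>a\<in>?K. e a) = 2 * card ?K" using eA by simp
  finally have n: "n = (\<Sum>a\<in>?Z. e a) + card (A \<inter> B) + 2 * card ?K" by simp
  have "{a \<in> B. f a = s} = (if f a0 = s \<and> a0 \<in> B then insert a0 (A \<inter> B) else A \<inter> B)"
    by (auto simp: A_def)
  then have "m s = card (A \<inter> B) + (if f a0 = s \<and> a0 \<in> B then 1 else 0)"
    unfolding m_def using finA by (simp add: A_def)
  then have "n = 2 * card ?K + m s + (if f a0 = s then (if a0 \<in> B then 2 else 4) else 0)"
    using n a0(1) s by (auto simp: std_def)
  then show "\<exists>k. ft s = (if f a0 = s then {#e a0#} else {#}) + replicate_mset k 2 \<and>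
      n = 2 * k + m s + (if f a0 = s then (if a0 \<in> B then 2 else 4) else 0)"
    using ft by blast
qed

lemma enumerate_S:
  assumes "s \<in> S" "s' \<in> S" "s \<noteq> s'"
  shows "\<exists>x y. distinct [x, y, s, s'] \<and> set [x, y, s, s'] = S"
proof -
  have "card (S - {s, s'}) = 2" using assms card_S finite_S by (simp add: card_Diff_subset)
  then obtain x y where "S - {s, s'} = {x, y}" "x \<noteq> y" by (auto simp: card_2_iff)
  moreover from this have "x \<in> S - {s, s'}" "y \<in> S - {s, s'}" by simp_all
  moreover have "S = (S - {s, s'}) \<union> {s, s'}" using assms by blast
  ultimately have "S = {x, y, s, s'}" "x \<notin> {s, s'}" "y \<notin> {s, s'}" by auto
  then show ?thesis using assms(3) \<open>x \<noteq> y\<close> by (intro exI[of _ x] exI[of _ y]) simp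
qed

definition structured :: "nat multiset list \<Rightarrow> nat multiset list \<Rightarrow> bool" where
  "structured Ms Ns \<longleftrightarrow> (\<exists>xs ys. distinct (xs @ ys) \<and> set xs = S \<and> map ft xs = Ms \<and> map ft ys = Ns \<and>
    (\<forall>b. b \<notin> set (xs @ ys) \<longrightarrow> ft b = {#}))"

lemma structuredI:
  assumes "distinct (xs @ ys)" "set xs = S" "map ft xs = Ms" "map ft ys = Ns"
    "\<And>b. b \<notin> S \<Longrightarrow> b \<notin> set ys \<Longrightarrow> ft b = {#}"
  shows "structured Ms Ns"
  unfolding structured_def using assms by (intro exI[of _ xs] exI[of _ ys]) simp

text \<open>A special fiber with 1 or 3 branch points leaves n - 1 or n - 3 to be filled by points
  of index 2; an exceptional point reduces this by 4, or by 2 if it is a branch point. The bounds on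
  \<open>n\<close> say that the rest is not negative. Four entries \<open>h\<close> cannot arise,
  since they would leave only four points of odd index over \<open>S\<close>.\<close>

lemma classification:
  assumes a0: "e a0 = std a0 + (if f a0 \<in> S then 2 else 1)" "\<forall>a. a \<noteq> a0 \<longrightarrow> e a = std a"
  defines "h \<equiv> entry 2 ((n - 1) div 2)"
  shows "f a0 \<notin> S \<Longrightarrow> n \<ge> 3 \<and> structured [h, h, h, entry 2 ((n - 3) div 2)] [entry 2 1]"
    and "f a0 \<in> S \<Longrightarrow> a0 \<notin> B \<Longrightarrow> n \<ge> 7 \<and> structured [h, h, h, entry 4 1 + entry 2 ((n - 7) div 2)] [] \<or>
      n \<ge> 5 \<and> structured [h, h, entry 4 1 + entry 2 ((n - 5) div 2), entry 2 ((n - 3) div 2)] []"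
    and "a0 \<in> B \<Longrightarrow> n \<ge> 5 \<and> structured [h, h, h, entry 3 1 + entry 2 ((n - 5) div 2)] [] \<or>
      n \<ge> 3 \<and> structured [h, h, entry 3 1 + entry 2 ((n - 3) div 2), entry 2 ((n - 3) div 2)] []"
proof -
  obtain s4 where s4: "s4 \<in> S" "m s4 = 3" "\<And>s. s \<in> S \<Longrightarrow> s \<noteq> s4 \<Longrightarrow> m s = 1"
    using ex_triple_fiber by blast
  note out = ft_outside[OF a0] and ins = ft_inside[OF a0]
  have h: "ft s = h" if "s \<in> S" "s \<noteq> s4" "s \<noteq> f a0" for s
    using ins[OF that(1)] s4(3)[OF that(1,2)] that(3) by (auto simp: h_def)
  have t: "n \<ge> 3 \<and> ft s4 = entry 2 ((n - 3) div 2)" if "f a0 \<noteq> s4"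
    using ins[OF s4(1)] s4(2) that by auto
  obtain s where s: "s \<in> S" "s \<noteq> s4"
  proof -
    have "S \<noteq> {s4}" using card_S by auto
    then show ?thesis using that s4(1) by blast
  qed
  have x: "\<exists>x y z. distinct [x, y, z, s4] \<and> set [x, y, z, s4] = S" using enumerate_S[OF s(1) s4(1) s(2)] by blast
  {
    assume f: "f a0 \<notin> S"
    obtain x y z where xyz: "distinct [x, y, z, s4]" "set [x, y, z, s4] = S" using x by blast
    have "f a0 \<noteq> s4" using f s4(1) by blast
    have eq: "ft x = h" "ft y = h" "ft z = h"
      using xyz f by (auto intro!: h)
    have "structured [h, h, h, entry 2 ((n - 3) div 2)] [entry 2 1]"
    proof (rule structuredI[of "[x, y, z, s4]" "[f a0]"])
      show "distinct ([x, y, z, s4] @ [f a0])" using xyz f by auto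
      show "set [x, y, z, s4] = S" by (fact xyz(2))
      show "map ft [x, y, z, s4] = [h, h, h, entry 2 ((n - 3) div 2)]"
        using t[OF \<open>f a0 \<noteq> s4\<close>] by (simp add: eq)
      show "map ft [f a0] = [entry 2 1]" using out[OF f] by simp
      show "ft b = {#}" if "b \<notin> S" "b \<notin> set [f a0]" for b using out[OF that(1)] that(2) by auto
    qed
    then show "n \<ge> 3 \<and> structured [h, h, h, entry 2 ((n - 3) div 2)] [entry 2 1]"
      using t[OF \<open>f a0 \<noteq> s4\<close>] by blast
  }
  have last: "structured [h, h, h, ft s4] []" if "f a0 = s4"
  proof -
    obtain x y z where xyz: "distinct [x, y, z, s4]" "set [x, y, z, s4] = S" using x by blast
    have eq: "ft x = h" "ft y = h" "ft z = h" using xyz that by (auto intro!: h)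
    show ?thesis
    proof (rule structuredI[of "[x, y, z, s4]" "[]"])
      show "ft b = {#}" if "b \<notin> S" for b using out[OF that] that \<open>f a0 = s4\<close> s4(1) by auto
    qed (use xyz in \<open>simp_all add: eq\<close>)
  qed
  have third: "n \<ge> 3 \<and> structured [h, h, ft (f a0), entry 2 ((n - 3) div 2)] []" if f: "f a0 \<in> S" "f a0 \<noteq> s4"
  proof -
    obtain x y where xy: "distinct [x, y, f a0, s4]" "set [x, y, f a0, s4] = S"
      using enumerate_S[OF f(1) s4(1) f(2)] by blast
    have eq: "ft x = h" "ft y = h" using xy by (auto intro!: h)
    have "structured [h, h, ft (f a0), entry 2 ((n - 3) div 2)] []"
    proof (rule structuredI[of "[x, y, f a0, s4]" "[]"])
      show "ft b = {#}" if "b \<notin> S" for b using out[OF that] that f by auto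
    qed (use xy t[OF f(2)] in \<open>simp_all add: eq\<close>)
    then show ?thesis using t[OF f(2)] by blast
  qed
  {
    assume f: "f a0 \<in> S" "a0 \<notin> B"
    have e0: "e a0 = 4" using a0(1) f by (simp add: std_def)
    show "n \<ge> 7 \<and> structured [h, h, h, entry 4 1 + entry 2 ((n - 7) div 2)] [] \<or>
      n \<ge> 5 \<and> structured [h, h, entry 4 1 + entry 2 ((n - 5) div 2), entry 2 ((n - 3) div 2)] []"
    proof (cases "f a0 = s4")
      case True
      obtain k where k: "ft s4 = {#4#} + replicate_mset k 2" "n = 2 * k + 7"
        using ins[OF s4(1)] True f(2) s4(2) e0 by auto
      then have "ft s4 = entry 4 1 + entry 2 ((n - 7) div 2)" by simp
      then show ?thesis using last[OF True] k(2) by auto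
    next
      case False
      obtain k where k: "ft (f a0) = {#4#} + replicate_mset k 2" "n = 2 * k + 5"
        using ins[OF f(1)] False f s4(3) e0 by auto
      then have "ft (f a0) = entry 4 1 + entry 2 ((n - 5) div 2)" by simp
      then show ?thesis using third[OF f(1) False] k(2) by auto
    qed
  }
  {
    assume B: "a0 \<in> B"
    have f: "f a0 \<in> S" using B B_iff by blast
    have e0: "e a0 = 3" using a0(1) f B by (simp add: std_def)
    show "n \<ge> 5 \<and> structured [h, h, h, entry 3 1 + entry 2 ((n - 5) div 2)] [] \<or>
      n \<ge> 3 \<and> structured [h, h, entry 3 1 + entry 2 ((n - 3) div 2), entry 2 ((n - 3) div 2)] []"
    proof (cases "f a0 = s4")
      case True
      obtain k where k: "ft s4 = {#3#} + replicate_mset k 2" "n = 2 * k + 5"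
        using ins[OF s4(1)] True B s4(2) e0 by auto
      then have "ft s4 = entry 3 1 + entry 2 ((n - 5) div 2)" by simp
      then show ?thesis using last[OF True] k(2) by auto
    next
      case False
      obtain k where k: "ft (f a0) = {#3#} + replicate_mset k 2" "n = 2 * k + 3"
        using ins[OF f] False f B s4(3) e0 by auto
      then have "ft (f a0) = entry 3 1 + entry 2 ((n - 3) div 2)" by simp
      then show ?thesis using third[OF f False] k(2) by auto
    qed
  }
qed

end

text \<open>Three elements with a common image lie in one fiber, and only the fiber over
  \<open>t4\<close> has more than one element; this forces the partition.\<close>

lemma ex1_partition_3_3:
  assumes "card W = 6" "card {P \<in> W. g P = t4} = 3" "\<And>t. t \<noteq> t4 \<Longrightarrow> card {P \<in> W. g P = t} \<le> 1"
  shows "\<exists>!(W1, W2). W1 \<union> W2 = W \<and> W1 \<inter> W2 = {} \<and> card W1 = 3 \<and> card W2 = 3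
         \<and> card (g ` W1) = 1 \<and> card (g ` W2) = 3"
proof -
  have fin: "finite W" using assms(1) by (auto intro: card_ge_0_finite)
  let ?W1 = "{P \<in> W. g P = t4}" and ?W2 = "{P \<in> W. g P \<noteq> t4}"
  have W: "?W1 \<union> ?W2 = W" "?W1 \<inter> ?W2 = {}" by auto
  have "card ?W1 + card ?W2 = 6"
    using card_Un_disjoint[of ?W1 ?W2] W fin assms(1) by simp
  then have c2: "card ?W2 = 3" using assms(2) by simp
  have "?W1 \<noteq> {}" using assms(2) by (metis card.empty zero_neq_numeral)
  then have "g ` ?W1 = {t4}" by auto
  then have c1: "card (g ` ?W1) = 1" by simp
  have "inj_on g ?W2"
  proof (rule inj_onI)
    fix P Q assume PQ: "P \<in> ?W2" "Q \<in> ?W2" "g P = g Q"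
    then have "card {R \<in> W. g R = g P} \<le> Suc 0" using assms(3)[of "g P"] by simp
    then show "P = Q" using PQ fin card_le_Suc0_iff_eq[of "{R \<in> W. g R = g P}"] by auto
  qed
  then have "card (g ` ?W2) = 3" using c2 by (simp add: card_image)
  then have ex: "?W1 \<union> ?W2 = W \<and> ?W1 \<inter> ?W2 = {} \<and> card ?W1 = 3 \<and> card ?W2 = 3
         \<and> card (g ` ?W1) = 1 \<and> card (g ` ?W2) = 3" using W c1 c2 assms(2) by blast
  have uniq: "U1 = ?W1 \<and> U2 = ?W2" if U: "U1 \<union> U2 = W" "U1 \<inter> U2 = {}" "card U1 = 3" "card (g ` U1) = 1" for U1 U2
  proof -
    obtain t where t: "g ` U1 = {t}" using U(4) by (auto simp: card_1_singleton_iff)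
    have sub: "U1 \<subseteq> {P \<in> W. g P = t}" using t U(1) by auto
    then have "3 \<le> card {P \<in> W. g P = t}" using U(3) fin card_mono[of "{P \<in> W. g P = t}" U1] by simp
    then have "t = t4" using assms(3)[of t] by fastforce
    then have "U1 = ?W1" using sub fin assms(2) U(3) by (intro card_subset_eq) auto
    then show ?thesis using U(1,2) by auto
  qed
  show ?thesis
  proof (rule ex1I[of _ "(?W1, ?W2)"])
    show "case (?W1, ?W2) of (W1, W2) \<Rightarrow> W1 \<union> W2 = W \<and> W1 \<inter> W2 = {} \<and> card W1 = 3 \<and> card W2 = 3
         \<and> card (g ` W1) = 1 \<and> card (g ` W2) = 3" unfolding prod.case by (rule ex)
  next
    fix U :: "'a set \<times> 'a set"
    assume "case U of (W1, W2) \<Rightarrow> W1 \<union> W2 = W \<and> W1 \<inter> W2 = {} \<and> card W1 = 3 \<and> card W2 = 3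
         \<and> card (g ` W1) = 1 \<and> card (g ` W2) = 3"
    then show "U = (?W1, ?W2)" using uniq[of "fst U" "snd U"] by (cases U) auto
  qed
qed

section \<open>The induced covering\<close>

text \<open>Composition of comorphisms is reversed: on points, the last two assumptions say that the
  covering maps conjugate points to opposite ones and that the square with the two quotient maps
  commutes.\<close>

locale induced_covering =
  C: double_cover C w \<pi>\<^sub>C y\<^sub>C F\<^sub>C + E: double_cover E neg \<pi>\<^sub>E y\<^sub>E F\<^sub>E + M: P1_map \<phi>
  for C :: "'k::{alg_closed_field, field_char_0} \<Rightarrow> 'c::field" and w \<pi>\<^sub>C y\<^sub>C F\<^sub>C
    and E :: "'k \<Rightarrow> 'e::field" and neg \<pi>\<^sub>E y\<^sub>E F\<^sub>E
    and \<phi> :: "'k poly fract \<Rightarrow> 'k poly fract" +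
  fixes \<psi> :: "'e \<Rightarrow> 'c"
  assumes cov_\<psi>: "covering C E \<psi>" and w_\<psi>: "w \<circ> \<psi> = \<psi> \<circ> neg" and \<pi>_\<phi>: "\<pi>\<^sub>C \<circ> \<phi> = \<psi> \<circ> \<pi>\<^sub>E"
begin

lemma \<psi>_hom: "field_hom \<psi>"
  using cov_\<psi> by (simp add: covering_def)

lemmas \<psi> = field_hom_simps[OF \<psi>_hom]

lemma \<psi>_\<pi>: "\<psi> (\<pi>\<^sub>E z) = \<pi>\<^sub>C (\<phi> z)" and w_\<psi>_apply: "w (\<psi> u) = \<psi> (neg u)"
  using fun_cong[OF \<pi>_\<phi>, of z] fun_cong[OF w_\<psi>, of u] by simp_all

text \<open>\<open>\<psi> y\<^sub>E\<close> is anti-invariant under \<open>w\<close>, hence a multiple of \<open>y\<^sub>C\<close>.\<close>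

lemma ex_\<psi>_y: "\<exists>r. r \<noteq> 0 \<and> \<psi> y\<^sub>E = \<pi>\<^sub>C r * y\<^sub>C \<and> \<phi> (to_fract F\<^sub>E) = r * r * to_fract F\<^sub>C"
proof -
  define r where "r = C.im (\<psi> y\<^sub>E)"
  have "w (\<psi> y\<^sub>E) = - \<psi> y\<^sub>E" by (simp add: w_\<psi>_apply E.w_y \<psi>)
  then have "\<pi>\<^sub>C (C.re (\<psi> y\<^sub>E)) = 0" unfolding C.p_re by simp
  then have y: "\<psi> y\<^sub>E = \<pi>\<^sub>C r * y\<^sub>C" using C.re_im[of "\<psi> y\<^sub>E"] by (simp add: r_def)
  have "\<pi>\<^sub>C (\<phi> (to_fract F\<^sub>E)) = \<psi> y\<^sub>E * \<psi> y\<^sub>E"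
    by (simp add: \<psi>(6)[symmetric] E.y_sq \<psi>_\<pi>)
  also have "\<dots> = \<pi>\<^sub>C (r * r * to_fract F\<^sub>C)" by (simp add: y C.p C.y_sq[symmetric])
  finally have eq: "\<phi> (to_fract F\<^sub>E) = r * r * to_fract F\<^sub>C" by (simp only: C.p(11))
  have "\<psi> y\<^sub>E \<noteq> 0" using E.y_neq_0 by (simp add: \<psi>)
  then have "r \<noteq> 0" using y by (auto simp: C.p)
  then show ?thesis using y eq by blast
qed

lemma branch_iff: "a \<in> C.branch \<longleftrightarrow> M.f a \<in> E.branch \<and> odd (M.e a)"
proof -
  obtain r where r: "r \<noteq> 0" "\<phi> (to_fract F\<^sub>E) = r * r * to_fract F\<^sub>C" using ex_\<psi>_y by blast
  have "int (M.e a) * pt (M.f a) (to_fract F\<^sub>E) = 2 * pt a r + pt a (to_fract F\<^sub>C)"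
    using r C.F_neq_0 unfolding M.pt_\<phi>[symmetric] by (simp add: valuation.val_mult[OF valuation_pt])
  then have "odd (pt a (to_fract F\<^sub>C)) \<longleftrightarrow> odd (int (M.e a) * pt (M.f a) (to_fract F\<^sub>E))" by presburger
  then show ?thesis by (auto simp: C.branch_def E.branch_def)
qed

text \<open>The powers of \<open>X\<close> that form a basis of k(X) over the image of
  \<open>\<phi>\<close> also form one of K(C) over that of \<open>\<psi>\<close>: as
  \<open>y\<^sub>E\<close> goes to a multiple of \<open>y\<^sub>C\<close>, a combination splits into
  its parts along 1 and \<open>y\<^sub>C\<close>.\<close>

lemma map_degree_\<psi>: "map_degree \<psi> = M.N"
proof -
  interpret V: vector_space "\<lambda>c z. \<psi> c * z"
    by unfold_locales (simp_all add: \<psi> algebra_simps)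
  obtain r where r: "r \<noteq> 0" "\<psi> y\<^sub>E = \<pi>\<^sub>C r * y\<^sub>C" using ex_\<psi>_y by blast
  define b where "b j = \<pi>\<^sub>C (X ^ j)" for j
  have comb: "(\<Sum>j<M.N. \<psi> (\<pi>\<^sub>E (\<alpha> j) + \<pi>\<^sub>E (\<beta> j) * y\<^sub>E) * b j) =
      \<pi>\<^sub>C (\<Sum>j<M.N. \<phi> (\<alpha> j) * X ^ j) + \<pi>\<^sub>C (r * (\<Sum>j<M.N. \<phi> (\<beta> j) * X ^ j)) * y\<^sub>C" for \<alpha> \<beta>
    unfolding sum_distrib_left C.p(12) sum_distrib_right sum.distrib[symmetric]
    by (intro sum.cong refl) (simp add: b_def \<psi> \<psi>_\<pi> r C.p algebra_simps)
  have indep: "\<forall>j\<in>{..<M.N}. c j = 0" if "(\<Sum>j<M.N. \<psi> (c j) * b j) = 0" for c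
  proof -
    have "(\<Sum>j<M.N. \<psi> (c j) * b j) = (\<Sum>j<M.N. \<psi> (\<pi>\<^sub>E (E.re (c j)) + \<pi>\<^sub>E (E.im (c j)) * y\<^sub>E) * b j)"
      by (simp only: E.re_im[symmetric])
    then have eq: "\<pi>\<^sub>C (\<Sum>j<M.N. \<phi> (E.re (c j)) * X ^ j) + \<pi>\<^sub>C (r * (\<Sum>j<M.N. \<phi> (E.im (c j)) * X ^ j)) * y\<^sub>C = 0"
      using that unfolding comb by simp
    have "(\<Sum>j<M.N. \<phi> (E.re (c j)) * X ^ j) = 0" "r * (\<Sum>j<M.N. \<phi> (E.im (c j)) * X ^ j) = 0"
      using C.re_im_unique[of "\<Sum>j<M.N. \<phi> (E.re (c j)) * X ^ j" "r * (\<Sum>j<M.N. \<phi> (E.im (c j)) * X ^ j)"]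
        C.re_im_p[of 0] unfolding eq C.p(1) by (simp_all only:)
    then have zero: "E.re (c j) = 0" "E.im (c j) = 0" if "j < M.N" for j
      using M.powers_independent that r(1) by auto
    show ?thesis
    proof
      fix j assume "j \<in> {..<M.N}"
      have "c j = \<pi>\<^sub>E (E.re (c j)) + \<pi>\<^sub>E (E.im (c j)) * y\<^sub>E" by (rule E.re_im)
      also have "\<dots> = 0" using zero[of j] \<open>j \<in> _\<close> by (simp add: E.p)
      finally show "c j = 0" .
    qed
  qed
  have inj: "inj_on b {..<M.N}" and ind: "V.independent (b ` {..<M.N})"
    using V.independent_familyI[of "{..<M.N}" b] indep by auto
  have "z \<in> V.span (b ` {..<M.N})" for z
  proof -
    obtain \<alpha> where \<alpha>: "C.re z = (\<Sum>j<M.N. \<phi> (\<alpha> j) * X ^ j)" using M.powers_span by blast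
    \<comment> \<open>Dividing by \<open>r\<close> beforehand compensates the factor in
      \<open>\<psi> y\<^sub>E = \<pi>\<^sub>C r * y\<^sub>C\<close>.\<close>
    obtain \<beta> where \<beta>: "C.im z / r = (\<Sum>j<M.N. \<phi> (\<beta> j) * X ^ j)" using M.powers_span by blast
    have "r * (\<Sum>j<M.N. \<phi> (\<beta> j) * X ^ j) = C.im z" unfolding \<beta>[symmetric] using r(1) by simp
    then have "z = (\<Sum>j<M.N. \<psi> (\<pi>\<^sub>E (\<alpha> j) + \<pi>\<^sub>E (\<beta> j) * y\<^sub>E) * b j)"
      unfolding comb \<alpha>[symmetric] using C.re_im[of z] by simp
    then show ?thesis by (simp only:) (intro V.span_sum V.span_scale V.span_base imageI)
  qed
  then have "V.dim UNIV = card (b ` {..<M.N})"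
    using V.basis_card_eq_dim[of "b ` {..<M.N}" UNIV] ind by (simp add: subset_iff)
  then show ?thesis unfolding map_degree_def using card_image[OF inj] by simp
qed

text \<open>Restricting \<open>P\<close> to k(X) along both ways around the square gives multiples
  of two points of the line. These must coincide, and comparing the factors shows that indices
  multiply.\<close>

lemma \<psi>_point:
  assumes "P \<in> C.fiber a"
  shows "image_point \<psi> P \<in> E.fiber (M.f a)"
    "ram_index \<psi> P * (if M.f a \<in> E.branch then 2 else 1) = (if a \<in> C.branch then 2 else 1) * M.e a"
    "P (\<psi> u) = int (ram_index \<psi> P) * image_point \<psi> P u"
proof -
  have P: "P (\<psi> (\<pi>\<^sub>E z)) = int ((if a \<in> C.branch then 2 else 1) * M.e a) * pt (M.f a) z" for z
    unfolding \<psi>_\<pi> C.fiber_val[OF assms] M.pt_\<phi> by simp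
  obtain t where t: "pt (M.f a) t = 1" using ex_uniformizer by blast
  have "P (\<psi> (\<pi>\<^sub>E t)) \<noteq> 0" unfolding P t using M.e_pos[of a] by simp
  note r = restrict_point_ex[OF C.fiber_point[OF assms] cov_\<psi> this]
  show "P (\<psi> u) = int (ram_index \<psi> P) * image_point \<psi> P u" by (rule r(3))
  obtain b where b: "image_point \<psi> P \<in> E.fiber b" by (rule E.fiberE[OF r(1)])
  let ?d = "ram_index \<psi> P * (if b \<in> E.branch then 2 else 1)" and ?d' = "(if a \<in> C.branch then 2 else 1) * M.e a"
  have eq: "int ?d * pt b z = int ?d' * pt (M.f a) z" for z
    using r(3)[of "\<pi>\<^sub>E z"] unfolding P E.fiber_val[OF b] by simp
  have "pt b = pt (M.f a)"
    by (rule proportional_points_eq[OF pt_point pt_point eq]) (use r(2) M.e_pos[of a] in auto)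
  then have ba: "b = M.f a" by (simp add: pt_inj)
  then show "image_point \<psi> P \<in> E.fiber (M.f a)" using b by simp
  have "int ?d = int ?d'" using eq[of t] t ba by simp
  then show "ram_index \<psi> P * (if M.f a \<in> E.branch then 2 else 1) = ?d'"
    unfolding ba by (simp only: of_nat_eq_iff)
qed

text \<open>Conjugate points go to opposite points; this separates Case I from Case II.\<close>

lemma image_\<psi>_w:
  assumes "P \<in> C.fiber a"
  shows "image_point \<psi> (\<lambda>z. P (w z)) = (\<lambda>z. image_point \<psi> P (neg z))"
proof (rule restrict_point(2))
  show "P (w (\<psi> u)) = int (ram_index \<psi> P) * image_point \<psi> P (neg u)" for u
    unfolding w_\<psi>_apply by (rule \<psi>_point(3)[OF assms])
  show "(\<lambda>z. image_point \<psi> P (neg z)) \<in> points E"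
    using E.fiber_point[OF E.fiber_w[OF \<psi>_point(1)[OF assms]]] .
  show "0 < ram_index \<psi> P"
    using \<psi>_point(2)[OF assms] M.e_pos[of a] by (auto intro!: Nat.gr0I split: if_splits)
qed

lemma fiber_type_\<phi>: "fiber_type P1 \<phi> (pt b) = image_mset M.e (mset_set {a. 1 < M.e a \<and> M.f a = b})"
proof -
  have "{P \<in> ram_points P1 \<phi>. image_point \<phi> P = pt b} = pt ` {a. 1 < M.e a \<and> M.f a = b}"
    by (auto simp: ram_points_def points_P1 M.image_pt pt_inj M.e_def)
  moreover have "mset_set (pt ` {a. 1 < M.e a \<and> M.f a = b}) = image_mset pt (mset_set {a. 1 < M.e a \<and> M.f a = b})"
    by (rule image_mset_mset_set[symmetric]) (auto simp: inj_on_def pt_inj)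
  moreover have "M.e = ram_index \<phi> \<circ> pt" by (rule ext) (simp add: M.e_def)
  ultimately show ?thesis unfolding fiber_type_def by (simp only: multiset.map_comp)
qed

end

section \<open>The ramification of \<psi> read off from that of \<phi>\<close>

theorem theorem1:
  fixes C :: "'k::{alg_closed_field, field_char_0} \<Rightarrow> 'c::field"
    and E :: "'k \<Rightarrow> 'e::field"
    and O\<^sub>E :: "'e \<Rightarrow> int"
    and w :: "'c \<Rightarrow> 'c" and neg :: "'e \<Rightarrow> 'e"
    and \<pi>\<^sub>C :: "'k poly fract \<Rightarrow> 'c" and \<pi>\<^sub>E :: "'k poly fract \<Rightarrow> 'e"
    and \<psi> :: "'e \<Rightarrow> 'c" and \<phi> :: "'k poly fract \<Rightarrow> 'k poly fract"
    and n :: nat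
  assumes "curve_of_genus 2 C"
    and "curve_of_genus 1 E" and "O\<^sub>E \<in> points E"
    and "covering C E \<psi>" and "map_degree \<psi> = n" and "odd n"
    and "P1_quotient C w \<pi>\<^sub>C"
    and "is_negation E O\<^sub>E neg" and "P1_quotient E neg \<pi>\<^sub>E"
    and "w \<circ> \<psi> = \<psi> \<circ> neg"
    and "covering P1 P1 \<phi>" and "\<pi>\<^sub>C \<circ> \<phi> = \<psi> \<circ> \<pi>\<^sub>E"
  defines "W \<equiv> weierstrass_points 2 C"
    and "S \<equiv> image_point \<pi>\<^sub>E ` two_torsion E O\<^sub>E"
    and "\<phi>pt \<equiv> (\<lambda>P. image_point \<phi> (image_point \<pi>\<^sub>C P))"
  shows "card W = 6 \<and> card S = 4
    \<and> (\<exists>!(W1, W2). W1 \<union> W2 = W \<and> W1 \<inter> W2 = {} \<and> card W1 = 3 \<and> card W2 = 3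
         \<and> card (\<phi>pt ` W1) = 1 \<and> card (\<phi>pt ` W2) = 3)
    \<and> (
        \<comment> \<open>Case I\<close>
        (\<exists>P Q. P \<noteq> Q \<and> ram_points C \<psi> = {P, Q} \<and> ram_index \<psi> P = 2 \<and> ram_index \<psi> Q = 2
           \<and> image_point \<psi> P \<noteq> image_point \<psi> Q)
        \<and> n \<ge> 3
        \<and> ram_structure P1 P1 \<phi> S
            [entry 2 ((n - 1) div 2), entry 2 ((n - 1) div 2), entry 2 ((n - 1) div 2),
             entry 2 ((n - 3) div 2)]
            [entry 2 1]
      \<or> \<comment> \<open>Case II\<close>
        (\<exists>P Q. P \<noteq> Q \<and> ram_points C \<psi> = {P, Q} \<and> ram_index \<psi> P = 2 \<and> ram_index \<psi> Q = 2
           \<and> image_point \<psi> P = image_point \<psi> Q)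
        \<and> (n \<ge> 7 \<and> ram_structure P1 P1 \<phi> S
              [entry 2 ((n - 1) div 2), entry 2 ((n - 1) div 2), entry 2 ((n - 1) div 2),
               entry 4 1 + entry 2 ((n - 7) div 2)] []
           \<or> ram_structure P1 P1 \<phi> S
              [entry 2 ((n - 1) div 2), entry 2 ((n - 1) div 2), entry 2 ((n - 1) div 2),
               entry 2 ((n - 1) div 2)] []
           \<or> n \<ge> 5 \<and> ram_structure P1 P1 \<phi> S
              [entry 2 ((n - 1) div 2), entry 2 ((n - 1) div 2),
               entry 4 1 + entry 2 ((n - 5) div 2), entry 2 ((n - 3) div 2)] [])
      \<or> \<comment> \<open>Case III\<close>
        (\<exists>P. ram_points C \<psi> = {P} \<and> ram_index \<psi> P = 3)
        \<and> (n \<ge> 5 \<and> ram_structure P1 P1 \<phi> S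
              [entry 2 ((n - 1) div 2), entry 2 ((n - 1) div 2), entry 2 ((n - 1) div 2),
               entry 3 1 + entry 2 ((n - 5) div 2)] []
           \<or> n \<ge> 3 \<and> ram_structure P1 P1 \<phi> S
              [entry 2 ((n - 1) div 2), entry 2 ((n - 1) div 2),
               entry 3 1 + entry 2 ((n - 3) div 2), entry 2 ((n - 3) div 2)] []))"
proof -
  obtain y\<^sub>C F\<^sub>C where "double_cover C w \<pi>\<^sub>C y\<^sub>C F\<^sub>C" using ex_double_cover[OF assms(7)] by blast
  moreover obtain y\<^sub>E F\<^sub>E where "double_cover E neg \<pi>\<^sub>E y\<^sub>E F\<^sub>E" using ex_double_cover[OF assms(9)] by blast
  ultimately interpret induced_covering C w \<pi>\<^sub>C y\<^sub>C F\<^sub>C E neg \<pi>\<^sub>E y\<^sub>E F\<^sub>E \<phi> \<psi>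
    using assms(4,10,11,12)
    by (simp add: induced_covering_def induced_covering_axioms_def P1_map_def)
  have hC: "C.half_branch = 3" and hE: "E.half_branch = 2"
    using C.genus_half_branch[of 2] E.genus_half_branch[of 1] assms(1,2) by (simp_all add: curve_of_genus_def)
  have n: "M.N = n" using map_degree_\<psi> assms(5) by simp
  interpret R: branched_map M.f M.e n C.branch E.branch
  proof
    show "card C.branch = 6" "card E.branch = 4" by (simp_all add: C.card_branch E.card_branch hC hE)
    show "a \<in> C.branch \<longleftrightarrow> M.f a \<in> E.branch \<and> odd (M.e a)" for a by (rule branch_iff)
    show "(\<Sum>a\<in>R. int (M.e a) - 1) = 2 * int n - 2" if "finite R" "{a. M.e a \<noteq> 1} \<subseteq> R" for R
      using M.riemann_hurwitz[OF that] n by simp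
    show "(\<Sum>a\<in>{a. M.f a = b}. M.e a) = n" for b using M.sum_fiber n by simp
  qed (simp_all add: M.e_pos M.finite_fiber M.finite_ramified[simplified] \<open>odd n\<close>)
  have W: "W = (\<Union>a\<in>C.branch. C.fiber a)"
    unfolding W_def by (rule C.weierstrass_points_eq[OF hC])
  have S: "S = pt ` E.branch"
  proof -
    have "two_torsion E O\<^sub>E = (\<Union>a\<in>E.branch. E.fiber a)"
      using E.two_torsion_eq assms(2,3,8) by (simp add: curve_of_genus_def)
    moreover have "image_point \<pi>\<^sub>E ` E.fiber a = {pt a}" for a
      using E.fiber_nonempty[of a] by (auto simp: E.fiber_def)
    ultimately show ?thesis unfolding S_def by (simp add: image_UN) blast
  qed
  have card_S: "card S = 4" unfolding S using R.card_S by (simp add: card_image inj_on_def pt_inj)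
  have "\<forall>a. \<exists>P. a \<in> C.branch \<longrightarrow> C.fiber a = {P}" by (meson C.fiber_branch)
  \<comment> \<open>Each fiber over a branch point is a singleton, so counting Weierstrass points
    amounts to counting branch points on the line.\<close>
  then obtain pc where pc: "\<And>a. a \<in> C.branch \<Longrightarrow> C.fiber a = {pc a}" by metis
  have W_pc: "W = pc ` C.branch" unfolding W using pc by auto
  have inj_pc: "inj_on pc C.branch" using pc C.fiber_unique by (intro inj_onI) (metis singletonI)
  have card_W: "card W = 6" unfolding W_pc using R.card_B inj_pc by (simp add: card_image)
  have \<phi>pt: "\<phi>pt (pc a) = pt (M.f a)" if "a \<in> C.branch" for a
  proof -
    have "image_point \<pi>\<^sub>C (pc a) = pt a" using pc[OF that] unfolding C.fiber_def by blast
    then show ?thesis by (simp add: \<phi>pt_def M.image_pt)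
  qed
  have card_fib: "card {P \<in> W. \<phi>pt P = pt s} = R.m s" for s
  proof -
    have "{P \<in> W. \<phi>pt P = pt s} = pc ` {a \<in> C.branch. M.f a = s}"
      unfolding W_pc using \<phi>pt by (auto simp: pt_inj)
    moreover have "inj_on pc {a \<in> C.branch. M.f a = s}" using inj_pc by (rule inj_on_subset) auto
    ultimately show ?thesis unfolding R.m_def by (simp add: card_image)
  qed
  obtain s4 where s4: "R.m s4 = 3" "\<forall>s\<in>E.branch - {s4}. R.m s = 1" using R.ex_triple_fiber by blast
  have partition: "\<exists>!(W1, W2). W1 \<union> W2 = W \<and> W1 \<inter> W2 = {} \<and> card W1 = 3 \<and> card W2 = 3
         \<and> card (\<phi>pt ` W1) = 1 \<and> card (\<phi>pt ` W2) = 3"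
  proof (rule ex1_partition_3_3[OF card_W])
    show "card {P \<in> W. \<phi>pt P = pt s4} = 3" using card_fib s4(1) by simp
    fix t assume t: "t \<noteq> pt s4"
    show "card {P \<in> W. \<phi>pt P = t} \<le> 1"
    proof (cases "t \<in> pt ` E.branch")
      case True
      then obtain s where "s \<in> E.branch" "t = pt s" by blast
      moreover from this have "s \<noteq> s4" using t by auto
      ultimately show ?thesis using card_fib[of s] s4(2) by simp
    next
      case False
      then have "{P \<in> W. \<phi>pt P = t} = {}" unfolding W_pc using \<phi>pt R.B_iff by auto
      then show ?thesis by (simp only: card.empty)
    qed
  qed
  have ft: "fiber_type P1 \<phi> (pt b) = R.ft b" for b unfolding R.ft_def by (rule fiber_type_\<phi>)
  have ram_str: "ram_structure P1 P1 \<phi> S Ms Ns" if "R.structured Ms Ns" for Ms Ns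
  proof -
    obtain xs ys where xy: "distinct (xs @ ys)" "set xs = E.branch" "map R.ft xs = Ms" "map R.ft ys = Ns"
      "\<forall>b. b \<notin> set (xs @ ys) \<longrightarrow> R.ft b = {#}"
      using \<open>R.structured Ms Ns\<close> unfolding R.structured_def by blast
    show ?thesis unfolding ram_structure_def
    proof (intro exI conjI)
      show "distinct (map pt xs @ map pt ys)"
        using xy(1) by (simp only: map_append[symmetric] distinct_map) (simp add: inj_on_def pt_inj)
      show "set (map pt xs) = S" using xy(2) S by simp
      show "set (map pt ys) \<subseteq> points P1" using pt_point by auto
      show "map (fiber_type P1 \<phi>) (map pt xs) = Ms" "map (fiber_type P1 \<phi>) (map pt ys) = Ns"
        using xy(3,4) by (simp_all add: ft comp_def)
      show "\<forall>t\<in>points P1 - set (map pt xs @ map pt ys). fiber_type P1 \<phi> t = {#}"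
        using xy(5) by (auto simp: points_P1 ft)
    qed
  qed
  obtain a0 where a0: "M.e a0 = R.std a0 + (if M.f a0 \<in> E.branch then 2 else 1)"
    "\<forall>a. a \<noteq> a0 \<longrightarrow> M.e a = R.std a" using R.ex_exceptional by blast
  note cases = R.classification[OF a0]
  \<comment> \<open>By \<open>\<psi>_point\<close> the index of \<open>\<psi>\<close> is that of
    \<open>\<phi>\<close>, doubled over a branch point of \<open>\<pi>\<^sub>C\<close> and halved if
    the image is one of \<open>\<pi>\<^sub>E\<close>. Standard indices give 1; the exceptional one
    gives 2, 4 / 2 or 3.\<close>
  have ram: "ram_index \<psi> P = (if a = a0 then if a0 \<in> C.branch then 3 else 2 else 1)" if "P \<in> C.fiber a" for P a
  proof (cases "a = a0")
    case True
    have "a0 \<in> C.branch \<Longrightarrow> M.f a0 \<in> E.branch" using branch_iff by blast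
    then show ?thesis
      using True \<psi>_point(2)[OF that] a0(1) by (auto simp: R.std_def split: if_splits)
  next
    case False
    then have "M.e a = R.std a" using a0(2) by blast
    moreover have "a \<in> C.branch \<Longrightarrow> M.f a \<in> E.branch" using branch_iff by blast
    ultimately show ?thesis
      using False \<psi>_point(2)[OF that] by (auto simp: R.std_def split: if_splits)
  qed
  have ram_points: "ram_points C \<psi> = C.fiber a0"
  proof (intro set_eqI iffI)
    fix P assume P: "P \<in> ram_points C \<psi>"
    then have "P \<in> points C" by (simp add: ram_points_def)
    then obtain a where "P \<in> C.fiber a" by (rule C.fiberE)
    then show "P \<in> C.fiber a0" using ram[of P a] P by (auto simp: ram_points_def split: if_splits)
  next
    fix P assume "P \<in> C.fiber a0"
    then show "P \<in> ram_points C \<psi>" using ram[of P a0] C.fiber_point by (auto simp: ram_points_def)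
  qed
  \<comment> \<open>Off the branch points of \<open>\<pi>\<^sub>C\<close> the fiber over
    \<open>a0\<close> is a conjugate pair. Its images are opposite points of E, distinct unless they
    lie in E[2].\<close>
  consider "M.f a0 \<notin> E.branch" | "M.f a0 \<in> E.branch" "a0 \<notin> C.branch" | "a0 \<in> C.branch" by blast
  then have "((\<exists>P Q. P \<noteq> Q \<and> ram_points C \<psi> = {P, Q} \<and> ram_index \<psi> P = 2 \<and> ram_index \<psi> Q = 2
           \<and> image_point \<psi> P \<noteq> image_point \<psi> Q) \<and> M.f a0 \<notin> E.branch) \<or>
      ((\<exists>P Q. P \<noteq> Q \<and> ram_points C \<psi> = {P, Q} \<and> ram_index \<psi> P = 2 \<and> ram_index \<psi> Q = 2
           \<and> image_point \<psi> P = image_point \<psi> Q) \<and> M.f a0 \<in> E.branch \<and> a0 \<notin> C.branch) \<or>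
      ((\<exists>P. ram_points C \<psi> = {P} \<and> ram_index \<psi> P = 3) \<and> a0 \<in> C.branch)"
  proof cases
    case 3
    then show ?thesis using ram[of "pc a0" a0] pc[OF 3] ram_points by auto
  next
    case 1
    then have nb: "a0 \<notin> C.branch" using R.B_iff by blast
    obtain P where P: "C.fiber a0 = {P, \<lambda>z. P (w z)}" "(\<lambda>z. P (w z)) \<noteq> P" by (rule C.fiber_nonbranch[OF nb])
    then have PP: "P \<in> C.fiber a0" "(\<lambda>z. P (w z)) \<in> C.fiber a0" by blast+
    have "image_point \<psi> (\<lambda>z. P (w z)) \<noteq> image_point \<psi> P"
      unfolding image_\<psi>_w[OF PP(1)] by (rule E.fiber_nonbranch_eq(2)[OF 1 \<psi>_point(1)[OF PP(1)]])
    then show ?thesis using ram[OF PP(1)] ram[OF PP(2)] nb 1 P ram_points by metis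
  next
    case 2
    obtain P where P: "C.fiber a0 = {P, \<lambda>z. P (w z)}" "(\<lambda>z. P (w z)) \<noteq> P" by (rule C.fiber_nonbranch[OF 2(2)])
    then have PP: "P \<in> C.fiber a0" "(\<lambda>z. P (w z)) \<in> C.fiber a0" by blast+
    obtain Q where "E.fiber (M.f a0) = {Q}" by (rule E.fiber_branch[OF 2(1)])
    then have "image_point \<psi> (\<lambda>z. P (w z)) = image_point \<psi> P"
      using \<psi>_point(1)[OF PP(1)] \<psi>_point(1)[OF PP(2)] by simp
    then show ?thesis using ram[OF PP(1)] ram[OF PP(2)] 2 P ram_points by metis
  qed
  then show ?thesis
    using card_W card_S partition cases ram_str by meson
qed

end
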